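(* In the Case (2) model, fix $p\ge1$ and assume that for every pair $1\le i,j\le p$ the hypotheses of the preceding $\alpha/\psi^{ij}$-stable limit theorem hold, namely: $\mathbb E[|Z|^{\alpha+\delta}]<\infty$ for some $\delta>0$; $(\sigma_{it}\sigma_{jt})_t$ is strongly mixing with rate $\alpha_n=o(n^{-\delta'})$ for some $\delta'>0$; and one of (i) $\alpha/\psi^{ij}<1$, (ii) $i\ne j$, $\alpha/\psi^{ij}\in[1,2)$ and $Z$ symmetric, (iii) $i=j$, $\alpha/2\in(1,2)$ and $\sup_nn\sum_{h\ge r_n}\alpha_h<\infty$ for some integers $r_n$ with $nr_n/b_n^2\to0$ (where $n\mathbb P(|X_{i0}X_{j0}|>b_n)\to1$); and let $\alpha\in(0,4)$. Then $$a_n^{-2}\big\|\mathbf X^n(\mathbf X^n)'-\widetilde{\mathbf X}^n\big\|_2\xrightarrow{\mathbb P}0,$$ where $\widetilde{\mathbf X}^n$ is the $p\times p$ matrix with entries $\widetilde X_{ij}=\sum_{t=1}^nX_{it}X_{jt}\mathbf 1((i,j)\in\Gamma_p)$. Moreover, if $\mathbb E[e^{\alpha\eta}]=\infty$, then also $a_n^{-2}\|\mathbf X^n(\mathbf X^n)'-\operatorname{diag}(\mathbf X^n(\mathbf X^n)')\|_2\xrightarrow{\mathbb P}0$.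
   Context: Case (2) model: $X_{it}=\sigma_{it}Z_{it}$, $(Z_{it})$ iid independent of $(\sigma_{it})$, $\sigma_{it}=\exp\big(\sum_{k,l}\psi_{kl}\eta_{i-k,t-l}\big)$, $\psi_{kl}\ge0$, $\max\psi_{kl}=1$, $\sum\psi_{kl}<\infty$, $(\eta_{it})$ iid with $\mathbb P(e^\eta>x)=x^{-\alpha}L(x)$, $L$ slowly varying, and either $\mathbb E[e^{\alpha\eta}]=\infty$ or $\lim_{x\to\infty}\mathbb P(\eta_1+\eta_2>x)/\mathbb P(\eta_1>x)\in(0,\infty)$. $\psi^{ij}=\max_{k,l}(\psi_{kl}+\psi_{k+i-j,l})$. $\Gamma_p=\{(i,j):1\le i,j\le p,\ \psi^{ij}=2\}$. $\mathbf X^n=(X_{it})_{1\le i\le p,1\le t\le n}$, $\|\cdot\|_2$ the spectral norm, $\operatorname{diag}(\mathbf A)$ the diagonal part of $\mathbf A$, and $n\,\mathbb P(|X|>a_n)\to1$. *)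

theory Defs
  imports "HOL-Probability.Probability" "HOL-Library.Landau_Symbols"
begin

definition slowly_varying :: "(real \<Rightarrow> real) \<Rightarrow> bool" where
  "slowly_varying L \<longleftrightarrow> (\<forall>\<^sub>F x in at_top. L x > 0) \<and>
     (\<forall>c>0. ((\<lambda>x. L (c * x) / L x) \<longlongrightarrow> 1) at_top)"

definition sv_sigma :: "(int \<Rightarrow> int \<Rightarrow> real) \<Rightarrow> (int \<Rightarrow> int \<Rightarrow> 'a \<Rightarrow> real) \<Rightarrow> int \<Rightarrow> int \<Rightarrow> 'a \<Rightarrow> real" where
  "sv_sigma psi eta i t \<omega> = exp (\<Sum>\<^sub>\<infinity>(k,l)\<in>UNIV. psi k l * eta (i - k) (t - l) \<omega>)"

definition sv_X :: "(int \<Rightarrow> int \<Rightarrow> real) \<Rightarrow> (int \<Rightarrow> int \<Rightarrow> 'a \<Rightarrow> real) \<Rightarrow> (int \<Rightarrow> int \<Rightarrow> 'a \<Rightarrow> real) \<Rightarrow> int \<Rightarrow> int \<Rightarrow> 'a \<Rightarrow> real" where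
  "sv_X psi eta Z i t \<omega> = sv_sigma psi eta i t \<omega> * Z i t \<omega>"

definition psi_sup :: "(int \<Rightarrow> int \<Rightarrow> real) \<Rightarrow> int \<Rightarrow> int \<Rightarrow> real" where
  "psi_sup psi i j = (SUP kl\<in>(UNIV :: (int \<times> int) set). psi (fst kl) (snd kl) + psi (fst kl + i - j) (snd kl))"

definition Gamma_p :: "(int \<Rightarrow> int \<Rightarrow> real) \<Rightarrow> nat \<Rightarrow> (int \<times> int) set" where
  "Gamma_p psi p = {(i,j). 1 \<le> i \<and> i \<le> int p \<and> 1 \<le> j \<and> j \<le> int p \<and> psi_sup psi i j = 2}"

definition gen_sigma :: "'a measure \<Rightarrow> (int \<Rightarrow> 'a \<Rightarrow> real) \<Rightarrow> int set \<Rightarrow> 'a set set" where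
  "gen_sigma M Y S = sigma_sets (space M) (\<Union>s\<in>S. {Y s -` B \<inter> space M | B. B \<in> sets borel})"

definition mixing_coeff :: "'a measure \<Rightarrow> (int \<Rightarrow> 'a \<Rightarrow> real) \<Rightarrow> nat \<Rightarrow> real" where
  "mixing_coeff M Y h = Sup {\<bar>measure M (A \<inter> B) - measure M A * measure M B\<bar> | A B.
      A \<in> gen_sigma M Y {..0} \<and> B \<in> gen_sigma M Y {int h..}}"

definition spec_norm :: "nat \<Rightarrow> (int \<Rightarrow> int \<Rightarrow> real) \<Rightarrow> real" where
  "spec_norm p A = Sup {sqrt (\<Sum>i=1..int p. (\<Sum>j=1..int p. A i j * x j)^2) | x.
      (\<Sum>j=1..int p. (x j)^2) = 1}"

definition conv_prob_zero :: "'a measure \<Rightarrow> (nat \<Rightarrow> 'a \<Rightarrow> real) \<Rightarrow> bool" where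
  "conv_prob_zero M Y \<longleftrightarrow> (\<forall>e>0. ((\<lambda>n. measure M {\<omega>\<in>space M. \<bar>Y n \<omega>\<bar> > e}) \<longlonglongrightarrow> 0))"

end

theory Submission
  imports Defs
begin

text \<open>
  Write \<open>G x = P(\<bar>X\<bar> > x)\<close>. The norm is at most the sum of the absolute values of the entries, so it
  suffices that \<open>a\<^sub>n\<^sup>-\<^sup>2 \<Sum>\<^sub>t X\<^sub>i\<^sub>t X\<^sub>j\<^sub>t\<close> tends to \<open>0\<close> in probability for \<open>i \<noteq> j\<close>. Truncating the summands at
  \<open>a\<^sub>n\<^sup>2\<close> and bounding a first moment (\<open>\<alpha> < 2\<close>), or a second moment when symmetry of \<open>Z\<close> makes the
  truncated summands orthogonal (\<open>\<alpha> < 4\<close>), reduces this to \<open>P(\<bar>X\<^sub>i X\<^sub>j\<bar> > x\<^sup>2) = o(G x)\<close>, because \<open>G\<close>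
  satisfies a Potter inequality with every exponent \<open>\<beta> > \<alpha>\<close>. That inequality holds for
  \<open>exp \<eta>\<close> by regular variation and survives multiplication by any independent nonnegative factor.

  The product \<open>\<sigma>\<^sub>i \<sigma>\<^sub>j\<close> is the exponential of a sum of the innovations with weights at most \<open>2\<close>. If all weights
  stay below \<open>2\<close>, it has a moment of order greater than \<open>\<alpha>/2\<close>. Otherwise the number \<open>k\<close> of weights equal to
  \<open>2\<close> is smaller than the number of weights of \<open>\<sigma>\<^sub>i\<close> equal to \<open>1\<close>, so \<open>P(\<bar>X\<^sub>i X\<^sub>j\<bar> > x\<^sup>2)\<close> is of order at most
  \<open>F\<^sub>k x\<close> and \<open>G x\<close> at least of order \<open>F\<^sub>k\<^sub>+\<^sub>1 x\<close>, where \<open>F\<^sub>k\<close> is the tail of a product of \<open>k\<close> independent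
  copies of \<open>exp \<eta>\<close>. If \<open>exp \<eta>\<close> has infinite \<open>\<alpha>\<close>-th moment, \<open>F\<^sub>k\<^sub>+\<^sub>1 / F\<^sub>k\<close> tends to infinity: by Fatou's
  lemma for \<open>k = 1\<close>, and then by induction.
\<close>

section \<open>Tails of products\<close>

context prob_space
begin

definition upper_tail :: "('a \<Rightarrow> real) \<Rightarrow> real \<Rightarrow> real" where
  "upper_tail A x = prob {\<omega>\<in>space M. x < A \<omega>}"

text \<open>The bound is asked at every level x > 0 and not only at large ones, because an
  independent factor \<open>V\<close> moves the level to x / \<open>V\<close>, which can lie
  anywhere.\<close>

definition potter_bound :: "real \<Rightarrow> ('a \<Rightarrow> real) \<Rightarrow> bool" where
  "potter_bound \<beta> A \<longleftrightarrow> (\<exists>C\<ge>1. \<forall>l\<ge>1. \<forall>x>0.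
     upper_tail (\<lambda>\<omega>. A \<omega> * l) x \<le> C * l powr \<beta> * upper_tail A x)"

lemma upper_tail_nonneg: "0 \<le> upper_tail A x"
  by (simp add: upper_tail_def)

lemma upper_tail_le_1: "upper_tail A x \<le> 1"
  by (simp add: upper_tail_def)

lemma upper_tail_antimono:
  assumes "A \<in> borel_measurable M" "x \<le> y"
  shows "upper_tail A y \<le> upper_tail A x"
  unfolding upper_tail_def using assms by (intro finite_measure_mono) auto

lemma upper_tail_mono_AE:
  assumes [measurable]: "B \<in> borel_measurable M" and "AE \<omega> in M. x < A \<omega> \<longrightarrow> y < B \<omega>"
  shows "upper_tail A x \<le> upper_tail B y"
  unfolding upper_tail_def using assms(2) by (intro finite_measure_mono_AE) auto

lemma upper_tail_cong_AE:
  assumes [measurable]: "A \<in> borel_measurable M" "B \<in> borel_measurable M"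
    and "AE \<omega> in M. A \<omega> = B \<omega>"
  shows "upper_tail A x = upper_tail B x"
  using assms(3) by (intro antisym upper_tail_mono_AE) auto

lemma upper_tail_distr:
  assumes [measurable]: "A \<in> borel_measurable M"
  shows "upper_tail A x = measure (distr M borel A) {x<..}"
  unfolding upper_tail_def by (subst measure_distr) (auto intro!: arg_cong[where f=prob])

lemma upper_tail_scale:
  assumes "0 < v"
  shows "upper_tail (\<lambda>\<omega>. A \<omega> * v) x = upper_tail A (x / v)"
  using assms unfolding upper_tail_def by (simp add: field_simps)

text \<open>Conditioning on \<open>V\<close>: Fubini's theorem for the product of the two laws,
  applied to the set \<open>Q\<close>. The integrability half serves later comparisons under the
  integral.\<close>

lemma upper_tail_indep_mult:
  assumes ind: "indep_var borel A borel V"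
  shows "integrable M (\<lambda>\<omega>. upper_tail (\<lambda>\<omega>'. A \<omega>' * V \<omega>) x)"
    and "upper_tail (\<lambda>\<omega>. A \<omega> * V \<omega>) x = expectation (\<lambda>\<omega>. upper_tail (\<lambda>\<omega>'. A \<omega>' * V \<omega>) x)"
proof -
  have [measurable]: "A \<in> borel_measurable M" "V \<in> borel_measurable M"
    using ind indep_var_rv1 indep_var_rv2 by blast+
  define Q where "Q = {p :: real \<times> real. x < fst p * snd p}"
  have Q: "Q \<in> sets (borel \<Otimes>\<^sub>M borel)"
  proof -
    have "{p \<in> space (borel \<Otimes>\<^sub>M borel :: (real \<times> real) measure). x < fst p * snd p} \<in> sets (borel \<Otimes>\<^sub>M borel)"
      by measurable
    then show ?thesis by (simp add: Q_def space_pair_measure)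
  qed
  interpret A: prob_space "distr M borel A" by (rule prob_space_distr) simp
  interpret V: prob_space "distr M borel V" by (rule prob_space_distr) simp
  interpret AV: pair_prob_space "distr M borel A" "distr M borel V" ..
  define h where "h v = emeasure (distr M borel A) ((\<lambda>u. (u, v)) -` Q)" for v
  have h: "h v = ennreal (upper_tail (\<lambda>\<omega>'. A \<omega>' * v) x)" for v
  proof -
    have "h v = emeasure M (A -` ((\<lambda>u. (u, v)) -` Q) \<inter> space M)"
      unfolding h_def by (subst emeasure_distr) (auto simp: Q_def)
    also have "A -` ((\<lambda>u. (u, v)) -` Q) \<inter> space M = {\<omega>\<in>space M. x < A \<omega> * v}"
      by (auto simp: Q_def)
    finally show ?thesis
      by (simp add: upper_tail_def emeasure_eq_measure)
  qed
  have hm: "h \<in> borel_measurable borel"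
    unfolding h_def using AV.measurable_emeasure_Pair2[OF Q[unfolded sets_pair_measure_cong[OF sets_distr sets_distr, of M borel A M borel V, symmetric]]]
    by simp
  have "(\<lambda>v. enn2real (h v)) \<in> borel_measurable borel"
    using hm by simp
  then have meas: "(\<lambda>v. upper_tail (\<lambda>\<omega>'. A \<omega>' * v) x) \<in> borel_measurable borel"
    by (simp add: h upper_tail_nonneg)
  show int: "integrable M (\<lambda>\<omega>. upper_tail (\<lambda>\<omega>'. A \<omega>' * V \<omega>) x)"
    by (rule integrable_const_bound[where B=1])
      (use meas in \<open>auto simp: upper_tail_nonneg upper_tail_le_1 intro: measurable_compose\<close>)
  have "ennreal (upper_tail (\<lambda>\<omega>. A \<omega> * V \<omega>) x)
      = emeasure (distr M (borel \<Otimes>\<^sub>M borel) (\<lambda>\<omega>. (A \<omega>, V \<omega>))) Q"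
    using Q by (subst emeasure_distr)
      (auto simp: upper_tail_def emeasure_eq_measure Q_def intro!: arg_cong[where f=prob])
  also have "\<dots> = emeasure (distr M borel A \<Otimes>\<^sub>M distr M borel V) Q"
    using ind by (simp add: indep_var_distribution_eq)
  also have "\<dots> = (\<integral>\<^sup>+v. h v \<partial>distr M borel V)"
    unfolding h_def using Q by (intro AV.emeasure_pair_measure_alt2)
      (simp add: sets_pair_measure_cong[OF sets_distr sets_distr])
  also have "\<dots> = (\<integral>\<^sup>+\<omega>. ennreal (upper_tail (\<lambda>\<omega>'. A \<omega>' * V \<omega>) x) \<partial>M)"
    using hm by (subst nn_integral_distr) (auto simp: h)
  also have "\<dots> = ennreal (expectation (\<lambda>\<omega>. upper_tail (\<lambda>\<omega>'. A \<omega>' * V \<omega>) x))"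
    using int by (intro nn_integral_eq_integral) (auto simp: upper_tail_nonneg)
  finally show "upper_tail (\<lambda>\<omega>. A \<omega> * V \<omega>) x
      = expectation (\<lambda>\<omega>. upper_tail (\<lambda>\<omega>'. A \<omega>' * V \<omega>) x)"
    by (simp add: upper_tail_nonneg integral_nonneg_AE)
qed

section \<open>Potter inequalities and multiplication by an independent factor\<close>

lemma potter_boundE:
  assumes "potter_bound \<beta> A"
  obtains C where "C \<ge> 1"
    "\<And>l x. 1 \<le> l \<Longrightarrow> 0 < x \<Longrightarrow> upper_tail (\<lambda>\<omega>. A \<omega> * l) x \<le> C * l powr \<beta> * upper_tail A x"
    "\<And>x y. 0 < x \<Longrightarrow> x \<le> y \<Longrightarrow> upper_tail A x \<le> C * (y / x) powr \<beta> * upper_tail A y"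
proof -
  from assms obtain C where C: "C \<ge> 1"
    "\<And>l x. 1 \<le> l \<Longrightarrow> 0 < x \<Longrightarrow> upper_tail (\<lambda>\<omega>. A \<omega> * l) x \<le> C * l powr \<beta> * upper_tail A x"
    unfolding potter_bound_def by blast
  have "upper_tail A x \<le> C * (y / x) powr \<beta> * upper_tail A y" if "0 < x" "x \<le> y" for x y
    using C(2)[of "y / x" y] upper_tail_scale[of "y / x" A y] that by simp
  with C that show thesis by blast
qed

lemma potter_bound_cong_AE:
  assumes [measurable]: "A \<in> borel_measurable M" "B \<in> borel_measurable M"
    and "AE \<omega> in M. A \<omega> = B \<omega>" "potter_bound \<beta> A"
  shows "potter_bound \<beta> B"
proof -
  have "upper_tail (\<lambda>\<omega>. A \<omega> * l) x = upper_tail (\<lambda>\<omega>. B \<omega> * l) x" for l x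
    by (rule upper_tail_cong_AE) (use assms(3) in auto)
  moreover have "upper_tail A x = upper_tail B x" for x
    by (rule upper_tail_cong_AE) (use assms(3) in auto)
  ultimately show ?thesis using assms(4) by (simp add: potter_bound_def)
qed

text \<open>Given \<open>V\<close> = v > 0, the factor only moves the level from x to x / v, and the
  bound for \<open>A\<close> is uniform in the level; averaging over v keeps the constant. For v = 0
  both tails vanish.\<close>

lemma potter_bound_mult:
  assumes A: "potter_bound \<beta> A" and ind: "indep_var borel A borel V"
    and V: "\<And>\<omega>. 0 \<le> V \<omega>"
  shows "potter_bound \<beta> (\<lambda>\<omega>. A \<omega> * V \<omega>)"
proof -
  from A obtain C where C: "C \<ge> 1"
    "\<And>l x. 1 \<le> l \<Longrightarrow> 0 < x \<Longrightarrow> upper_tail (\<lambda>\<omega>. A \<omega> * l) x \<le> C * l powr \<beta> * upper_tail A x"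
    by (elim potter_boundE) (rule that, blast+)
  have [measurable]: "A \<in> borel_measurable M" "V \<in> borel_measurable M"
    using ind indep_var_rv1 indep_var_rv2 by blast+
  have "upper_tail (\<lambda>\<omega>. A \<omega> * V \<omega> * l) x \<le> C * l powr \<beta> * upper_tail (\<lambda>\<omega>. A \<omega> * V \<omega>) x"
    if lx: "1 \<le> l" "0 < x" for l x
  proof -
    have indl: "indep_var borel A borel (\<lambda>\<omega>. V \<omega> * l)"
      using indep_var_compose[OF ind, of id borel "\<lambda>v. v * l" borel] by (simp add: comp_def)
    have pt: "upper_tail (\<lambda>\<omega>'. A \<omega>' * (v * l)) x \<le> C * l powr \<beta> * upper_tail (\<lambda>\<omega>'. A \<omega>' * v) x"
      if "0 \<le> v" for v
    proof (cases "v = 0")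
      case True
      then show ?thesis using lx C(1) by (simp add: upper_tail_def)
    next
      case False
      then have v: "0 < v" using that by simp
      have "upper_tail (\<lambda>\<omega>'. A \<omega>' * (v * l)) x = upper_tail (\<lambda>\<omega>'. A \<omega>' * l * v) x"
        by (simp add: mult_ac)
      also have "\<dots> = upper_tail (\<lambda>\<omega>'. A \<omega>' * l) (x / v)"
        by (rule upper_tail_scale[OF v])
      also have "\<dots> \<le> C * l powr \<beta> * upper_tail A (x / v)"
        using lx v by (intro C) auto
      finally show ?thesis using v by (simp add: upper_tail_scale)
    qed
    have "upper_tail (\<lambda>\<omega>. A \<omega> * V \<omega> * l) x = expectation (\<lambda>\<omega>. upper_tail (\<lambda>\<omega>'. A \<omega>' * (V \<omega> * l)) x)"
      using upper_tail_indep_mult(2)[OF indl, of x] by (simp add: mult_ac)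
    also have "\<dots> \<le> expectation (\<lambda>\<omega>. C * l powr \<beta> * upper_tail (\<lambda>\<omega>'. A \<omega>' * V \<omega>) x)"
      using upper_tail_indep_mult(1)[OF indl, of x] upper_tail_indep_mult(1)[OF ind, of x] V
      by (intro integral_mono) (auto intro: pt)
    also have "\<dots> = C * l powr \<beta> * upper_tail (\<lambda>\<omega>. A \<omega> * V \<omega>) x"
      using upper_tail_indep_mult(2)[OF ind, of x] by simp
    finally show ?thesis .
  qed
  with C(1) show ?thesis unfolding potter_bound_def by blast
qed

text \<open>One half of Breiman's lemma.\<close>

lemma upper_tail_mult_le:
  assumes T: "potter_bound \<beta> T" "T \<in> borel_measurable M" and \<beta>: "0 \<le> \<beta>"
    and ind: "indep_var borel A borel V" and V: "\<And>\<omega>. 0 \<le> V \<omega>"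
    and int: "integrable M (\<lambda>\<omega>. V \<omega> powr \<beta>)"
    and dom: "\<And>y. 0 < y \<Longrightarrow> upper_tail A y \<le> C1 * upper_tail T y" and "0 \<le> C1"
  shows "\<exists>C2\<ge>0. \<forall>x>0. upper_tail (\<lambda>\<omega>. A \<omega> * V \<omega>) x \<le> C2 * upper_tail T x"
proof -
  from T(1) obtain C where C: "C \<ge> 1"
    "\<And>l x. 1 \<le> l \<Longrightarrow> 0 < x \<Longrightarrow> upper_tail (\<lambda>\<omega>. T \<omega> * l) x \<le> C * l powr \<beta> * upper_tail T x"
    by (elim potter_boundE) (rule that, blast+)
  note [measurable] = T(2)
  \<comment> \<open>Potter's inequality handles v \<ge> 1 and monotonicity of the tail handles v <
    1. The weight \<open>1 + v powr \<beta>\<close> covers both cases and has finite mean under the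
    law of \<open>V\<close>.\<close>
  have pt: "upper_tail (\<lambda>\<omega>. A \<omega> * v) x \<le> (C1 * C * upper_tail T x) * (1 + v powr \<beta>)"
    if "0 \<le> v" "0 < x" for v x
  proof (cases "v = 0")
    case True
    then show ?thesis using that C(1) \<open>0 \<le> C1\<close> upper_tail_nonneg[of T x] by (simp add: upper_tail_def)
  next
    case False
    then have v: "0 < v" using that by simp
    have A: "upper_tail (\<lambda>\<omega>. A \<omega> * v) x \<le> C1 * upper_tail T (x / v)"
      using v that by (simp add: upper_tail_scale dom)
    have "upper_tail T (x / v) \<le> C * upper_tail T x * (1 + v powr \<beta>)"
    proof (cases "v \<ge> 1")
      case True
      then have "upper_tail T (x / v) \<le> C * v powr \<beta> * upper_tail T x"
        using C(2)[of v x] that v by (simp add: upper_tail_scale)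
      also have "\<dots> \<le> C * (1 + v powr \<beta>) * upper_tail T x"
        using C(1) by (intro mult_right_mono mult_left_mono upper_tail_nonneg) auto
      finally show ?thesis by (simp add: mult_ac)
    next
      case False
      then have "x \<le> x / v" using v that by (simp add: field_simps)
      then have "upper_tail T (x / v) \<le> upper_tail T x * 1"
        using upper_tail_antimono by simp
      also have "\<dots> \<le> upper_tail T x * (C * (1 + v powr \<beta>))"
        using C(1) mult_mono[of 1 C 1 "1 + v powr \<beta>"]
        by (intro mult_left_mono upper_tail_nonneg) auto
      finally show ?thesis by (simp add: mult_ac)
    qed
    from order_trans[OF A mult_left_mono[OF this \<open>0 \<le> C1\<close>]] show ?thesis
      by (simp add: mult_ac)
  qed
  define K where "K = expectation (\<lambda>\<omega>. 1 + V \<omega> powr \<beta>)"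
  have "upper_tail (\<lambda>\<omega>. A \<omega> * V \<omega>) x \<le> C1 * C * K * upper_tail T x" if "0 < x" for x
  proof -
    have "upper_tail (\<lambda>\<omega>. A \<omega> * V \<omega>) x = expectation (\<lambda>\<omega>. upper_tail (\<lambda>\<omega>'. A \<omega>' * V \<omega>) x)"
      by (rule upper_tail_indep_mult(2)[OF ind])
    also have "\<dots> \<le> expectation (\<lambda>\<omega>. (C1 * C * upper_tail T x) * (1 + V \<omega> powr \<beta>))"
      using upper_tail_indep_mult(1)[OF ind] int that V by (intro integral_mono pt) auto
    also have "\<dots> = C1 * C * K * upper_tail T x"
      unfolding K_def by simp
    finally show ?thesis .
  qed
  moreover have "0 \<le> C1 * C * K"
    using C(1) \<open>0 \<le> C1\<close> by (auto simp: K_def intro!: mult_nonneg_nonneg integral_nonneg_AE add_nonneg_nonneg)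
  ultimately show ?thesis by blast
qed

text \<open>Otherwise \<open>V\<close> would almost surely be at most 1 / (n + 1) for every n, hence
  at most 0. The bound v \<le> 1 gives x \<le> x / v, the direction in which Potter's inequality is
  applied.\<close>

lemma upper_tail_pos_level:
  assumes [measurable]: "V \<in> borel_measurable M" and "0 < upper_tail V 0"
  obtains v where "0 < v" "v \<le> 1" "0 < upper_tail V v"
proof (rule ccontr)
  assume "\<not> thesis"
  with that have "\<not> 0 < upper_tail V (1 / real (Suc n))" for n
    by (metis (no_types) divide_pos_pos divide_le_eq_1_pos of_nat_0_less_iff
        zero_less_one zero_less_Suc Suc_le_mono le0 of_nat_1 of_nat_le_iff One_nat_def)
  then have 0: "upper_tail V (1 / real (Suc n)) = 0" for n
    using upper_tail_nonneg[of V] by (metis order_less_le)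
  have "AE \<omega> in M. \<not> (1 / real (Suc n) < V \<omega>)" for n
    using 0[of n] by (simp add: upper_tail_def prob_eq_0)
  then have "AE \<omega> in M. \<forall>n. \<not> (1 / real (Suc n) < V \<omega>)"
    by (simp add: AE_all_countable)
  then have "AE \<omega> in M. \<not> 0 < V \<omega>"
    by eventually_elim (metis nat_approx_posE)
  then have "upper_tail V 0 = 0"
    by (simp add: upper_tail_def prob_eq_0)
  with assms show False by simp
qed

text \<open>The counterpart from below: the event \<open>x / v < A\<close>, \<open>v < V\<close>
  forces \<open>x < A * V\<close>, and by independence its probability factors. Potter's inequality
  for \<open>T\<close> compares the levels x and x / v at the cost of a constant.\<close>

lemma upper_tail_mult_ge:
  assumes T: "potter_bound \<beta> T" "T \<in> borel_measurable M"
    and ind: "indep_var borel A borel V" and V: "\<And>\<omega>. 0 \<le> V \<omega>" "0 < upper_tail V 0"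
    and dom: "\<And>y. 0 < y \<Longrightarrow> c1 * upper_tail T y \<le> upper_tail A y" and "0 < c1"
  shows "\<exists>c2>0. \<forall>x>0. c2 * upper_tail T x \<le> upper_tail (\<lambda>\<omega>. A \<omega> * V \<omega>) x"
proof -
  have [measurable]: "A \<in> borel_measurable M" "V \<in> borel_measurable M"
    using ind indep_var_rv1 indep_var_rv2 by blast+
  note [measurable] = T(2)
  obtain v where v: "0 < v" "v \<le> 1" "0 < upper_tail V v"
    using upper_tail_pos_level[OF _ V(2)] by auto
  from T(1) obtain C where C: "C \<ge> 1"
    "\<And>x y. 0 < x \<Longrightarrow> x \<le> y \<Longrightarrow> upper_tail T x \<le> C * (y / x) powr \<beta> * upper_tail T y"
    by (elim potter_boundE) (rule that, blast+)
  define c2 where "c2 = upper_tail V v * c1 / (C * (1 / v) powr \<beta>)"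
  have "c2 > 0" unfolding c2_def using v C(1) \<open>0 < c1\<close> by auto
  moreover have "c2 * upper_tail T x \<le> upper_tail (\<lambda>\<omega>. A \<omega> * V \<omega>) x" if "0 < x" for x
  proof -
    have xv: "x \<le> x / v" using v that by (simp add: field_simps)
    have "upper_tail T x \<le> C * (1 / v) powr \<beta> * upper_tail T (x / v)"
      using C(2)[OF that xv] that by (simp add: field_simps)
    then have "c2 * upper_tail T x \<le> c2 * (C * (1 / v) powr \<beta> * upper_tail T (x / v))"
      using \<open>c2 > 0\<close> by simp
    also have "\<dots> = upper_tail V v * (c1 * upper_tail T (x / v))"
      using C(1) v by (simp add: c2_def)
    also have "\<dots> \<le> upper_tail V v * upper_tail A (x / v)"
      using that v by (intro mult_left_mono dom) (auto simp: upper_tail_nonneg)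
    also have "\<dots> = prob {\<omega>\<in>space M. x / v < A \<omega> \<and> v < V \<omega>}"
    proof -
      have "prob (A -` {x / v<..} \<inter> space M \<inter> (V -` {v<..} \<inter> space M))
        = prob (A -` {x / v<..} \<inter> space M) * prob (V -` {v<..} \<inter> space M)"
        using indep_varD[OF ind, of "{x / v<..}" "{v<..}"]
        by (simp add: vimage_Times Int_def conj_ac vimage_def)
      moreover have "A -` {x / v<..} \<inter> space M \<inter> (V -` {v<..} \<inter> space M)
          = {\<omega>\<in>space M. x / v < A \<omega> \<and> v < V \<omega>}"
        "A -` {x / v<..} \<inter> space M = {\<omega>\<in>space M. x / v < A \<omega>}"
        "V -` {v<..} \<inter> space M = {\<omega>\<in>space M. v < V \<omega>}" by auto
      ultimately show ?thesis by (simp add: upper_tail_def mult.commute)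
    qed
    also have "\<dots> \<le> upper_tail (\<lambda>\<omega>. A \<omega> * V \<omega>) x"
      unfolding upper_tail_def
    proof (intro finite_measure_mono subsetI)
      fix \<omega> assume "\<omega> \<in> {\<omega> \<in> space M. x / v < A \<omega> \<and> v < V \<omega>}"
      then have h: "\<omega> \<in> space M" "x / v < A \<omega>" "v < V \<omega>" by auto
      have "0 < x / v" using that v by simp
      then have "x / v * v < A \<omega> * V \<omega>" using h v by (intro mult_strict_mono) auto
      then show "\<omega> \<in> {\<omega> \<in> space M. x < A \<omega> * V \<omega>}" using h v by simp
    qed auto
    finally show ?thesis .
  qed
  ultimately show ?thesis by blast
qed

end

section \<open>Regularly varying tails\<close>

locale regvar_tail = prob_space +
  fixes U :: "'a \<Rightarrow> real" and \<alpha> :: real and L :: "real \<Rightarrow> real"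
  assumes U_meas [measurable]: "U \<in> borel_measurable M"
    and U_pos: "\<And>\<omega>. 0 < U \<omega>"
    and alpha_pos: "0 < \<alpha>"
    and sv: "slowly_varying L"
    and tail_eq: "\<And>x. 0 < x \<Longrightarrow> upper_tail U x = x powr (-\<alpha>) * L x"
begin

lemma upper_tail_ratio:
  assumes "0 < c"
  shows "((\<lambda>x. upper_tail U (c * x) / upper_tail U x) \<longlongrightarrow> c powr (-\<alpha>)) at_top"
proof (rule Lim_transform_eventually)
  have "((\<lambda>x. L (c * x) / L x) \<longlongrightarrow> 1) at_top"
    using sv assms by (simp add: slowly_varying_def)
  from tendsto_mult_left[OF this, of "c powr (-\<alpha>)"]
  show "((\<lambda>x. c powr (-\<alpha>) * (L (c * x) / L x)) \<longlongrightarrow> c powr (-\<alpha>)) at_top"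
    by simp
  show "\<forall>\<^sub>F x in at_top. c powr (-\<alpha>) * (L (c * x) / L x) = upper_tail U (c * x) / upper_tail U x"
    using eventually_gt_at_top[of 0]
    by eventually_elim (use assms in \<open>auto simp: tail_eq powr_mult\<close>)
qed

text \<open>\<open>L\<close> is positive far out, hence so is the tail there, and the tail only
  increases towards smaller levels.\<close>

lemma upper_tail_pos: "0 < upper_tail U x"
proof -
  have "\<forall>\<^sub>F y in at_top. L y > 0"
    using sv by (simp add: slowly_varying_def)
  then have "\<forall>\<^sub>F y in at_top. L y > 0 \<and> y > 0 \<and> y \<ge> x"
    by (intro eventually_conj eventually_gt_at_top eventually_ge_at_top)
  then obtain y where "L y > 0" "y > 0" "y \<ge> x"
    using eventually_happens'[OF trivial_limit_at_top_linorder] by blast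
  then have "0 < upper_tail U y" by (simp add: tail_eq)
  with upper_tail_antimono[OF U_meas \<open>y \<ge> x\<close>] show ?thesis by simp
qed

text \<open>The ratio 2 is enough for the Potter bound, since monotonicity of the tail fills the
  gaps between powers of 2; no uniform convergence in the ratio enters. The limit
  \<open>2 powr (-\<alpha>)\<close> leaves room for every \<beta> > \<alpha> here and every \<gamma>
  < \<alpha> in \<open>doubling_le\<close>.\<close>

lemma doubling_ge:
  assumes "\<alpha> < \<beta>"
  obtains x0 where "0 < x0" "\<And>x. x0 \<le> x \<Longrightarrow> 2 powr (-\<beta>) * upper_tail U x \<le> upper_tail U (2 * x)"
proof -
  have "2 powr (-\<beta>) < 2 powr (-\<alpha>)" using assms by simp
  from order_tendstoD(1)[OF upper_tail_ratio[of 2] this]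
  have "\<forall>\<^sub>F x in at_top. 2 powr (-\<beta>) < upper_tail U (2 * x) / upper_tail U x" by simp
  then obtain x0 where x0: "\<And>x. x0 \<le> x \<Longrightarrow> 2 powr (-\<beta>) < upper_tail U (2 * x) / upper_tail U x"
    by (auto simp: eventually_at_top_linorder)
  show thesis
  proof (rule that[of "max 1 x0"])
    show "2 powr (-\<beta>) * upper_tail U x \<le> upper_tail U (2 * x)" if "max 1 x0 \<le> x" for x
      using x0[of x] that upper_tail_pos[of x] by (simp add: pos_less_divide_eq)
  qed simp
qed

lemma doubling_le:
  assumes "\<gamma> < \<alpha>"
  obtains x0 where "0 < x0" "\<And>x. x0 \<le> x \<Longrightarrow> upper_tail U (2 * x) \<le> 2 powr (-\<gamma>) * upper_tail U x"
proof -
  have "2 powr (-\<alpha>) < 2 powr (-\<gamma>)" using assms by simp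
  from order_tendstoD(2)[OF upper_tail_ratio[of 2] this]
  have "\<forall>\<^sub>F x in at_top. upper_tail U (2 * x) / upper_tail U x < 2 powr (-\<gamma>)" by simp
  then obtain x0 where x0: "\<And>x. x0 \<le> x \<Longrightarrow> upper_tail U (2 * x) / upper_tail U x < 2 powr (-\<gamma>)"
    by (auto simp: eventually_at_top_linorder)
  show thesis
  proof (rule that[of "max 1 x0"])
    show "upper_tail U (2 * x) \<le> 2 powr (-\<gamma>) * upper_tail U x" if "max 1 x0 \<le> x" for x
      using x0[of x] that upper_tail_pos[of x] by (simp add: pos_divide_less_eq)
  qed simp
qed

text \<open>Above \<open>x0\<close> the doubling estimate is iterated. Below \<open>x0\<close> the
  tail lies between \<open>upper_tail U x0\<close>, which is positive, and 1, so a constant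
  suffices.\<close>

lemma potter:
  assumes "\<alpha> < \<beta>"
  shows "potter_bound \<beta> U"
proof -
  have \<beta>: "0 < \<beta>" using alpha_pos assms by simp
  obtain x0 where x0: "0 < x0" "\<And>x. x0 \<le> x \<Longrightarrow> 2 powr (-\<beta>) * upper_tail U x \<le> upper_tail U (2 * x)"
    using doubling_ge[OF assms] by blast
  have pow: "2 powr (- \<beta> * real k) * upper_tail U x \<le> upper_tail U (2 ^ k * x)" if "x0 \<le> x" for k x
  proof (induction k)
    case (Suc k)
    have "2 powr (- \<beta> * real (Suc k)) * upper_tail U x
        = 2 powr (-\<beta>) * (2 powr (- \<beta> * real k) * upper_tail U x)"
      by (simp add: powr_add[symmetric] algebra_simps flip: powr_add mult.assoc)
    also have "\<dots> \<le> 2 powr (-\<beta>) * upper_tail U (2 ^ k * x)"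
      using Suc by (intro mult_left_mono) auto
    also have "\<dots> \<le> upper_tail U (2 * (2 ^ k * x))"
    proof (rule x0)
      have "1 * x \<le> 2 ^ k * x" using that x0 by (intro mult_right_mono) auto
      then show "x0 \<le> 2 ^ k * x" using that by simp
    qed
    finally show ?case by (simp add: mult.assoc)
  qed simp
  have far: "upper_tail U x \<le> 2 powr \<beta> * l powr \<beta> * upper_tail U (l * x)"
    if "x0 \<le> x" "1 \<le> l" for x l
  proof -
    \<comment> \<open>Rounding up gives l \<le> 2^k \<le> 2 l, so passing to a power of 2 costs at
      most the factor \<open>2 powr \<beta>\<close>.\<close>
    define k where "k = nat \<lceil>log 2 l\<rceil>"
    have "0 \<le> log 2 l" using that by simp
    then have k: "log 2 l \<le> k" "k < log 2 l + 1" unfolding k_def by linarith+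
    have "l = 2 powr (log 2 l)" using that by simp
    also have "\<dots> \<le> 2 powr k" using k by simp
    finally have "l \<le> 2 ^ k" by (simp add: powr_realpow)
    have "2 powr k \<le> 2 powr (log 2 l + 1)" using k by simp
    then have "(2 powr k) powr \<beta> \<le> (2 * l) powr \<beta>"
      using that \<beta> by (intro powr_mono2) (auto simp: powr_add)
    then have kb: "2 powr (\<beta> * k) \<le> 2 powr \<beta> * l powr \<beta>"
      using that by (simp add: powr_powr powr_mult mult.commute)
    have "upper_tail U x = 2 powr (\<beta> * k) * (2 powr (- \<beta> * k) * upper_tail U x)"
      by (simp add: powr_minus field_simps)
    also have "\<dots> \<le> 2 powr (\<beta> * k) * upper_tail U (2 ^ k * x)"
      using pow[OF that(1)] by (intro mult_left_mono) auto
    also have "\<dots> \<le> 2 powr (\<beta> * k) * upper_tail U (l * x)"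
      using \<open>l \<le> 2 ^ k\<close> that x0 by (intro mult_left_mono upper_tail_antimono mult_right_mono) auto
    also have "\<dots> \<le> 2 powr \<beta> * l powr \<beta> * upper_tail U (l * x)"
      using kb by (intro mult_right_mono upper_tail_nonneg)
    finally show ?thesis .
  qed
  \<comment> \<open>Dividing by \<open>upper_tail U x0\<close> pays for levels below
    \<open>x0\<close>, where the tail is bounded by 1 only.\<close>
  define C where "C = 2 powr \<beta> / upper_tail U x0"
  have tx: "0 < upper_tail U x0" "upper_tail U x0 \<le> 1"
    using upper_tail_pos upper_tail_le_1 by auto
  have two: "1 \<le> (2::real) powr \<beta>" using \<beta> by (intro ge_one_powr_ge_zero) auto
  have C2: "2 powr \<beta> \<le> C" unfolding C_def using tx by (simp add: pos_le_divide_eq)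
  have main: "upper_tail U x \<le> C * l powr \<beta> * upper_tail U (l * x)" if "0 < x" "1 \<le> l" for x l
  proof -
    have lb: "1 \<le> l powr \<beta>" using that \<beta> by (intro ge_one_powr_ge_zero) auto
    consider "x0 \<le> x" | "x < x0" "l * x \<le> x0" | "x < x0" "x0 < l * x" by linarith
    then show ?thesis
    proof cases
      case 1
      have "upper_tail U x \<le> 2 powr \<beta> * l powr \<beta> * upper_tail U (l * x)"
        by (rule far[OF 1 that(2)])
      also have "\<dots> \<le> C * l powr \<beta> * upper_tail U (l * x)"
        by (intro mult_right_mono C2 upper_tail_nonneg) auto
      finally show ?thesis .
    next
      case 2
      have "upper_tail U x * (upper_tail U x0 * 1) \<le> 1 * (upper_tail U (l * x) * (2 powr \<beta> * l powr \<beta>))"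
        using 2 two lb mult_mono[OF two lb]
        by (intro mult_mono upper_tail_le_1 upper_tail_antimono)
          (auto simp: upper_tail_nonneg)
      then show ?thesis unfolding C_def using tx by (simp add: field_simps)
    next
      case 3
      \<comment> \<open>The levels x and l x lie on different sides of \<open>x0\<close>: the
        estimate restarts at \<open>x0\<close> with the ratio \<open>l * x / x0\<close>, which is at
        most l.\<close>
      have "upper_tail U x \<le> 1" by (rule upper_tail_le_1)
      also have "1 = upper_tail U x0 / upper_tail U x0" using tx by simp
      also have "\<dots> \<le> (2 powr \<beta> * (l * x / x0) powr \<beta> * upper_tail U (l * x)) / upper_tail U x0"
        using far[of x0 "l * x / x0"] 3 x0 tx by (intro divide_right_mono) auto
      also have "\<dots> = C * (l * x / x0) powr \<beta> * upper_tail U (l * x)"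
        by (simp add: C_def)
      also have "\<dots> \<le> C * l powr \<beta> * upper_tail U (l * x)"
      proof -
        have "l * x / x0 \<le> l" using 3 x0 that by (simp add: field_simps)
        then have "(l * x / x0) powr \<beta> \<le> l powr \<beta>"
          using \<beta> x0 that by (intro powr_mono2) auto
        then show ?thesis using C2 two by (intro mult_right_mono mult_left_mono upper_tail_nonneg) auto
      qed
      finally show ?thesis .
    qed
  qed
  show ?thesis unfolding potter_bound_def
  proof (intro exI[of _ C] conjI allI impI)
    show "1 \<le> C" using C2 two by simp
    fix l x :: real assume lx: "1 \<le> l" "0 < x"
    then show "upper_tail (\<lambda>\<omega>. U \<omega> * l) x \<le> C * l powr \<beta> * upper_tail U x"
      using main[of "x / l" l] by (simp add: upper_tail_scale)
  qed
qed

text \<open>Split the range of \<open>U\<close> above \<open>x0\<close> into dyadic layers. On the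
  k-th layer \<open>U powr s\<close> is of order 2^(k s), while the layer has probability at most
  2^(-\<gamma> k) with s < \<gamma> < \<alpha>, so a geometric series bounds the moment.\<close>

lemma moment_finite:
  assumes s: "0 \<le> s" "s < \<alpha>"
  shows "integrable M (\<lambda>\<omega>. U \<omega> powr s)"
proof -
  obtain \<gamma> where \<gamma>: "s < \<gamma>" "\<gamma> < \<alpha>" using dense[OF s(2)] by blast
  obtain x0 where x0: "0 < x0" "\<And>x. x0 \<le> x \<Longrightarrow> upper_tail U (2 * x) \<le> 2 powr (-\<gamma>) * upper_tail U x"
    using doubling_le[OF \<gamma>(2)] by blast
  have pow: "upper_tail U (2 ^ k * x0) \<le> 2 powr (- \<gamma> * real k)" for k
  proof (induction k)
    case (Suc k)
    have "upper_tail U (2 ^ Suc k * x0) = upper_tail U (2 * (2 ^ k * x0))"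
      by (simp add: mult.assoc)
    also have "\<dots> \<le> 2 powr (-\<gamma>) * upper_tail U (2 ^ k * x0)"
    proof (rule x0)
      have "1 * x0 \<le> 2 ^ k * x0" using x0 by (intro mult_right_mono) auto
      then show "x0 \<le> 2 ^ k * x0" by simp
    qed
    also have "\<dots> \<le> 2 powr (-\<gamma>) * 2 powr (- \<gamma> * real k)"
      using Suc by (intro mult_left_mono) auto
    also have "\<dots> = 2 powr (- \<gamma> * real (Suc k))"
      by (simp add: algebra_simps flip: powr_add)
    finally show ?case .
  qed (simp add: upper_tail_le_1)
  define c where "c k = (2 ^ Suc k * x0) powr s" for k :: nat
  define E where "E k = {\<omega>\<in>space M. 2 ^ k * x0 < U \<omega>}" for k :: nat
  have [measurable]: "E k \<in> sets M" for k unfolding E_def by measurable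
  have "(\<integral>\<^sup>+\<omega>. ennreal (U \<omega> powr s) \<partial>M) \<le> (\<integral>\<^sup>+\<omega>. ennreal (x0 powr s) + (\<Sum>k. ennreal (c k) * indicator (E k) \<omega>) \<partial>M)"
  proof (intro nn_integral_mono)
    fix \<omega> assume \<omega>: "\<omega> \<in> space M"
    show "ennreal (U \<omega> powr s) \<le> ennreal (x0 powr s) + (\<Sum>k. ennreal (c k) * indicator (E k) \<omega>)"
    proof (cases "U \<omega> \<le> x0")
      case True
      then have "ennreal (U \<omega> powr s) \<le> ennreal (x0 powr s)"
        using s U_pos[of \<omega>] by (intro ennreal_leI powr_mono2) auto
      then show ?thesis by (simp add: add_increasing2)
    next
      case False
      define y where "y = U \<omega> / x0"
      have y: "1 < y" using False x0 by (simp add: y_def)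
      have "\<exists>k. y \<le> 2 ^ k"
        using real_arch_pow[of 2 y] by (auto intro: less_imp_le)
      \<comment> \<open>The least exponent k is positive because y > 1, so its predecessor j
        satisfies 2^j < y \<le> 2^(j+1) and names the layer of \<omega>.\<close>
      then obtain k where k: "y \<le> 2 ^ k" "\<And>j. j < k \<Longrightarrow> \<not> y \<le> 2 ^ j"
        using LeastI_ex[of "\<lambda>k. y \<le> 2 ^ k"] not_less_Least[of _ "\<lambda>k. y \<le> 2 ^ k"] by blast
      have "k \<noteq> 0" using k(1) y by (cases k) auto
      then obtain j where j: "k = Suc j" by (cases k) auto
      have "2 ^ j < y" using k(2)[of j] j by simp
      then have "\<omega> \<in> E j" using \<omega> x0 by (simp add: E_def y_def field_simps)
      have "U \<omega> \<le> 2 ^ Suc j * x0" using k(1) x0 j by (simp add: y_def field_simps)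
      then have "ennreal (U \<omega> powr s) \<le> ennreal (c j) * indicator (E j) \<omega>"
        using \<open>\<omega> \<in> E j\<close> s U_pos[of \<omega>] unfolding c_def by (auto intro!: powr_mono2 ennreal_leI)
      also have "\<dots> \<le> (\<Sum>k. ennreal (c k) * indicator (E k) \<omega>)"
        using sum_le_suminf[OF summableI, of "{j}" "\<lambda>k. ennreal (c k) * indicator (E k) \<omega>"]
        by (simp del: sum_mult_indicator)
      finally show ?thesis by (simp add: add_increasing)
    qed
  qed
  also have "\<dots> = ennreal (x0 powr s) + (\<Sum>k. ennreal (c k) * emeasure M (E k))"
    by (subst nn_integral_add) (auto simp: nn_integral_suminf nn_integral_cmult_indicator emeasure_space_1)
  also have "(\<Sum>k. ennreal (c k) * emeasure M (E k)) \<le> (\<Sum>k. ennreal ((2 * x0) powr s * (2 powr (s - \<gamma>)) ^ k))"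
  proof (rule suminf_le)
    fix k
    have "ennreal (c k) * emeasure M (E k) = ennreal (c k * upper_tail U (2 ^ k * x0))"
      by (simp add: emeasure_eq_measure E_def upper_tail_def ennreal_mult c_def)
    also have "\<dots> \<le> ennreal (c k * 2 powr (- \<gamma> * real k))"
      using pow[of k] by (intro ennreal_leI mult_left_mono) (auto simp: c_def)
    also have "c k * 2 powr (- \<gamma> * real k) = (2 * x0) powr s * (2 powr (s - \<gamma>)) ^ k"
    proof -
      have "c k = (2 * x0 * 2 powr k) powr s" by (simp add: c_def powr_realpow mult_ac)
      also have "\<dots> = (2 * x0) powr s * 2 powr (k * s)"
        using x0 by (simp add: powr_mult powr_powr)
      finally show ?thesis
        by (simp add: powr_power algebra_simps flip: powr_add)
    qed
    finally show "ennreal (c k) * emeasure M (E k) \<le> ennreal ((2 * x0) powr s * (2 powr (s - \<gamma>)) ^ k)" .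
  qed auto
  also have "\<dots> < \<infinity>"
  proof -
    have "2 powr (s - \<gamma>) < (2::real) powr 0" using \<gamma> by (intro powr_less_mono) auto
    then have "summable (\<lambda>k. (2 * x0) powr s * (2 powr (s - \<gamma>)) ^ k)"
      by (intro summable_mult summable_geometric) auto
    then have "(\<Sum>k. ennreal ((2 * x0) powr s * (2 powr (s - \<gamma>)) ^ k)) = ennreal (\<Sum>k. (2 * x0) powr s * (2 powr (s - \<gamma>)) ^ k)"
      by (intro suminf_ennreal2) auto
    then show ?thesis by simp
  qed
  finally show ?thesis
    by (intro integrableI_nonneg) (auto simp: top.not_eq_extremum)
qed

end

section \<open>Weighted sums of an iid sequence\<close>

locale iid_sequence = prob_space +
  fixes \<epsilon> :: "nat \<Rightarrow> 'a \<Rightarrow> real" and \<alpha> :: real and L :: "real \<Rightarrow> real"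
  assumes indep: "indep_vars (\<lambda>_. borel) \<epsilon> UNIV"
    and ident: "\<And>n. distr M borel (\<epsilon> n) = distr M borel (\<epsilon> 0)"
    and alpha_pos: "0 < \<alpha>"
    and sv: "slowly_varying L"
    and tail_eq: "\<And>x. 0 < x \<Longrightarrow> upper_tail (\<lambda>\<omega>. exp (\<epsilon> 0 \<omega>)) x = x powr (-\<alpha>) * L x"
begin

lemma eps_meas [measurable]: "\<epsilon> n \<in> borel_measurable M"
  using indep by (simp add: indep_vars_def)

lemma upper_tail_eps: "upper_tail (\<lambda>\<omega>. exp (\<epsilon> n \<omega>)) x = upper_tail (\<lambda>\<omega>. exp (\<epsilon> 0 \<omega>)) x"
proof -
  have "distr M borel (\<lambda>\<omega>. exp (\<epsilon> n \<omega>)) = distr (distr M borel (\<epsilon> n)) borel exp" for n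
    by (subst distr_distr) (auto simp: comp_def)
  then have "distr M borel (\<lambda>\<omega>. exp (\<epsilon> n \<omega>)) = distr M borel (\<lambda>\<omega>. exp (\<epsilon> 0 \<omega>))"
    using ident[of n] by simp
  then show ?thesis by (simp add: upper_tail_distr)
qed

lemma regvar_tail_eps: "regvar_tail M (\<lambda>\<omega>. exp (\<epsilon> n \<omega>)) \<alpha> L"
proof unfold_locales
  show "upper_tail (\<lambda>\<omega>. exp (\<epsilon> n \<omega>)) x = x powr (-\<alpha>) * L x" if "0 < x" for x
    using tail_eq[OF that] by (simp only: upper_tail_eps[of n])
qed (use alpha_pos sv in auto)

definition wsum :: "(nat \<Rightarrow> real) \<Rightarrow> 'a \<Rightarrow> real" where
  "wsum w \<omega> = (\<Sum>n. w n * \<epsilon> n \<omega>)"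

text \<open>Where the series diverges \<open>suminf\<close> has an unspecified value, so additivity
  and scaling of \<open>wsum\<close> are claimed almost surely and for admissible weights. Smaller
  nonnegative weights, sums and nonnegative multiples stay admissible.\<close>

definition admissible :: "(nat \<Rightarrow> real) \<Rightarrow> bool" where
  "admissible w \<longleftrightarrow> (\<forall>n. 0 \<le> w n) \<and> summable w \<and> (AE \<omega> in M. summable (\<lambda>n. \<bar>w n * \<epsilon> n \<omega>\<bar>))"

lemma wsum_meas [measurable]: "wsum w \<in> borel_measurable M"
  unfolding wsum_def[abs_def] by measurable

text \<open>The two sums read disjoint groups of independent variables. Convergence is irrelevant:
  each sum is, at every point, a fixed measurable functional of its own group.\<close>

lemma wsum_indep:
  assumes "\<And>n. u n = 0 \<or> v n = 0"
  shows "indep_var borel (wsum u) borel (wsum v)"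
proof -
  define A where "A = {n. u n \<noteq> 0}"
  \<comment> \<open>The guard makes the functional depend on coordinates in \<open>S\<close> only,
    as measurability on the product over \<open>S\<close> demands. It changes nothing below, since
    \<open>u\<close> vanishes off \<open>A\<close> and \<open>v\<close> on \<open>A\<close>.\<close>
  define g where "g S w x = (\<Sum>n. if n \<in> S then w n * x n else 0)"
    for S and w x :: "nat \<Rightarrow> real"
  have [measurable]: "g S w \<in> borel_measurable (PiM S (\<lambda>_. borel))" for S w
    unfolding g_def[abs_def]
  proof (rule borel_measurable_suminf)
    show "(\<lambda>x. if n \<in> S then w n * x n else 0) \<in> borel_measurable (PiM S (\<lambda>_. borel))" for n
      by (cases "n \<in> S") (auto intro!: borel_measurable_times measurable_component_singleton)
  qed
  have "indep_var (PiM A (\<lambda>_. borel)) (\<lambda>\<omega>. restrict (\<lambda>n. \<epsilon> n \<omega>) A)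
      (PiM (-A) (\<lambda>_. borel)) (\<lambda>\<omega>. restrict (\<lambda>n. \<epsilon> n \<omega>) (-A))"
    by (rule indep_var_restrict[OF indep]) auto
  from indep_var_compose[OF this, of "g A u" borel "g (-A) v" borel]
  have "indep_var borel (\<lambda>\<omega>. g A u (restrict (\<lambda>n. \<epsilon> n \<omega>) A))
      borel (\<lambda>\<omega>. g (-A) v (restrict (\<lambda>n. \<epsilon> n \<omega>) (-A)))"
    by (simp add: comp_def)
  moreover have "g A u (restrict (\<lambda>n. \<epsilon> n \<omega>) A) = wsum u \<omega>" for \<omega>
    unfolding g_def wsum_def by (intro suminf_cong) (auto simp: A_def)
  moreover have "g (-A) v (restrict (\<lambda>n. \<epsilon> n \<omega>) (-A)) = wsum v \<omega>" for \<omega>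
    unfolding g_def wsum_def using assms by (intro suminf_cong) (auto simp: A_def)
  ultimately show ?thesis by simp
qed

lemma exp_wsum_indep:
  assumes "\<And>n. u n = 0 \<or> v n = 0"
  shows "indep_var borel (\<lambda>\<omega>. exp (wsum u \<omega>)) borel (\<lambda>\<omega>. exp (wsum v \<omega>))"
  using indep_var_compose[OF wsum_indep[OF assms], of exp borel exp borel] by (simp add: comp_def)

lemma wsum_add:
  assumes "admissible u" "admissible v"
  shows "AE \<omega> in M. wsum (\<lambda>n. u n + v n) \<omega> = wsum u \<omega> + wsum v \<omega>"
proof -
  have "AE \<omega> in M. summable (\<lambda>n. \<bar>u n * \<epsilon> n \<omega>\<bar>)" "AE \<omega> in M. summable (\<lambda>n. \<bar>v n * \<epsilon> n \<omega>\<bar>)"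
    using assms by (auto simp: admissible_def)
  then show ?thesis
  proof eventually_elim
    case (elim \<omega>)
    then show ?case
      unfolding wsum_def by (subst suminf_add) (auto dest: summable_rabs_cancel simp: algebra_simps)
  qed
qed

lemma wsum_scale: "admissible w \<Longrightarrow> AE \<omega> in M. wsum (\<lambda>n. q * w n) \<omega> = q * wsum w \<omega>"
  unfolding admissible_def wsum_def
  by (elim conjE, erule eventually_mono)
    (auto dest: summable_rabs_cancel simp: suminf_mult[symmetric] mult.assoc)

lemma admissible_mono:
  assumes "admissible w" "\<And>n. 0 \<le> u n" "\<And>n. u n \<le> w n"
  shows "admissible u"
  unfolding admissible_def
proof (intro conjI allI)
  show "summable u"
  proof (rule summable_comparison_test'[of w 0])
    show "summable w" using assms(1) by (simp add: admissible_def)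
    show "norm (u n) \<le> w n" for n using assms(2,3)[of n] by simp
  qed
  have "AE \<omega> in M. summable (\<lambda>n. \<bar>w n * \<epsilon> n \<omega>\<bar>)" using assms by (simp add: admissible_def)
  then show "AE \<omega> in M. summable (\<lambda>n. \<bar>u n * \<epsilon> n \<omega>\<bar>)"
  proof eventually_elim
    case (elim \<omega>)
    show ?case
    proof (rule summable_comparison_test'[OF elim])
      show "norm \<bar>u n * \<epsilon> n \<omega>\<bar> \<le> \<bar>w n * \<epsilon> n \<omega>\<bar>" for n
        using assms(2)[of n] assms(3)[of n] by (auto simp: abs_mult intro!: mult_right_mono)
    qed
  qed
qed (use assms in auto)

lemma admissible_add:
  assumes "admissible u" "admissible v"
  shows "admissible (\<lambda>n. u n + v n)"
  unfolding admissible_def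
proof (intro conjI allI)
  have "AE \<omega> in M. summable (\<lambda>n. \<bar>u n * \<epsilon> n \<omega>\<bar>)" "AE \<omega> in M. summable (\<lambda>n. \<bar>v n * \<epsilon> n \<omega>\<bar>)"
    using assms by (auto simp: admissible_def)
  then show "AE \<omega> in M. summable (\<lambda>n. \<bar>(u n + v n) * \<epsilon> n \<omega>\<bar>)"
  proof eventually_elim
    case (elim \<omega>)
    show ?case
      by (rule summable_comparison_test'[OF summable_add[OF elim], of 0])
        (auto simp: distrib_right abs_triangle_ineq)
  qed
qed (use assms in \<open>auto simp: admissible_def intro: summable_add\<close>)

lemma admissible_scale: "admissible w \<Longrightarrow> 0 \<le> q \<Longrightarrow> admissible (\<lambda>n. q * w n)"
  unfolding admissible_def
  by (auto simp: abs_mult mult.assoc intro: summable_mult elim!: eventually_mono)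

lemma admissible_indicator: "finite S \<Longrightarrow> admissible (indicator S)"
  unfolding admissible_def by (auto intro!: summable_finite[of S] simp: indicator_def)

lemma wsum_indicator: "finite S \<Longrightarrow> wsum (indicator S) \<omega> = (\<Sum>n\<in>S. \<epsilon> n \<omega>)"
  unfolding wsum_def by (subst suminf_finite[of S]) auto

text \<open>Convexity of exp between 0 and s y bounds the mean of
  \<open>exp (w n * \<epsilon> n)\<close> by \<open>1 + w n / s * K\<close>, hence by
  \<open>exp (w n / s * K)\<close>. Multiplying over independent factors bounds all partial products
  by \<open>exp (suminf w / s * K)\<close>, and Fatou's lemma passes to the infinite sum.\<close>

lemma wsum_moment:
  assumes w: "admissible w" and s: "0 < s" "s < \<alpha>" "\<And>n. w n \<le> s"
  shows "integrable M (\<lambda>\<omega>. exp (wsum w \<omega>))"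
proof -
  have w0: "0 \<le> w n" for n using w by (simp add: admissible_def)
  have sw: "summable w" using w by (simp add: admissible_def)
  define K where "K = expectation (\<lambda>\<omega>. exp (s * \<epsilon> 0 \<omega>))"
  have int: "integrable M (\<lambda>\<omega>. exp (s * \<epsilon> n \<omega>))" for n
    using regvar_tail.moment_finite[OF regvar_tail_eps, of s n] s by (simp add: powr_def)
  have K: "expectation (\<lambda>\<omega>. exp (s * \<epsilon> n \<omega>)) = K" for n
  proof -
    have "expectation (\<lambda>\<omega>. exp (s * \<epsilon> n \<omega>)) = (\<integral>x. exp (s * x) \<partial>distr M borel (\<epsilon> n))" for n
      by (subst integral_distr) auto
    then show ?thesis unfolding K_def using ident[of n] by simp
  qed
  have "K \<ge> 0" unfolding K_def by (intro integral_nonneg_AE) auto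
  have one: "(\<integral>\<^sup>+\<omega>. ennreal (exp (w n * \<epsilon> n \<omega>)) \<partial>M) \<le> ennreal (exp (w n / s * K))" for n
  proof -
    define \<theta> where "\<theta> = w n / s"
    have \<theta>: "0 \<le> \<theta>" "\<theta> \<le> 1" using w0[of n] s(1) s(3)[of n] by (auto simp: \<theta>_def)
    have pt: "exp (w n * y) \<le> 1 + \<theta> * exp (s * y)" for y
    proof -
      have "exp (w n * y) = exp ((1 - \<theta>) *\<^sub>R 0 + \<theta> *\<^sub>R (s * y))"
        using s(1) by (simp add: \<theta>_def)
      also have "\<dots> \<le> (1 - \<theta>) * exp 0 + \<theta> * exp (s * y)"
        by (rule convex_onD[OF exp_convex \<theta> UNIV_I UNIV_I])
      finally show ?thesis using \<theta>(1) by simp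
    qed
    have "(\<integral>\<^sup>+\<omega>. ennreal (exp (w n * \<epsilon> n \<omega>)) \<partial>M) \<le> (\<integral>\<^sup>+\<omega>. ennreal (1 + \<theta> * exp (s * \<epsilon> n \<omega>)) \<partial>M)"
      by (intro nn_integral_mono ennreal_leI pt)
    also have "\<dots> = ennreal (1 + \<theta> * K)"
      using int[of n] \<theta> K[of n] by (subst nn_integral_eq_integral) (auto simp: prob_space)
    also have "\<dots> \<le> ennreal (exp (\<theta> * K))" by (intro ennreal_leI exp_ge_add_one_self)
    finally show ?thesis by (simp add: \<theta>_def)
  qed
  define f where "f N \<omega> = (\<Prod>n<N. ennreal (exp (w n * \<epsilon> n \<omega>)))" for N \<omega>
  have f: "f N \<omega> = ennreal (exp (\<Sum>n<N. w n * \<epsilon> n \<omega>))" for N \<omega>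
    unfolding f_def by (subst prod_ennreal) (simp_all add: exp_sum)
  have [measurable]: "f N \<in> borel_measurable M" for N unfolding f[abs_def] by measurable
  have "AE \<omega> in M. ennreal (exp (wsum w \<omega>)) = liminf (\<lambda>N. f N \<omega>)"
  proof -
    have "AE \<omega> in M. summable (\<lambda>n. \<bar>w n * \<epsilon> n \<omega>\<bar>)" using w by (simp add: admissible_def)
    then show ?thesis
    proof eventually_elim
      case (elim \<omega>)
      then have "(\<lambda>N. \<Sum>n<N. w n * \<epsilon> n \<omega>) \<longlonglongrightarrow> wsum w \<omega>"
        unfolding wsum_def by (intro summable_LIMSEQ) (rule summable_rabs_cancel)
      then have "(\<lambda>N. f N \<omega>) \<longlonglongrightarrow> ennreal (exp (wsum w \<omega>))"
        unfolding f by (intro tendsto_ennrealI tendsto_exp)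
      then show ?case by (intro lim_imp_Liminf[symmetric]) auto
    qed
  qed
  then have "(\<integral>\<^sup>+\<omega>. ennreal (exp (wsum w \<omega>)) \<partial>M) = (\<integral>\<^sup>+\<omega>. liminf (\<lambda>N. f N \<omega>) \<partial>M)"
    by (rule nn_integral_cong_AE)
  also have "\<dots> \<le> liminf (\<lambda>N. \<integral>\<^sup>+\<omega>. f N \<omega> \<partial>M)"
    by (rule nn_integral_liminf) simp
  also have "\<dots> \<le> ennreal (exp (suminf w / s * K))"
  proof (rule Liminf_le)
    show "\<forall>\<^sub>F N in sequentially. (\<integral>\<^sup>+\<omega>. f N \<omega> \<partial>M) \<le> ennreal (exp (suminf w / s * K))"
    proof (rule always_eventually, rule allI)
      fix N
      have iv: "indep_vars (\<lambda>_. borel) (\<lambda>n \<omega>. ennreal (exp (w n * \<epsilon> n \<omega>))) {..<N}"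
        by (rule indep_vars_compose2[OF indep_vars_subset[OF indep], where Y = "\<lambda>n x. ennreal (exp (w n * x))"]) auto
      have "(\<integral>\<^sup>+\<omega>. f N \<omega> \<partial>M) = (\<Prod>n<N. \<integral>\<^sup>+\<omega>. ennreal (exp (w n * \<epsilon> n \<omega>)) \<partial>M)"
        unfolding f_def by (rule indep_vars_nn_integral[OF _ iv]) auto
      also have "\<dots> \<le> (\<Prod>n<N. ennreal (exp (w n / s * K)))"
        by (intro prod_mono_ennreal one)
      also have "\<dots> = ennreal (exp ((\<Sum>n<N. w n) / s * K))"
        by (subst prod_ennreal) (simp_all add: exp_sum sum_divide_distrib sum_distrib_right)
      also have "\<dots> \<le> ennreal (exp (suminf w / s * K))"
        using sum_le_suminf[OF sw, of "{..<N}"] w0 s(1) \<open>K \<ge> 0\<close>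
        by (auto intro!: ennreal_leI mult_right_mono divide_right_mono)
      finally show "(\<integral>\<^sup>+\<omega>. f N \<omega> \<partial>M) \<le> ennreal (exp (suminf w / s * K))" .
    qed
  qed auto
  also have "\<dots> < \<infinity>" by simp
  finally show ?thesis
    by (intro integrableI_nonneg) (auto simp: top.not_eq_extremum)
qed

text \<open>Adding an index convolves with the law of \<open>\<epsilon> 0\<close>, so both laws are
  the same convolution power of it.\<close>

lemma distr_wsum_indicator:
  assumes "finite S" "finite S'" "card S = card S'"
  shows "distr M borel (wsum (indicator S)) = distr M borel (wsum (indicator S'))"
  using assms
proof (induction S arbitrary: S' rule: finite_induct)
  case empty
  then show ?case by simp
next
  case (insert s S)
  then obtain s' T where S': "S' = insert s' T" "s' \<notin> T" "finite T" "card T = card S"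
    by (metis card_insert_disjoint card_Suc_eq finite_insert)
  have split: "distr M borel (wsum (indicator (insert a A)))
      = convolution (distr M borel (\<epsilon> 0)) (distr M borel (wsum (indicator A)))"
    if "finite A" "a \<notin> A" for a A
  proof -
    have "indep_var borel (wsum (indicator {a})) borel (wsum (indicator A))"
      using that by (intro wsum_indep) (auto simp: indicator_def)
    moreover have a: "wsum (indicator {a}) = \<epsilon> a"
      by (auto simp: wsum_indicator)
    ultimately have "distr M borel (\<lambda>\<omega>. \<epsilon> a \<omega> + wsum (indicator A) \<omega>)
      = convolution (distr M borel (\<epsilon> a)) (distr M borel (wsum (indicator A)))"
      by (intro sum_indep_random_variable) auto
    moreover have "(\<lambda>\<omega>. \<epsilon> a \<omega> + wsum (indicator A) \<omega>) = wsum (indicator (insert a A))"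
      using that by (auto simp: wsum_indicator)
    ultimately show ?thesis using ident[of a] by simp
  qed
  show ?case
    using insert.IH[of T] S' insert.hyps by (simp add: split)
qed

section \<open>Products of m independent copies, and comparison of weighted sums with them\<close>

abbreviation F :: "nat \<Rightarrow> real \<Rightarrow> real" where
  "F m \<equiv> upper_tail (\<lambda>\<omega>. exp (wsum (indicator {..<m}) \<omega>))"

lemma upper_tail_wsum_indicator:
  assumes "finite S"
  shows "upper_tail (\<lambda>\<omega>. exp (wsum (indicator S) \<omega>)) x = F (card S) x"
proof -
  have "distr M borel (\<lambda>\<omega>. exp (wsum w \<omega>)) = distr (distr M borel (wsum w)) borel exp" for w
    by (subst distr_distr) (auto simp: comp_def)
  then have "distr M borel (\<lambda>\<omega>. exp (wsum (indicator S) \<omega>)) = distr M borel (\<lambda>\<omega>. exp (wsum (indicator {..<card S}) \<omega>))"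
    using distr_wsum_indicator[OF assms, of "{..<card S}"] by simp
  then show ?thesis by (simp add: upper_tail_distr)
qed

lemma wsum_split:
  assumes w: "admissible w" and S: "finite S" "\<And>n. n \<in> S \<Longrightarrow> w n = c" and c: "0 \<le> c"
  shows "AE \<omega> in M. wsum w \<omega> = c * wsum (indicator S) \<omega> + wsum (\<lambda>n. if n \<in> S then 0 else w n) \<omega>"
proof -
  let ?r = "\<lambda>n. if n \<in> S then 0 else w n"
  have "admissible (\<lambda>n. c * indicator S n)"
    by (rule admissible_scale[OF admissible_indicator[OF S(1)] c])
  moreover have "admissible ?r"
    using w by (intro admissible_mono[OF w]) (auto simp: admissible_def)
  ultimately have "AE \<omega> in M. wsum (\<lambda>n. c * indicator S n + ?r n) \<omega> = wsum (\<lambda>n. c * indicator S n) \<omega> + wsum ?r \<omega>"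
    by (rule wsum_add)
  moreover have "(\<lambda>n. c * indicator S n + ?r n) = w"
    using S(2) by (auto simp: fun_eq_iff)
  ultimately show ?thesis
    using wsum_scale[OF admissible_indicator[OF S(1)], of c] by auto
qed

text \<open>One index of weight 1 supplies a regularly varying factor
  \<open>exp (\<epsilon> n)\<close>; all other terms form an independent positive factor, which
  preserves the Potter bound.\<close>

lemma potter_wsum:
  assumes w: "admissible w" "w n = 1" and \<beta>: "\<alpha> < \<beta>"
  shows "potter_bound \<beta> (\<lambda>\<omega>. exp (wsum w \<omega>))"
proof -
  let ?r = "\<lambda>k. if k \<in> {n} then 0 else w k"
  have "potter_bound \<beta> (\<lambda>\<omega>. exp (wsum (indicator {n}) \<omega>))"
    using regvar_tail.potter[OF regvar_tail_eps \<beta>, of n] by (simp add: wsum_indicator)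
  then have pot: "potter_bound \<beta> (\<lambda>\<omega>. exp (wsum (indicator {n}) \<omega>) * exp (wsum ?r \<omega>))"
    by (rule potter_bound_mult[OF _ exp_wsum_indep]) auto
  have AE: "AE \<omega> in M. exp (wsum (indicator {n}) \<omega>) * exp (wsum ?r \<omega>) = exp (wsum w \<omega>)"
  proof -
    have "AE \<omega> in M. wsum w \<omega> = 1 * wsum (indicator {n}) \<omega> + wsum ?r \<omega>"
      using w by (intro wsum_split) auto
    then show ?thesis by eventually_elim (simp only: exp_add mult_1_left)
  qed
  show ?thesis
    by (rule potter_bound_cong_AE[OF _ _ AE pot]) measurable
qed

lemma potter_F:
  assumes "1 \<le> m" "\<alpha> < \<beta>"
  shows "potter_bound \<beta> (\<lambda>\<omega>. exp (wsum (indicator {..<m}) \<omega>))"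
  using assms by (intro potter_wsum[where n=0] admissible_indicator) auto

text \<open>The indices outside \<open>S\<close> form an independent factor that is positive
  everywhere, so \<open>upper_tail_mult_ge\<close> applies. \<open>S\<close> may omit indices of
  weight 1, which permits a choice of its cardinality later.\<close>

lemma F_le_upper_tail_wsum:
  assumes w: "admissible w" and S: "finite S" "S \<noteq> {}" "\<And>n. n \<in> S \<Longrightarrow> w n = 1"
  shows "\<exists>c>0. \<forall>x>0. c * F (card S) x \<le> upper_tail (\<lambda>\<omega>. exp (wsum w \<omega>)) x"
proof -
  let ?T = "\<lambda>\<omega>. exp (wsum (indicator S) \<omega>)"
  let ?V = "\<lambda>\<omega>. exp (wsum (\<lambda>k. if k \<in> S then 0 else w k) \<omega>)"
  obtain n where "n \<in> S" using S by blast
  have "\<exists>c>0. \<forall>x>0. c * upper_tail ?T x \<le> upper_tail (\<lambda>\<omega>. ?T \<omega> * ?V \<omega>) x"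
  proof (rule upper_tail_mult_ge[where \<beta>="\<alpha> + 1" and ?c1.0=1])
    show "potter_bound (\<alpha> + 1) ?T"
      using \<open>n \<in> S\<close> S by (intro potter_wsum[where n=n] admissible_indicator) auto
    show "indep_var borel ?T borel ?V"
      by (rule exp_wsum_indep) auto
    show "0 < upper_tail ?V 0"
      by (simp add: upper_tail_def prob_space)
  qed auto
  moreover have "upper_tail (\<lambda>\<omega>. ?T \<omega> * ?V \<omega>) x = upper_tail (\<lambda>\<omega>. exp (wsum w \<omega>)) x" for x
  proof (rule upper_tail_cong_AE)
    have "AE \<omega> in M. wsum w \<omega> = 1 * wsum (indicator S) \<omega> + wsum (\<lambda>k. if k \<in> S then 0 else w k) \<omega>"
      using S by (intro wsum_split[OF w]) auto
    then show "AE \<omega> in M. ?T \<omega> * ?V \<omega> = exp (wsum w \<omega>)"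
      by eventually_elim (simp only: exp_add mult_1_left)
  qed auto
  ultimately show ?thesis by (simp add: upper_tail_wsum_indicator[OF S(1)])
qed

text \<open>The square root turns the weights 2 into 1 and the others into at most c / 2. The
  condition \<open>\<beta> * c / 2 < \<alpha>\<close> gives the remaining factor a finite \<beta>-th
  moment, so the product over \<open>B\<close> determines the order of the tail through
  \<open>upper_tail_mult_le\<close>.\<close>

lemma upper_tail_wsum_le_F:
  assumes w: "admissible w" and B: "finite B" "B \<noteq> {}" "\<And>n. n \<in> B \<Longrightarrow> w n = 2"
    and c: "\<And>n. n \<notin> B \<Longrightarrow> w n \<le> c" "0 < c" and \<beta>: "\<alpha> < \<beta>" "\<beta> * c / 2 < \<alpha>"
  shows "\<exists>C\<ge>0. \<forall>x>0. upper_tail (\<lambda>\<omega>. sqrt (exp (wsum w \<omega>))) x \<le> C * F (card B) x"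
proof -
  let ?r = "\<lambda>k. if k \<in> B then 0 else w k"
  have r: "admissible ?r" using w by (intro admissible_mono[OF w]) (auto simp: admissible_def)
  let ?T = "\<lambda>\<omega>. exp (wsum (indicator B) \<omega>)"
  let ?V = "\<lambda>\<omega>. exp (wsum (\<lambda>k. 1/2 * ?r k) \<omega>)"
  obtain n where "n \<in> B" using B by blast
  have "\<beta> > 0" using \<beta> alpha_pos by simp
  have "\<exists>C2\<ge>0. \<forall>x>0. upper_tail (\<lambda>\<omega>. ?T \<omega> * ?V \<omega>) x \<le> C2 * upper_tail ?T x"
  proof (rule upper_tail_mult_le[where \<beta>=\<beta> and ?C1.0=1])
    show "potter_bound \<beta> ?T"
      using \<open>n \<in> B\<close> B \<beta> by (intro potter_wsum[where n=n] admissible_indicator) auto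
    show "indep_var borel ?T borel ?V"
      by (rule exp_wsum_indep) auto
    have "integrable M (\<lambda>\<omega>. exp (wsum (\<lambda>k. (\<beta> / 2) * ?r k) \<omega>))"
    proof (rule wsum_moment[where s="\<beta> * c / 2"])
      show "admissible (\<lambda>k. (\<beta> / 2) * ?r k)"
        using r \<open>\<beta> > 0\<close> by (intro admissible_scale) auto
      show "(\<beta> / 2) * ?r k \<le> \<beta> * c / 2" for k
        using c \<open>\<beta> > 0\<close> by auto
    qed (use \<beta> c \<open>\<beta> > 0\<close> in auto)
    moreover have "AE \<omega> in M. exp (wsum (\<lambda>k. (\<beta> / 2) * ?r k) \<omega>) = ?V \<omega> powr \<beta>"
      using wsum_scale[OF r, of "\<beta> / 2"] wsum_scale[OF r, of "1 / 2"]
    proof eventually_elim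
      case (elim \<omega>)
      have "?V \<omega> powr \<beta> = exp (\<beta> * wsum (\<lambda>k. 1/2 * ?r k) \<omega>)" by (simp add: powr_def)
      then show ?case unfolding elim by (simp del: mult_if_delta)
    qed
    ultimately show "integrable M (\<lambda>\<omega>. ?V \<omega> powr \<beta>)"
      by (subst (asm) integrable_cong_AE) auto
  qed (use \<open>\<beta> > 0\<close> in auto)
  moreover have "upper_tail (\<lambda>\<omega>. ?T \<omega> * ?V \<omega>) x = upper_tail (\<lambda>\<omega>. sqrt (exp (wsum w \<omega>))) x" for x
  proof (rule upper_tail_cong_AE)
    have "sqrt (exp y) = exp (y / 2)" for y :: real
      by (rule real_sqrt_unique) (auto simp: power2_eq_square simp flip: exp_add)
    note sqrt_exp = this
    have "AE \<omega> in M. wsum w \<omega> = 2 * wsum (indicator B) \<omega> + wsum ?r \<omega>"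
      using B by (intro wsum_split[OF w]) auto
    with wsum_scale[OF r, of "1 / 2"]
    show "AE \<omega> in M. ?T \<omega> * ?V \<omega> = sqrt (exp (wsum w \<omega>))"
    proof eventually_elim
      case (elim \<omega>)
      show ?case unfolding sqrt_exp elim by (simp add: add_divide_distrib flip: exp_add)
    qed
  qed auto
  ultimately show ?thesis by (simp add: upper_tail_wsum_indicator[OF B(1)])
qed

section \<open>Growth of the tails in the number of factors when the \<alpha>-th moment is
  infinite\<close>

lemma F_rec:
  "F (m + k) x = expectation (\<lambda>\<omega>. upper_tail (\<lambda>\<omega>'. exp (wsum (indicator {m..<m+k}) \<omega>') * exp (wsum (indicator {..<m}) \<omega>)) x)"
  "integrable M (\<lambda>\<omega>. upper_tail (\<lambda>\<omega>'. exp (wsum (indicator {m..<m+k}) \<omega>') * exp (wsum (indicator {..<m}) \<omega>)) x)"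
proof -
  have ind: "indep_var borel (\<lambda>\<omega>. exp (wsum (indicator {m..<m+k}) \<omega>)) borel (\<lambda>\<omega>. exp (wsum (indicator {..<m}) \<omega>))"
    by (rule exp_wsum_indep) (auto simp: indicator_def)
  have "{..<m+k} = {m..<m+k} \<union> {..<m}" by auto
  then have "(\<Sum>n<m+k. \<epsilon> n \<omega>) = (\<Sum>n=m..<m+k. \<epsilon> n \<omega>) + (\<Sum>n<m. \<epsilon> n \<omega>)" for \<omega>
    by (metis sum.union_disjoint[of "{m..<m+k}" "{..<m}"] finite_atLeastLessThan finite_lessThan ivl_disj_int_one(2) inf_commute)
  then have "wsum (indicator {..<m+k}) \<omega> = wsum (indicator {m..<m+k}) \<omega> + wsum (indicator {..<m}) \<omega>" for \<omega>
    by (simp add: wsum_indicator)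
  then show "F (m + k) x = expectation (\<lambda>\<omega>. upper_tail (\<lambda>\<omega>'. exp (wsum (indicator {m..<m+k}) \<omega>') * exp (wsum (indicator {..<m}) \<omega>)) x)"
    using upper_tail_indep_mult(2)[OF ind, of x] by (simp add: exp_add)
  show "integrable M (\<lambda>\<omega>. upper_tail (\<lambda>\<omega>'. exp (wsum (indicator {m..<m+k}) \<omega>') * exp (wsum (indicator {..<m}) \<omega>)) x)"
    by (rule upper_tail_indep_mult(1)[OF ind])
qed

lemma upper_tail_block:
  "upper_tail (\<lambda>\<omega>'. exp (wsum (indicator {m..<m+k}) \<omega>') * exp y) x = F k (x / exp y)"
proof -
  have "upper_tail (\<lambda>\<omega>. exp (wsum (indicator {m..<m+k}) \<omega>)) z = F k z" for z
    by (subst upper_tail_wsum_indicator) auto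
  then show ?thesis by (subst upper_tail_scale) auto
qed

lemma F_one: "F (Suc 0) x = upper_tail (\<lambda>\<omega>. exp (\<epsilon> 0 \<omega>)) x"
  by (simp add: wsum_indicator)

text \<open>\<open>F 2 x / F 1 x\<close> is the mean of
  \<open>F 1 (x / exp (\<epsilon> 0 \<omega>)) / F 1 x\<close>, and this integrand tends to
  \<open>exp (\<alpha> * \<epsilon> 0 \<omega>)\<close> by regular variation. The limit has infinite
  mean, so by Fatou's lemma the ratio diverges.\<close>

lemma F_two_dominates:
  assumes inf: "(\<integral>\<^sup>+\<omega>. ennreal (exp (\<alpha> * \<epsilon> 0 \<omega>)) \<partial>M) = \<infinity>"
  shows "\<forall>\<^sub>F x in at_top. N * F 1 x \<le> F 2 x"
proof -
  interpret U: regvar_tail M "\<lambda>\<omega>. exp (\<epsilon> 0 \<omega>)" \<alpha> L by (rule regvar_tail_eps)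
  have F1: "F 1 x > 0" for x using U.upper_tail_pos by (simp add: F_one)
  have "((\<lambda>x. ennreal (F 2 x / F 1 x)) \<longlongrightarrow> \<infinity>) at_top"
  proof (rule tendsto_at_topI_sequentially)
    \<comment> \<open>Fatou's lemma concerns sequences, so the limit at infinity is tested along an
      arbitrary sequence of levels.\<close>
    fix X :: "nat \<Rightarrow> real" assume X: "filterlim X at_top sequentially"
    define h where "h n \<omega> = F 1 (X n / exp (\<epsilon> 0 \<omega>)) / F 1 (X n)" for n \<omega>
    have h: "integrable M (h n)" "expectation (h n) = F 2 (X n) / F 1 (X n)" for n
      using F_rec[of 1 1 "X n"] upper_tail_block[of 1 1 _ "X n"] unfolding h_def[abs_def]
      by (simp_all add: wsum_indicator numeral_2_eq_2)
    have "liminf (\<lambda>n. ennreal (h n \<omega>)) = ennreal (exp (\<alpha> * \<epsilon> 0 \<omega>))" for \<omega>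
    proof -
      have "(\<lambda>n. h n \<omega>) \<longlonglongrightarrow> (inverse (exp (\<epsilon> 0 \<omega>))) powr (-\<alpha>)"
        using filterlim_compose[OF U.upper_tail_ratio[of "inverse (exp (\<epsilon> 0 \<omega>))"] X]
        by (simp add: h_def F_one divide_inverse mult.commute)
      also have "(inverse (exp (\<epsilon> 0 \<omega>))) powr (-\<alpha>) = exp (\<alpha> * \<epsilon> 0 \<omega>)"
        by (simp add: powr_def ln_inverse)
      finally show ?thesis by (intro lim_imp_Liminf tendsto_ennrealI) auto
    qed
    moreover have nn: "(\<integral>\<^sup>+\<omega>. ennreal (h n \<omega>) \<partial>M) = ennreal (F 2 (X n) / F 1 (X n))" for n
      unfolding h(2)[symmetric]
      by (rule nn_integral_eq_integral[OF h(1)]) (simp add: h_def upper_tail_nonneg)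
    ultimately have "\<infinity> = (\<integral>\<^sup>+\<omega>. liminf (\<lambda>n. ennreal (h n \<omega>)) \<partial>M)" using inf by simp
    also have "\<dots> \<le> liminf (\<lambda>n. \<integral>\<^sup>+\<omega>. ennreal (h n \<omega>) \<partial>M)"
      using h(1) by (intro nn_integral_liminf) auto
    also have "\<dots> = liminf (\<lambda>n. ennreal (F 2 (X n) / F 1 (X n)))"
      unfolding nn ..
    finally have L: "liminf (\<lambda>n. ennreal (F 2 (X n) / F 1 (X n))) = \<infinity>" by (simp add: top_unique)
    moreover have "\<infinity> \<le> limsup (\<lambda>n. ennreal (F 2 (X n) / F 1 (X n)))"
      unfolding L[symmetric] by (rule Liminf_le_Limsup) simp
    ultimately show "(\<lambda>n. ennreal (F 2 (X n) / F 1 (X n))) \<longlonglongrightarrow> \<infinity>"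
      by (intro Liminf_eq_Limsup) (simp_all add: top_unique)
  qed
  then have "\<forall>\<^sub>F x in at_top. ennreal (max 0 N) < ennreal (F 2 x / F 1 x)"
    by (rule order_tendstoD) simp
  then show ?thesis
  proof eventually_elim
    case (elim x)
    then have "N < F 2 x / F 1 x"
      using ennreal_less_iff[of "max 0 N" "F 2 x / F 1 x"] by (metis max.cobounded1 max_less_iff_conj)
    then show ?case using F1[of x] by (simp add: pos_less_divide_eq less_imp_le)
  qed
qed

text \<open>Induction, conditioning on the first p factors. Where their product leaves a level of at
  least \<open>y0\<close>, the case of two factors applies to the remaining ones. The complementary
  event has probability of order \<open>F p x\<close> by Potter's inequality, which the induction
  hypothesis makes small against \<open>F (p + 1) x\<close>.\<close>

lemma F_Suc_dominates:
  assumes inf: "(\<integral>\<^sup>+\<omega>. ennreal (exp (\<alpha> * \<epsilon> 0 \<omega>)) \<partial>M) = \<infinity>" and "0 < N"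
  shows "\<forall>\<^sub>F x in at_top. N * F (Suc m) x \<le> F (Suc (Suc m)) x"
  using \<open>0 < N\<close>
proof (induction m arbitrary: N)
  case 0
  then show ?case using F_two_dominates[OF inf, of N] by (simp add: numeral_2_eq_2)
next
  case (Suc m)
  define p where "p = Suc m"
  have "p \<ge> 1" by (simp add: p_def)
  \<comment> \<open>Domination with 2 N instead of N leaves a term \<open>N * F (p + 1) x\<close> to
    absorb the exceptional event.\<close>
  obtain y1 where y1: "\<And>y. y1 \<le> y \<Longrightarrow> 2 * N * F 1 y \<le> F 2 y"
    using F_two_dominates[OF inf, of "2 * N"] by (auto simp: eventually_at_top_linorder)
  define y0 where "y0 = max 1 y1"
  have y0: "0 < y0" by (simp add: y0_def)
  obtain C where C: "C \<ge> 1"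
    "\<And>l x. 1 \<le> l \<Longrightarrow> 0 < x \<Longrightarrow> upper_tail (\<lambda>\<omega>. exp (wsum (indicator {..<p}) \<omega>) * l) x \<le> C * l powr (\<alpha> + 1) * F p x"
    using potter_boundE[OF potter_F[OF \<open>p \<ge> 1\<close>, of "\<alpha> + 1"]] by (metis less_add_one)
  \<comment> \<open>With this constant the error
    \<open>2 * N * C * y0 powr (\<alpha> + 1) * F p x\<close> equals \<open>N * (K * F p x)\<close>,
    which the induction hypothesis for \<open>K\<close> bounds by
    \<open>N * F (p + 1) x\<close>.\<close>
  define K where "K = 2 * C * y0 powr (\<alpha> + 1)"
  have "K > 0" unfolding K_def y0_def using C by auto
  from Suc.IH[OF this] have "\<forall>\<^sub>F x in at_top. K * F p x \<le> F (p + 1) x \<and> 0 < x"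
    using eventually_gt_at_top[of 0] unfolding p_def by (simp add: eventually_conj_iff)
  then have "\<forall>\<^sub>F x in at_top. N * F (p + 1) x \<le> F (p + 2) x"
  proof eventually_elim
    case (elim x)
    let ?P = "\<lambda>\<omega>. exp (wsum (indicator {..<p}) \<omega>)"
    let ?G = "\<lambda>k \<omega>. upper_tail (\<lambda>\<omega>'. exp (wsum (indicator {p..<p+k}) \<omega>') * ?P \<omega>) x"
    \<comment> \<open>Given the first p factors, \<open>?G k\<close> is \<open>F k\<close> at the
      level \<open>x / ?P \<omega>\<close>. If that level is below \<open>y0\<close>, the trivial
      bound 1 on \<open>?G 1\<close> is used and the indicator pays for it.\<close>
    have pt: "2 * N * ?G 1 \<omega> \<le> ?G 2 \<omega> + 2 * N * indicator {\<omega>\<in>space M. x / y0 < ?P \<omega>} \<omega>" if "\<omega> \<in> space M" for \<omega>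
    proof (cases "y0 \<le> x / ?P \<omega>")
      case True
      then have "2 * N * F 1 (x / ?P \<omega>) \<le> F 2 (x / ?P \<omega>)"
        by (intro y1) (auto simp: y0_def)
      then show ?thesis using Suc.prems unfolding upper_tail_block
        by (simp add: add_increasing2)
    next
      case False
      then have "x / y0 < ?P \<omega>" using y0 by (simp add: field_simps)
      then have "2 * N * ?G 1 \<omega> \<le> 2 * N * indicator {\<omega>\<in>space M. x / y0 < ?P \<omega>} \<omega>"
        using that Suc.prems upper_tail_le_1 by (simp add: mult_le_cancel_left1)
      then show ?thesis by (simp add: add_increasing upper_tail_nonneg)
    qed
    have "2 * N * F (p + 1) x = expectation (\<lambda>\<omega>. 2 * N * ?G 1 \<omega>)"
      using F_rec(1)[of p 1 x] by simp
    also have "\<dots> \<le> expectation (\<lambda>\<omega>. ?G 2 \<omega> + 2 * N * indicator {\<omega>\<in>space M. x / y0 < ?P \<omega>} \<omega>)"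
      using F_rec(2)[of p 1 x] F_rec(2)[of p 2 x] pt
      by (intro integral_mono Bochner_Integration.integrable_add integrable_mult_right integrable_real_indicator)
        (auto simp: emeasure_eq_measure)
    also have "\<dots> = F (p + 2) x + 2 * N * upper_tail ?P (x / y0)"
      using F_rec[of p 2 x]
      by (subst Bochner_Integration.integral_add)
        (auto simp: emeasure_eq_measure upper_tail_def[of ?P] intro!: integrable_mult_right integrable_real_indicator)
    also have "upper_tail ?P (x / y0) = upper_tail (\<lambda>\<omega>. ?P \<omega> * y0) x"
      by (rule upper_tail_scale[symmetric]) (simp add: y0_def)
    also have "2 * N * \<dots> \<le> 2 * N * (C * y0 powr (\<alpha> + 1) * F p x)"
      using elim Suc.prems by (intro mult_left_mono C) (auto simp: y0_def)
    also have "\<dots> = N * (K * F p x)" by (simp add: K_def)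
    also have "\<dots> \<le> N * F (p + 1) x" using elim Suc.prems by (intro mult_left_mono) auto
    finally show ?case by simp
  qed
  then show ?case by (simp add: p_def)
qed

end

section \<open>Truncation of sums\<close>

context prob_space
begin

text \<open>A Karamata-type estimate, by decomposing the range of \<open>W\<close> dyadically.\<close>

lemma truncated_moment_le:
  assumes [measurable]: "W \<in> borel_measurable M" and W: "\<And>\<omega>. 0 \<le> W \<omega>"
    and G: "\<And>x y. 0 < x \<Longrightarrow> x \<le> y \<Longrightarrow> G x \<le> C * (y / x) powr \<beta> * G y" "\<And>x. 0 \<le> G x"
    and C: "0 \<le> C" and \<beta>: "\<beta> < real r"
    and dom: "0 < v" "\<And>x. v \<le> x \<Longrightarrow> upper_tail W x \<le> \<epsilon> * G x" "0 \<le> \<epsilon>" and a: "0 < a"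
  shows "expectation (\<lambda>\<omega>. min (W \<omega>) a ^ r)
    \<le> (2 * v) ^ r + \<epsilon> * (C * 2 powr \<beta> / (1 - 2 powr (\<beta> - r)) * a ^ r * G a)"
proof -
  define E where "E k = (if v \<le> a / 2 ^ Suc k then {\<omega>\<in>space M. a / 2 ^ Suc k < W \<omega>} else {})" for k :: nat
  have [measurable]: "E k \<in> sets M" for k
    by (cases "v \<le> a / 2 ^ Suc k") (auto simp: E_def)
  define c where "c k = (a / 2 ^ k) ^ r" for k :: nat
  define K where "K = \<epsilon> * (C * 2 powr \<beta> * a ^ r * G a)"
  have K: "0 \<le> K" unfolding K_def using dom C a G(2) by auto
  \<comment> \<open>Descending one layer multiplies the r-th power by 2^(-r) and the bound on
    \<open>G\<close> by \<open>2 powr \<beta>\<close>; their product is the geometric ratio, below 1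
    as \<beta> < r.\<close>
  define q where "q = 2 powr (\<beta> - r)"
  have "q < 2 powr 0" unfolding q_def using \<beta> by (intro powr_less_mono) auto
  then have q: "0 < q" "q < 1" by (auto simp: q_def)
  have "(\<integral>\<^sup>+\<omega>. ennreal (min (W \<omega>) a ^ r) \<partial>M) \<le> (\<integral>\<^sup>+\<omega>. ennreal ((2 * v) ^ r) + (\<Sum>k. ennreal (c k) * indicator (E k) \<omega>) \<partial>M)"
  proof (intro nn_integral_mono)
    fix \<omega> assume \<omega>: "\<omega> \<in> space M"
    define y where "y = min (W \<omega>) a"
    have y0: "0 \<le> y" using W[of \<omega>] a by (simp add: y_def)
    show "ennreal (min (W \<omega>) a ^ r) \<le> ennreal ((2 * v) ^ r) + (\<Sum>k. ennreal (c k) * indicator (E k) \<omega>)"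
    proof (cases "y \<le> 2 * v")
      case True
      then have "ennreal (min (W \<omega>) a ^ r) \<le> ennreal ((2 * v) ^ r)"
        using y0 unfolding y_def by (intro ennreal_leI power_mono)
      then show ?thesis by (simp add: add_increasing2)
    next
      case False
      then have y: "2 * v < y" "0 < y" using dom by auto
      have "\<exists>k. a / y < 2 ^ k" by (intro real_arch_pow) simp
      then obtain k where k: "a / y < 2 ^ k" "\<And>j. j < k \<Longrightarrow> \<not> a / y < 2 ^ j"
        using LeastI_ex[of "\<lambda>k. a / y < 2 ^ k"] not_less_Least[of _ "\<lambda>k. a / y < 2 ^ k"] by blast
      have "y \<le> a" by (simp add: y_def)
      then have "k \<noteq> 0" using k(1) y by (cases k) auto
      then obtain j where j: "k = Suc j" by (cases k) auto
      have up: "y \<le> a / 2 ^ j" using k(2)[of j] j y by (simp add: field_simps)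
      have lo: "a / 2 ^ Suc j < y" using k(1) j y by (simp add: field_simps)
      have "v \<le> a / 2 ^ Suc j" using up y by simp
      moreover have "a / 2 ^ Suc j < W \<omega>" using lo unfolding y_def by simp
      ultimately have "\<omega> \<in> E j" using \<omega> by (simp add: E_def)
      then have "ennreal (min (W \<omega>) a ^ r) \<le> ennreal (c j) * indicator (E j) \<omega>"
        using up y0 unfolding c_def y_def by (auto intro!: ennreal_leI power_mono)
      also have "\<dots> \<le> (\<Sum>k. ennreal (c k) * indicator (E k) \<omega>)"
        using sum_le_suminf[OF summableI, of "{j}" "\<lambda>k. ennreal (c k) * indicator (E k) \<omega>"]
        by (simp del: sum_mult_indicator)
      finally show ?thesis by (simp add: add_increasing)
    qed
  qed
  also have "\<dots> = ennreal ((2 * v) ^ r) + (\<Sum>k. ennreal (c k) * emeasure M (E k))"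
    by (subst nn_integral_add) (auto simp: nn_integral_suminf nn_integral_cmult_indicator emeasure_space_1)
  also have "(\<Sum>k. ennreal (c k) * emeasure M (E k)) \<le> (\<Sum>k. ennreal (K * q ^ k))"
  proof (rule suminf_le)
    fix k
    have Ek: "prob (E k) \<le> \<epsilon> * (C * (2 ^ Suc k) powr \<beta> * G a)"
    proof (cases "v \<le> a / 2 ^ Suc k")
      case True
      then have "prob (E k) = upper_tail W (a / 2 ^ Suc k)" by (simp add: E_def upper_tail_def)
      also have "\<dots> \<le> \<epsilon> * G (a / 2 ^ Suc k)" by (rule dom(2)[OF True])
      also have "\<dots> \<le> \<epsilon> * (C * (a / (a / 2 ^ Suc k)) powr \<beta> * G a)"
      proof (intro mult_left_mono G(1) dom)
        have "a * 1 \<le> a * 2 ^ Suc k" using a by (intro mult_left_mono one_le_power) auto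
        then show "a / 2 ^ Suc k \<le> a" by (simp add: divide_le_eq)
      qed (use a in auto)
      finally show ?thesis using a by simp
    next
      case False
      then show ?thesis using C dom G(2) by (simp add: E_def)
    qed
    have "ennreal (c k) * emeasure M (E k) = ennreal (c k * prob (E k))"
      using a by (simp add: emeasure_eq_measure ennreal_mult c_def)
    also have "\<dots> \<le> ennreal (c k * (\<epsilon> * (C * (2 ^ Suc k) powr \<beta> * G a)))"
      using Ek a by (intro ennreal_leI mult_left_mono) (auto simp: c_def)
    also have "c k * (\<epsilon> * (C * (2 ^ Suc k) powr \<beta> * G a)) = K * q ^ k"
    proof -
      have "q ^ k = (2 powr \<beta>) ^ k / (2 ^ k) ^ r"
        by (simp add: q_def powr_diff power_divide powr_realpow mult.commute flip: power_mult)
      moreover have "(2 powr \<beta>) ^ k = (2 ^ k) powr \<beta>"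
        by (simp add: powr_powr mult.commute flip: powr_realpow)
      moreover have "(2 ^ Suc k) powr \<beta> = 2 powr \<beta> * (2 ^ k) powr \<beta>" by (simp add: powr_mult)
      ultimately show ?thesis by (simp add: c_def K_def power_divide)
    qed
    finally show "ennreal (c k) * emeasure M (E k) \<le> ennreal (K * q ^ k)" .
  qed auto
  also have "(\<Sum>k. ennreal (K * q ^ k)) = ennreal (K / (1 - q))"
  proof -
    have "(\<lambda>k. K * q ^ k) sums (K * (1 / (1 - q)))"
      using q by (intro sums_mult geometric_sums) auto
    then have "(\<Sum>k. ennreal (K * q ^ k)) = ennreal (K * (1 / (1 - q)))"
      using K q(1) by (intro suminf_ennreal_eq) auto
    then show ?thesis by (simp only: mult_1_right times_divide_eq_right)
  qed
  also have "ennreal ((2 * v) ^ r) + ennreal (K / (1 - q)) = ennreal ((2 * v) ^ r + K / (1 - q))"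
    using K q dom by (intro ennreal_plus[symmetric]) auto
  finally have le: "(\<integral>\<^sup>+\<omega>. ennreal (min (W \<omega>) a ^ r) \<partial>M) \<le> ennreal ((2 * v) ^ r + K / (1 - q))" by simp
  have "expectation (\<lambda>\<omega>. min (W \<omega>) a ^ r) = enn2real (\<integral>\<^sup>+\<omega>. ennreal (min (W \<omega>) a ^ r) \<partial>M)"
    using W a by (intro integral_eq_nn_integral) auto
  also have "\<dots> \<le> (2 * v) ^ r + K / (1 - q)"
    using le K q dom by (intro enn2real_leI) auto
  also have "K / (1 - q) = \<epsilon> * (C * 2 powr \<beta> / (1 - 2 powr (\<beta> - r)) * a ^ r * G a)"
    by (simp add: K_def q_def)
  finally show ?thesis .
qed

section \<open>Sums bounded through first or second truncated moments\<close>

lemma min_sqrt_power: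
  assumes "0 \<le> a"
  shows "min (sqrt \<bar>y\<bar>) a ^ (2 * m) = min \<bar>y\<bar> (a\<^sup>2) ^ m"
proof -
  have "min (sqrt \<bar>y\<bar>) a ^ 2 = min \<bar>y\<bar> (a\<^sup>2)"
    using assms real_le_rsqrt[of a "\<bar>y\<bar>"] real_sqrt_le_iff[of "\<bar>y\<bar>" "a\<^sup>2"]
    by (auto simp: min_def)
  then show ?thesis by (simp add: power_mult)
qed

text \<open>Unless some summand exceeds \<open>a\<^sup>2\<close> in absolute value, the absolute sum
  is at most the sum of the truncated absolute values, to which Markov's inequality applies. Square
  roots put the products on the scale of a single \<open>X\<close>.\<close>

lemma tail_sum_abs_le:
  assumes [measurable]: "\<And>t. t \<in> T \<Longrightarrow> Y t \<in> borel_measurable M" and T: "finite T"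
    and a: "0 \<le> a" and e: "0 < e"
  shows "prob {\<omega>\<in>space M. e < \<bar>\<Sum>t\<in>T. Y t \<omega>\<bar>}
    \<le> (\<Sum>t\<in>T. upper_tail (\<lambda>\<omega>. sqrt \<bar>Y t \<omega>\<bar>) a)
      + (\<Sum>t\<in>T. expectation (\<lambda>\<omega>. min (sqrt \<bar>Y t \<omega>\<bar>) a ^ 2)) / e"
proof -
  define H where "H t = {\<omega>\<in>space M. a < sqrt \<bar>Y t \<omega>\<bar>}" for t
  define S where "S \<omega> = (\<Sum>t\<in>T. min (sqrt \<bar>Y t \<omega>\<bar>) a ^ 2)" for \<omega>
  have [measurable]: "H t \<in> sets M" if "t \<in> T" for t
    using that unfolding H_def by measurable
  have [measurable]: "S \<in> borel_measurable M" unfolding S_def[abs_def] by measurable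
  have int: "integrable M (\<lambda>\<omega>. min (sqrt \<bar>Y t \<omega>\<bar>) a ^ 2)" if "t \<in> T" for t
  proof (rule integrable_const_bound[where B="a\<^sup>2"])
    show "AE \<omega> in M. norm (min (sqrt \<bar>Y t \<omega>\<bar>) a ^ 2) \<le> a\<^sup>2"
      using a by (auto intro!: power_mono)
  qed (use that in measurable)
  have "{\<omega>\<in>space M. e < \<bar>\<Sum>t\<in>T. Y t \<omega>\<bar>} \<subseteq> (\<Union>t\<in>T. H t) \<union> {\<omega>\<in>space M. e \<le> S \<omega>}"
  proof (rule subsetI, rule ccontr)
    fix \<omega> assume \<omega>: "\<omega> \<in> {\<omega>\<in>space M. e < \<bar>\<Sum>t\<in>T. Y t \<omega>\<bar>}" "\<omega> \<notin> (\<Union>t\<in>T. H t) \<union> {\<omega>\<in>space M. e \<le> S \<omega>}"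
    have "\<bar>Y t \<omega>\<bar> = min (sqrt \<bar>Y t \<omega>\<bar>) a ^ 2" if "t \<in> T" for t
    proof -
      have "sqrt \<bar>Y t \<omega>\<bar> \<le> a" using that \<omega> by (auto simp: H_def not_less)
      then show ?thesis by (simp add: min_def)
    qed
    then have "(\<Sum>t\<in>T. \<bar>Y t \<omega>\<bar>) = S \<omega>" unfolding S_def by (intro sum.cong) auto
    moreover have "\<bar>\<Sum>t\<in>T. Y t \<omega>\<bar> \<le> (\<Sum>t\<in>T. \<bar>Y t \<omega>\<bar>)" by (rule sum_abs)
    ultimately show False using \<omega> by auto
  qed
  then have "prob {\<omega>\<in>space M. e < \<bar>\<Sum>t\<in>T. Y t \<omega>\<bar>} \<le> prob ((\<Union>t\<in>T. H t) \<union> {\<omega>\<in>space M. e \<le> S \<omega>})"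
    using T by (intro finite_measure_mono sets.Un sets.finite_UN) measurable
  also have "\<dots> \<le> prob (\<Union>t\<in>T. H t) + prob {\<omega>\<in>space M. e \<le> S \<omega>}"
    using T by (intro measure_Un_le sets.finite_UN) measurable
  also have "\<dots> \<le> (\<Sum>t\<in>T. prob (H t)) + expectation S / e"
  proof (rule add_mono)
    show "prob (\<Union>t\<in>T. H t) \<le> (\<Sum>t\<in>T. prob (H t))"
      using T by (intro finite_measure_subadditive_finite) auto
    show "prob {\<omega>\<in>space M. e \<le> S \<omega>} \<le> expectation S / e"
      using e int unfolding S_def
      by (intro integral_Markov_inequality_measure[where A="{}"]) (auto intro!: sum_nonneg)
  qed
  also have "expectation S = (\<Sum>t\<in>T. expectation (\<lambda>\<omega>. min (sqrt \<bar>Y t \<omega>\<bar>) a ^ 2))"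
    unfolding S_def using int by (intro Bochner_Integration.integral_sum) auto
  finally show ?thesis by (simp add: H_def upper_tail_def)
qed

text \<open>The second-moment version: orthogonality removes the cross terms from the mean of the
  squared truncated sum, and Chebyshev's inequality follows.\<close>

lemma tail_sum_orthogonal_le:
  assumes [measurable]: "\<And>t. t \<in> T \<Longrightarrow> Y t \<in> borel_measurable M" and T: "finite T"
    and a: "0 \<le> a" and e: "0 < e"
    and orth: "\<And>s t. s \<in> T \<Longrightarrow> t \<in> T \<Longrightarrow> s \<noteq> t \<Longrightarrow>
      expectation (\<lambda>\<omega>. (if \<bar>Y s \<omega>\<bar> \<le> a\<^sup>2 then Y s \<omega> else 0) * (if \<bar>Y t \<omega>\<bar> \<le> a\<^sup>2 then Y t \<omega> else 0)) = 0"
  shows "prob {\<omega>\<in>space M. e < \<bar>\<Sum>t\<in>T. Y t \<omega>\<bar>}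
    \<le> (\<Sum>t\<in>T. upper_tail (\<lambda>\<omega>. sqrt \<bar>Y t \<omega>\<bar>) a)
      + (\<Sum>t\<in>T. expectation (\<lambda>\<omega>. min (sqrt \<bar>Y t \<omega>\<bar>) a ^ 4)) / e\<^sup>2"
proof -
  define H where "H t = {\<omega>\<in>space M. a < sqrt \<bar>Y t \<omega>\<bar>}" for t
  \<comment> \<open>Large summands are replaced by 0 and not cut down to \<open>a\<^sup>2\<close>,
    matching the form of \<open>orth\<close>. The square of \<open>y t\<close> is still at most the
    fourth power of the truncated root.\<close>
  define y where "y t \<omega> = (if \<bar>Y t \<omega>\<bar> \<le> a\<^sup>2 then Y t \<omega> else 0)" for t \<omega>
  define S where "S \<omega> = (\<Sum>t\<in>T. y t \<omega>)\<^sup>2" for \<omega>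
  have [measurable]: "H t \<in> sets M" if "t \<in> T" for t
    using that unfolding H_def by measurable
  have [measurable]: "y t \<in> borel_measurable M" if "t \<in> T" for t
    using that unfolding y_def[abs_def] by measurable
  have [measurable]: "S \<in> borel_measurable M" unfolding S_def[abs_def] by measurable
  have yb: "\<bar>y t \<omega>\<bar> \<le> a\<^sup>2" for t \<omega> by (simp add: y_def)
  have int: "integrable M (\<lambda>\<omega>. y s \<omega> * y t \<omega>)" if "s \<in> T" "t \<in> T" for s t
  proof (rule integrable_const_bound[where B="a\<^sup>2 * a\<^sup>2"])
    have "norm (y s \<omega> * y t \<omega>) \<le> a\<^sup>2 * a\<^sup>2" for \<omega>
      unfolding real_norm_def abs_mult by (intro mult_mono yb) auto
    then show "AE \<omega> in M. norm (y s \<omega> * y t \<omega>) \<le> a\<^sup>2 * a\<^sup>2" by (rule AE_I2)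
  qed (use that in measurable)
  have int4: "integrable M (\<lambda>\<omega>. min (sqrt \<bar>Y t \<omega>\<bar>) a ^ 4)" if "t \<in> T" for t
  proof (rule integrable_const_bound[where B="a ^ 4"])
    show "AE \<omega> in M. norm (min (sqrt \<bar>Y t \<omega>\<bar>) a ^ 4) \<le> a ^ 4"
      using a by (auto intro!: power_mono)
  qed (use that in measurable)
  have Sexp: "S = (\<lambda>\<omega>. \<Sum>s\<in>T. \<Sum>t\<in>T. y s \<omega> * y t \<omega>)"
    by (simp add: S_def fun_eq_iff power2_eq_square sum_product)
  have ES: "expectation S = (\<Sum>t\<in>T. expectation (\<lambda>\<omega>. y t \<omega> * y t \<omega>))"
  proof -
    have "expectation S = (\<Sum>s\<in>T. expectation (\<lambda>\<omega>. \<Sum>t\<in>T. y s \<omega> * y t \<omega>))"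
      unfolding Sexp by (intro Bochner_Integration.integral_sum Bochner_Integration.integrable_sum int)
    also have "\<dots> = (\<Sum>s\<in>T. \<Sum>t\<in>T. expectation (\<lambda>\<omega>. y s \<omega> * y t \<omega>))"
      by (intro sum.cong refl Bochner_Integration.integral_sum int)
    also have "\<dots> = (\<Sum>s\<in>T. \<Sum>t\<in>T. if t = s then expectation (\<lambda>\<omega>. y s \<omega> * y s \<omega>) else 0)"
      using orth unfolding y_def by (intro sum.cong refl) auto
    finally show ?thesis using T by simp
  qed
  have "expectation (\<lambda>\<omega>. y t \<omega> * y t \<omega>) \<le> expectation (\<lambda>\<omega>. min (sqrt \<bar>Y t \<omega>\<bar>) a ^ 4)" if "t \<in> T" for t
  proof (rule integral_mono)
    have "y t \<omega> * y t \<omega> \<le> min \<bar>Y t \<omega>\<bar> (a\<^sup>2) ^ 2" for \<omega>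
      by (auto simp: y_def min_def power2_eq_square)
    then show "y t \<omega> * y t \<omega> \<le> min (sqrt \<bar>Y t \<omega>\<bar>) a ^ 4" for \<omega>
      using min_sqrt_power[OF a, of "Y t \<omega>" 2] by simp
  qed (use that int int4 in auto)
  then have ES4: "expectation S \<le> (\<Sum>t\<in>T. expectation (\<lambda>\<omega>. min (sqrt \<bar>Y t \<omega>\<bar>) a ^ 4))"
    unfolding ES by (rule sum_mono)
  have "{\<omega>\<in>space M. e < \<bar>\<Sum>t\<in>T. Y t \<omega>\<bar>} \<subseteq> (\<Union>t\<in>T. H t) \<union> {\<omega>\<in>space M. e\<^sup>2 \<le> S \<omega>}"
  proof (rule subsetI, rule ccontr)
    fix \<omega> assume \<omega>: "\<omega> \<in> {\<omega>\<in>space M. e < \<bar>\<Sum>t\<in>T. Y t \<omega>\<bar>}" "\<omega> \<notin> (\<Union>t\<in>T. H t) \<union> {\<omega>\<in>space M. e\<^sup>2 \<le> S \<omega>}"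
    have "Y t \<omega> = y t \<omega>" if "t \<in> T" for t
    proof -
      have "sqrt \<bar>Y t \<omega>\<bar> \<le> a" using that \<omega> by (auto simp: H_def not_less)
      then have "\<bar>Y t \<omega>\<bar> \<le> a\<^sup>2" by (rule sqrt_le_D)
      then show ?thesis by (simp add: y_def)
    qed
    then have "(\<Sum>t\<in>T. Y t \<omega>)\<^sup>2 = S \<omega>" unfolding S_def by simp
    moreover have "e\<^sup>2 \<le> (\<Sum>t\<in>T. Y t \<omega>)\<^sup>2"
      using \<omega> e by (intro abs_le_square_iff[THEN iffD1]) auto
    ultimately show False using \<omega> by auto
  qed
  then have "prob {\<omega>\<in>space M. e < \<bar>\<Sum>t\<in>T. Y t \<omega>\<bar>} \<le> prob ((\<Union>t\<in>T. H t) \<union> {\<omega>\<in>space M. e\<^sup>2 \<le> S \<omega>})"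
    using T by (intro finite_measure_mono sets.Un sets.finite_UN) measurable
  also have "\<dots> \<le> prob (\<Union>t\<in>T. H t) + prob {\<omega>\<in>space M. e\<^sup>2 \<le> S \<omega>}"
    using T by (intro measure_Un_le sets.finite_UN) measurable
  also have "\<dots> \<le> (\<Sum>t\<in>T. prob (H t)) + expectation S / e\<^sup>2"
  proof (rule add_mono)
    show "prob (\<Union>t\<in>T. H t) \<le> (\<Sum>t\<in>T. prob (H t))"
      using T by (intro finite_measure_subadditive_finite) auto
    have "integrable M S" unfolding Sexp using int by auto
    moreover have "0 \<le> S \<omega>" for \<omega> by (simp add: S_def)
    ultimately show "prob {\<omega>\<in>space M. e\<^sup>2 \<le> S \<omega>} \<le> expectation S / e\<^sup>2"
      using e by (intro integral_Markov_inequality_measure[where A="{}"]) auto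
  qed
  also have "expectation S / e\<^sup>2 \<le> (\<Sum>t\<in>T. expectation (\<lambda>\<omega>. min (sqrt \<bar>Y t \<omega>\<bar>) a ^ 4)) / e\<^sup>2"
    using ES4 by (intro divide_right_mono) auto
  finally show ?thesis by (simp add: H_def upper_tail_def)
qed

text \<open>Truncation at \<open>a n\<close> leaves two terms proportional to \<epsilon> times
  \<open>n * upper_tail X (a n)\<close>, which stays bounded, and one proportional to
  \<open>n / a n ^ (2 * m)\<close>, which vanishes because \<beta> < 2 m. The cases m = 1 and m = 2
  are the first- and second-moment methods.\<close>

lemma sum_negligible:
  fixes a :: "nat \<Rightarrow> real" and m :: nat
  assumes X [measurable]: "X \<in> borel_measurable M" and pot: "potter_bound \<beta> X" and \<beta>: "0 \<le> \<beta>" "\<beta> < real (2 * m)"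
    and pos: "0 < x1" "0 < upper_tail X x1"
    and lim: "(\<lambda>n. real n * upper_tail X (a n)) \<longlonglongrightarrow> 1"
    and Y [measurable]: "\<And>t. Y t \<in> borel_measurable M"
    and dom: "\<And>\<epsilon>. 0 < \<epsilon> \<Longrightarrow> \<exists>v. \<forall>x\<ge>v. \<forall>t. upper_tail (\<lambda>\<omega>. sqrt \<bar>Y t \<omega>\<bar>) x \<le> \<epsilon> * upper_tail X x"
    and trunc: "\<And>n b e. 0 < b \<Longrightarrow> 0 < e \<Longrightarrow> prob {\<omega>\<in>space M. e < \<bar>\<Sum>t=1..int n. Y t \<omega>\<bar>}
      \<le> (\<Sum>t=1..int n. upper_tail (\<lambda>\<omega>. sqrt \<bar>Y t \<omega>\<bar>) b)
        + (\<Sum>t=1..int n. expectation (\<lambda>\<omega>. min (sqrt \<bar>Y t \<omega>\<bar>) b ^ (2 * m))) / e ^ m"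
    and d: "0 < d"
  shows "(\<lambda>n. prob {\<omega>\<in>space M. d < \<bar>inverse ((a n)\<^sup>2) * (\<Sum>t=1..int n. Y t \<omega>)\<bar>}) \<longlonglongrightarrow> 0"
proof -
  let ?G = "upper_tail X"
  obtain C where C: "C \<ge> 1" "\<And>x y. 0 < x \<Longrightarrow> x \<le> y \<Longrightarrow> ?G x \<le> C * (y / x) powr \<beta> * ?G y"
    using potter_boundE[OF pot] by metis
  \<comment> \<open>A Potter bound prevents a tail that is positive at \<open>x1\<close> from
    vanishing further out.\<close>
  have Gpos: "0 < ?G y" if "x1 \<le> y" for y
  proof -
    have "0 < C * (y / x1) powr \<beta> * ?G y" using C(2)[OF pos(1) that] pos(2) by linarith
    then show ?thesis using upper_tail_nonneg[of X y] by (auto simp: zero_less_mult_iff)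
  qed
  have ev2: "\<forall>\<^sub>F n in sequentially. real n * ?G (a n) < 2"
    using order_tendstoD(2)[OF lim, of 2] by simp
  \<comment> \<open>The tail at \<open>a n\<close> is eventually below 2 / n, while it is positive
    at every fixed level; antitonicity pushes \<open>a n\<close> beyond each of them.\<close>
  have a_top: "filterlim a at_top sequentially"
    unfolding filterlim_at_top
  proof
    fix Z :: real
    let ?z = "max Z x1"
    have "((\<lambda>n. 2 / real n) \<longlongrightarrow> 0) sequentially" by (rule lim_const_over_n)
    then have "\<forall>\<^sub>F n in sequentially. 2 / real n < ?G ?z"
      using Gpos[of ?z] by (intro order_tendstoD(2)) auto
    then show "\<forall>\<^sub>F n in sequentially. Z \<le> a n"
      using ev2 eventually_gt_at_top[of 0]
    proof eventually_elim
      case (elim n)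
      have "?G (a n) < 2 / real n" using elim by (simp add: field_simps)
      then have "?G (a n) < ?G ?z" using elim by simp
      then have "\<not> a n \<le> ?z" using upper_tail_antimono[OF X, of "a n" ?z] by auto
      then show ?case by simp
    qed
  qed
  \<comment> \<open>Potter's inequality between \<open>x1\<close> and \<open>a n\<close> reads
    \<open>1 \<le> c * a n powr \<beta> * ?G (a n)\<close>. Multiplied by n, this bounds n by
    \<open>2 * c * a n powr \<beta>\<close> eventually.\<close>
  define c where "c = C * (1 / x1) powr \<beta> / ?G x1"
  have c: "0 < c" unfolding c_def using C(1) pos by auto
  have small: "(\<lambda>n. real n / a n ^ (2 * m)) \<longlonglongrightarrow> 0"
  proof (rule tendsto_sandwich[of "\<lambda>_. 0" _ _ "\<lambda>n. 2 * c * a n powr (\<beta> - real (2 * m))"])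
    have "((\<lambda>x. x powr (\<beta> - real (2 * m))) \<longlongrightarrow> 0) at_top"
      using \<beta> by (intro tendsto_neg_powr filterlim_ident) auto
    from tendsto_mult_right_zero[OF filterlim_compose[OF this a_top], of "2 * c"]
    show "(\<lambda>n. 2 * c * a n powr (\<beta> - real (2 * m))) \<longlonglongrightarrow> 0" by simp
    have big: "\<forall>\<^sub>F n in sequentially. x1 \<le> a n" using a_top by (simp add: filterlim_at_top)
    then show "\<forall>\<^sub>F n in sequentially. 0 \<le> real n / a n ^ (2 * m)"
      by eventually_elim (use pos in auto)
    show "\<forall>\<^sub>F n in sequentially. real n / a n ^ (2 * m) \<le> 2 * c * a n powr (\<beta> - real (2 * m))"
      using big ev2
    proof eventually_elim
      case (elim n)
      have an: "0 < a n" using elim pos by simp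
      have "?G x1 \<le> C * (a n / x1) powr \<beta> * ?G (a n)" by (rule C(2)[OF pos(1) elim(1)])
      also have "(a n / x1) powr \<beta> = (1 / x1) powr \<beta> * a n powr \<beta>"
        using an pos by (simp add: powr_divide)
      finally have "1 \<le> c * a n powr \<beta> * ?G (a n)"
        using pos(2) by (simp add: c_def field_simps)
      then have "real n * 1 \<le> real n * (c * a n powr \<beta> * ?G (a n))"
        by (intro mult_left_mono) auto
      also have "\<dots> = c * a n powr \<beta> * (real n * ?G (a n))" by simp
      also have "\<dots> \<le> c * a n powr \<beta> * 2"
        using elim(2) c by (intro mult_left_mono) auto
      finally have "real n / a n ^ (2 * m) \<le> c * a n powr \<beta> * 2 / a n ^ (2 * m)"
        using an by (intro divide_right_mono) auto
      also have "\<dots> = 2 * c * a n powr (\<beta> - real (2 * m))"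
        using an by (simp add: powr_diff powr_realpow[symmetric])
      finally show ?case .
    qed
  qed auto
  define K where "K = C * 2 powr \<beta> / (1 - 2 powr (\<beta> - real (2 * m)))"
  have K: "0 \<le> K"
  proof -
    have "2 powr (\<beta> - real (2 * m)) \<le> (2::real) powr 0" using \<beta> by (intro powr_mono) auto
    then show ?thesis unfolding K_def using C(1) by auto
  qed
  show ?thesis
  proof (rule order_tendstoI)
    fix \<kappa> :: real assume "0 < \<kappa>"
    \<comment> \<open>Eventually \<open>n * ?G (a n)\<close> is below 2, so this choice keeps the
      \<epsilon>-terms within \<kappa> / 2; the vanishing term gets the other half.\<close>
    define \<epsilon> where "\<epsilon> = \<kappa> / (4 * (1 + K / d ^ m))"
    have dm: "0 < d ^ m" using d by simp
    have e0: "0 < \<epsilon>" unfolding \<epsilon>_def using \<open>0 < \<kappa>\<close> K dm by (auto intro!: divide_pos_pos add_pos_nonneg)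
    have e_eq: "2 * \<epsilon> * (1 + K / d ^ m) = \<kappa> / 2"
    proof -
      have "1 + K / d ^ m \<noteq> 0" using K dm by (smt (verit) divide_nonneg_pos)
      moreover have "2 * (\<kappa> / (4 * D)) * D = \<kappa> / 2" if "D \<noteq> 0" for D
        using that by simp
      ultimately show ?thesis unfolding \<epsilon>_def by blast
    qed
    obtain v' where v': "\<And>x t. v' \<le> x \<Longrightarrow> upper_tail (\<lambda>\<omega>. sqrt \<bar>Y t \<omega>\<bar>) x \<le> \<epsilon> * ?G x"
      using dom[OF e0] by blast
    define v where "v = max 1 v'"
    have v: "0 < v" "\<And>x t. v \<le> x \<Longrightarrow> upper_tail (\<lambda>\<omega>. sqrt \<bar>Y t \<omega>\<bar>) x \<le> \<epsilon> * ?G x"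
      using v' by (auto simp: v_def)
    have "(\<lambda>n. (2 * v) ^ (2 * m) / d ^ m * (real n / a n ^ (2 * m))) \<longlonglongrightarrow> 0"
      by (rule tendsto_mult_right_zero[OF small])
    then have ev3: "\<forall>\<^sub>F n in sequentially. (2 * v) ^ (2 * m) / d ^ m * (real n / a n ^ (2 * m)) < \<kappa> / 2"
      using \<open>0 < \<kappa>\<close> by (intro order_tendstoD(2)) auto
    have ev4: "\<forall>\<^sub>F n in sequentially. v \<le> a n" using a_top by (simp add: filterlim_at_top)
    show "\<forall>\<^sub>F n in sequentially. prob {\<omega>\<in>space M. d < \<bar>inverse ((a n)\<^sup>2) * (\<Sum>t=1..int n. Y t \<omega>)\<bar>} < \<kappa>"
      using ev2 ev3 ev4
    proof eventually_elim
      case (elim n)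
      have an: "0 < a n" using elim v by simp
      let ?W = "\<lambda>t \<omega>. sqrt \<bar>Y t \<omega>\<bar>"
      have "{\<omega>\<in>space M. d < \<bar>inverse ((a n)\<^sup>2) * (\<Sum>t=1..int n. Y t \<omega>)\<bar>}
          = {\<omega>\<in>space M. d * (a n)\<^sup>2 < \<bar>\<Sum>t=1..int n. Y t \<omega>\<bar>}"
        using an by (auto simp: abs_mult field_simps)
      then have "prob {\<omega>\<in>space M. d < \<bar>inverse ((a n)\<^sup>2) * (\<Sum>t=1..int n. Y t \<omega>)\<bar>}
        \<le> (\<Sum>t=1..int n. upper_tail (?W t) (a n))
          + (\<Sum>t=1..int n. expectation (\<lambda>\<omega>. min (?W t \<omega>) (a n) ^ (2 * m))) / (d * (a n)\<^sup>2) ^ m"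
        using trunc[of "a n" "d * (a n)\<^sup>2" n] an d by simp
      also have "\<dots> \<le> (\<Sum>t=1..int n. \<epsilon> * ?G (a n))
          + (\<Sum>t=1..int n. (2 * v) ^ (2 * m) + \<epsilon> * (K * a n ^ (2 * m) * ?G (a n))) / (d * (a n)\<^sup>2) ^ m"
      proof (intro add_mono sum_mono divide_right_mono)
        show "upper_tail (?W t) (a n) \<le> \<epsilon> * ?G (a n)" for t using v(2) elim by blast
        show "expectation (\<lambda>\<omega>. min (?W t \<omega>) (a n) ^ (2 * m))
          \<le> (2 * v) ^ (2 * m) + \<epsilon> * (K * a n ^ (2 * m) * ?G (a n))" for t
          unfolding K_def using C v \<beta> an e0
          by (intro truncated_moment_le) (auto simp: upper_tail_nonneg)
      qed (use an d in auto)
      also have "\<dots> = \<epsilon> * (real n * ?G (a n)) * (1 + K / d ^ m)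
          + (2 * v) ^ (2 * m) / d ^ m * (real n / a n ^ (2 * m))"
        using an d by (simp add: power_mult_distrib power_mult[symmetric] field_simps)
      also have "\<dots> < \<epsilon> * 2 * (1 + K / d ^ m) + \<kappa> / 2"
      proof (rule add_le_less_mono)
        show "\<epsilon> * (real n * ?G (a n)) * (1 + K / d ^ m) \<le> \<epsilon> * 2 * (1 + K / d ^ m)"
          using elim e0 K dm by (intro mult_right_mono mult_left_mono) auto
      qed (use elim in auto)
      also have "\<dots> = \<kappa>" using e_eq by simp
      finally show ?case .
    qed
  qed (auto intro!: always_eventually less_le_trans[OF _ measure_nonneg])
qed

end

section \<open>Independence\<close>

context prob_space
begin

lemma indep_var_commute: "indep_var S X T Y \<longleftrightarrow> indep_var T Y S X"
proof -
  have "indep_set B A" if "indep_set A B" for A B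
    unfolding indep_sets2_eq
  proof (intro conjI ballI)
    show "prob (a \<inter> b) = prob a * prob b" if "a \<in> B" "b \<in> A" for a b
      using indep_setD[OF \<open>indep_set A B\<close> that(2,1)] by (simp only: Int_commute mult.commute)
  qed (use that in \<open>simp_all only: indep_sets2_eq\<close>)
  then show ?thesis unfolding indep_var_eq by blast
qed

lemma indep_vars_inj:
  assumes ind: "indep_vars (\<lambda>_. N) X UNIV" and f: "inj f"
  shows "indep_vars (\<lambda>_. N) (\<lambda>n. X (f n)) UNIV"
proof -
  have "indep_vars (\<lambda>n. PiM {f n} (\<lambda>_. N)) (\<lambda>n \<omega>. restrict (\<lambda>i. X i \<omega>) {f n}) UNIV"
    using f by (intro indep_vars_restrict[OF ind]) (auto simp: disjoint_family_on_def inj_def)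
  from indep_vars_compose2[OF this, of "\<lambda>n x. x (f n)" "\<lambda>_. N"]
  show ?thesis by simp
qed

text \<open>Every injective relabelling of an iid family has the same product law. Applied to
  translations in time, this is the source of stationarity; applied to an enumeration, it gives an
  iid sequence.\<close>

lemma distr_family_inj:
  assumes ind: "indep_vars (\<lambda>_. N) X UNIV" and ident: "\<And>i. distr M N (X i) = \<mu>" and f: "inj f"
  shows "distr M (PiM UNIV (\<lambda>_. N)) (\<lambda>\<omega> n. X (f n) \<omega>) = PiM UNIV (\<lambda>_. \<mu>)"
proof -
  have iv: "indep_vars (\<lambda>_. N) (\<lambda>n. X (f n)) UNIV" by (rule indep_vars_inj[OF ind f])
  then have rv: "random_variable N (X (f n))" for n by (simp add: indep_vars_def)
  from iv show ?thesis
    by (subst (asm) indep_vars_iff_distr_eq_PiM) (auto simp: rv ident restrict_UNIV)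
qed

lemma distr_mult_indep_cong:
  assumes AB: "indep_var borel A borel B" "indep_var borel A' borel B'"
    and eq: "distr M borel A = distr M borel A'" "distr M borel B = distr M borel B'"
  shows "distr M borel (\<lambda>\<omega>. A \<omega> * B \<omega> :: real) = distr M borel (\<lambda>\<omega>. A' \<omega> * B' \<omega>)"
proof -
  have *: "distr M borel (\<lambda>\<omega>. A \<omega> * B \<omega>) = distr (distr M borel A \<Otimes>\<^sub>M distr M borel B) borel (\<lambda>(x, y). x * y)"
    if "indep_var borel A borel B" for A B :: "'a \<Rightarrow> real"
  proof -
    have [measurable]: "A \<in> borel_measurable M" "B \<in> borel_measurable M"
      using that indep_var_rv1 indep_var_rv2 by blast+
    have pair: "distr M borel A \<Otimes>\<^sub>M distr M borel B = distr M (borel \<Otimes>\<^sub>M borel) (\<lambda>\<omega>. (A \<omega>, B \<omega>))"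
      using that by (simp add: indep_var_distribution_eq)
    show ?thesis unfolding pair by (subst distr_distr) (auto simp: comp_def)
  qed
  show ?thesis unfolding *[OF AB(1)] *[OF AB(2)] eq ..
qed

end

section \<open>The model\<close>

text \<open>A fixed enumeration turns the lattice of innovations into a sequence.\<close>

definition site :: "nat \<Rightarrow> int \<times> int" where
  "site = from_nat_into UNIV"

lemma bij_site: "bij site"
  unfolding site_def by (rule bij_betw_from_nat_into) (auto intro!: finite_prod[THEN iffD1] simp: finite_prod)

locale sv_model = prob_space +
  fixes Z eta :: "int \<Rightarrow> int \<Rightarrow> 'a \<Rightarrow> real"
    and psi :: "int \<Rightarrow> int \<Rightarrow> real" and \<alpha> \<delta> :: real and L :: "real \<Rightarrow> real"
  assumes Z_indep: "indep_vars (\<lambda>_. borel) (\<lambda>(i,t). Z i t) UNIV"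
    and Z_ident: "\<And>i t. distr M borel (Z i t) = distr M borel (Z 0 0)"
    and eta_indep: "indep_vars (\<lambda>_. borel) (\<lambda>(i,t). eta i t) UNIV"
    and eta_ident: "\<And>i t. distr M borel (eta i t) = distr M borel (eta 0 0)"
    and Z_sigma_indep: "indep_var
          (PiM (UNIV :: (int \<times> int) set) (\<lambda>_. borel)) (\<lambda>\<omega> (i,t). Z i t \<omega>)
          (PiM (UNIV :: (int \<times> int) set) (\<lambda>_. borel)) (\<lambda>\<omega> (i,t). sv_sigma psi eta i t \<omega>)"
    and psi_nonneg: "\<And>k l. psi k l \<ge> 0"
    and psi_le1: "\<And>k l. psi k l \<le> 1"
    and psi_max: "\<exists>k l. psi k l = 1"
    and psi_summable: "(\<lambda>(k,l). psi k l) summable_on UNIV"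
    and sigma_welldef: "\<And>i t. AE \<omega> in M. (\<lambda>(k,l). \<bar>psi k l * eta (i - k) (t - l) \<omega>\<bar>) summable_on UNIV"
    and slowly_varying: "slowly_varying L"
    and tail: "\<And>x. 0 < x \<Longrightarrow> measure M {\<omega>\<in>space M. exp (eta 0 0 \<omega>) > x} = x powr (-\<alpha>) * L x"
    and alpha: "0 < \<alpha>"
    and delta: "0 < \<delta>"
    and Z_moment: "(\<integral>\<^sup>+\<omega>. ennreal (\<bar>Z 0 0 \<omega>\<bar> powr (\<alpha> + \<delta>)) \<partial>M) < \<infinity>"
begin

text \<open>The summation index is changed from lags to innovation sites. All rows i then weight one
  common sequence, and time enters through that sequence alone: \<open>wt\<close> does not depend on
  t.\<close>

definition eps :: "int \<Rightarrow> nat \<Rightarrow> 'a \<Rightarrow> real" where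
  "eps t n = eta (fst (site n)) (snd (site n) + t)"

definition wt :: "int \<Rightarrow> nat \<Rightarrow> real" where
  "wt i n = psi (i - fst (site n)) (- snd (site n))"

abbreviation "\<sigma> \<equiv> sv_sigma psi eta"
abbreviation "X \<equiv> sv_X psi eta Z"

lemma inj_shift_site: "inj (\<lambda>n. (fst (site n), snd (site n) + t))"
  using bij_site by (auto simp: inj_def bij_def prod_eq_iff)

lemma component_meas [measurable]:
  "(\<lambda>x. x p) \<in> borel_measurable (PiM (UNIV :: (int \<times> int) set) (\<lambda>_. borel :: real measure))"
  by (rule measurable_component_singleton) simp

lemma distr_eps: "distr M (PiM UNIV (\<lambda>_. borel)) (\<lambda>\<omega> n. eps t n \<omega>) = PiM UNIV (\<lambda>_. distr M borel (eta 0 0))"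
  using distr_family_inj[OF eta_indep _ inj_shift_site[of t], of "distr M borel (eta 0 0)"] eta_ident
  by (simp add: eps_def case_prod_beta)

sublocale iid_sequence M "eps 0" \<alpha> L
proof
  show "indep_vars (\<lambda>_. borel) (eps 0) UNIV"
    using indep_vars_inj[OF eta_indep inj_shift_site[of 0]] by (simp add: eps_def[abs_def] case_prod_beta)
  show "distr M borel (eps 0 n) = distr M borel (eps 0 0)" for n
    unfolding eps_def by (metis eta_ident)
  fix x :: real assume "0 < x"
  have [measurable]: "eta i t \<in> borel_measurable M" for i t
    using eta_indep by (auto simp: indep_vars_def)
  have "upper_tail (\<lambda>\<omega>. exp (eta i t \<omega>)) x = upper_tail (\<lambda>\<omega>. exp (eta 0 0 \<omega>)) x" for i t
  proof -
    have "distr M borel (\<lambda>\<omega>. exp (eta i t \<omega>)) = distr (distr M borel (eta i t)) borel exp" for i t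
      by (subst distr_distr) (auto simp: comp_def)
    then have "distr M borel (\<lambda>\<omega>. exp (eta i t \<omega>)) = distr M borel (\<lambda>\<omega>. exp (eta 0 0 \<omega>))"
      using eta_ident[of i t] by simp
    then show ?thesis by (simp add: upper_tail_distr)
  qed
  then show "upper_tail (\<lambda>\<omega>. exp (eps 0 0 \<omega>)) x = x powr (-\<alpha>) * L x"
    using tail[OF \<open>0 < x\<close>] by (simp add: eps_def upper_tail_def)
qed (use alpha slowly_varying in auto)

lemma exp_eta_moment_eps:
  "(\<integral>\<^sup>+\<omega>. ennreal (exp (\<alpha> * eta 0 0 \<omega>)) \<partial>M) = (\<integral>\<^sup>+\<omega>. ennreal (exp (\<alpha> * eps 0 0 \<omega>)) \<partial>M)"
proof -
  have [measurable]: "eta i t \<in> borel_measurable M" for i t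
    using eta_indep by (auto simp: indep_vars_def)
  have "(\<integral>\<^sup>+\<omega>. ennreal (exp (\<alpha> * eta i t \<omega>)) \<partial>M) = (\<integral>\<^sup>+x. ennreal (exp (\<alpha> * x)) \<partial>distr M borel (eta i t))" for i t
    by (subst nn_integral_distr) auto
  then show ?thesis unfolding eps_def by (metis eta_ident)
qed

lemma bij_lag: "bij (\<lambda>n. (i - fst (site n), - snd (site n)))"
proof -
  have "bij (\<lambda>(a, b). (i - a, - b :: int))"
    by (rule bij_betw_byWitness[where f'="\<lambda>(a, b). (i - a, - b)"]) auto
  from bij_comp[OF bij_site this] show ?thesis by (simp add: comp_def case_prod_beta)
qed

lemma wt_bounds: "0 \<le> wt i n" "wt i n \<le> 1"
  by (simp_all add: wt_def psi_nonneg psi_le1)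

lemma wt_summable: "summable (wt i)"
proof -
  have "(\<lambda>n. (\<lambda>(k,l). psi k l) (i - fst (site n), - snd (site n))) summable_on UNIV"
    using psi_summable by (subst summable_on_reindex_bij_betw[OF bij_lag])
  then show ?thesis by (simp add: wt_def[abs_def] summable_on_imp_summable)
qed

text \<open>The unordered sum over lags is reindexed by the bijection between site numbers and lags;
  absolute convergence makes it agree with the ordinary series.\<close>

lemma sigma_eq_suminf:
  "AE \<omega> in M. summable (\<lambda>n. \<bar>wt i n * eps t n \<omega>\<bar>) \<and> \<sigma> i t \<omega> = exp (\<Sum>n. wt i n * eps t n \<omega>)"
  using sigma_welldef[of i t]
proof eventually_elim
  case (elim \<omega>)
  let ?f = "\<lambda>(k,l). psi k l * eta (i - k) (t - l) \<omega>"
  let ?h = "\<lambda>n. (i - fst (site n), - snd (site n))"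
  have fh: "?f (?h n) = wt i n * eps t n \<omega>" for n
    by (simp add: wt_def eps_def add.commute)
  have "(\<lambda>p. \<bar>?f p\<bar>) = (\<lambda>(k,l). \<bar>psi k l * eta (i - k) (t - l) \<omega>\<bar>)" by auto
  with elim have "(\<lambda>p. \<bar>?f p\<bar>) summable_on UNIV" by simp
  then have "(\<lambda>n. \<bar>?f (?h n)\<bar>) summable_on UNIV"
    by (subst summable_on_reindex_bij_betw[OF bij_lag, of "\<lambda>p. \<bar>?f p\<bar>"])
  then have "(\<lambda>n. \<bar>wt i n * eps t n \<omega>\<bar>) summable_on UNIV" unfolding fh .
  then have s: "summable (\<lambda>n. \<bar>wt i n * eps t n \<omega>\<bar>)" by (rule summable_on_imp_summable)
  then have "((\<lambda>n. wt i n * eps t n \<omega>) has_sum (\<Sum>n. wt i n * eps t n \<omega>)) UNIV"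
    by (intro norm_summable_imp_has_sum) (auto dest: summable_rabs_cancel)
  then have "infsum (\<lambda>n. ?f (?h n)) UNIV = (\<Sum>n. wt i n * eps t n \<omega>)"
    unfolding fh by (rule infsumI)
  moreover have "infsum (\<lambda>n. ?f (?h n)) UNIV = infsum ?f UNIV"
    by (rule infsum_reindex_bij_betw[OF bij_lag])
  ultimately show ?case using s by (simp add: sv_sigma_def)
qed

lemma admissible_wt: "admissible (wt i)"
  using sigma_eq_suminf[of i 0] by (auto simp: admissible_def wt_bounds wt_summable elim: eventually_mono)

lemma sigma_eq_wsum: "AE \<omega> in M. \<sigma> i 0 \<omega> = exp (wsum (wt i) \<omega>)"
  using sigma_eq_suminf[of i 0] by (auto simp: wsum_def elim: eventually_mono)

section \<open>Independence of volatilities and noise, and stationarity in time\<close>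

lemma Z_meas [measurable]: "Z i t \<in> borel_measurable M"
  using Z_indep by (auto simp: indep_vars_def)

lemma sigma_meas [measurable]: "\<sigma> i t \<in> borel_measurable M"
proof -
  have "(\<lambda>\<omega> (i,t). \<sigma> i t \<omega>) \<in> measurable M (PiM UNIV (\<lambda>_. borel))"
    using Z_sigma_indep by (rule indep_var_rv2)
  from measurable_compose[OF this measurable_component_singleton[of "(i,t)"]]
  show ?thesis by simp
qed

lemma X_meas [measurable]: "X i t \<in> borel_measurable M"
  unfolding sv_X_def[abs_def] by measurable

lemma indep_sigma_Z:
  assumes f: "f \<in> borel_measurable (PiM UNIV (\<lambda>_. borel))" and g: "g \<in> borel_measurable (PiM UNIV (\<lambda>_. borel))"
  shows "indep_var borel (\<lambda>\<omega>. f (\<lambda>(i,t). \<sigma> i t \<omega>)) borel (\<lambda>\<omega>. g (\<lambda>(i,t). Z i t \<omega>))"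
  using indep_var_compose[OF Z_sigma_indep[THEN indep_var_commute[THEN iffD1]] f g] by (simp add: comp_def)

text \<open>For every t the product is almost surely the same measurable functional \<open>g\<close>
  of the shifted innovation sequence, whose joint law does not depend on t.\<close>

lemma sigma_prod_distr:
  "distr M borel (\<lambda>\<omega>. sqrt (\<sigma> i t \<omega> * \<sigma> j t \<omega>)) = distr M borel (\<lambda>\<omega>. sqrt (\<sigma> i 0 \<omega> * \<sigma> j 0 \<omega>))"
proof -
  define g where "g x = sqrt (exp (\<Sum>n. wt i n * x n) * exp (\<Sum>n. wt j n * x n))" for x :: "nat \<Rightarrow> real"
  have [measurable]: "g \<in> borel_measurable (PiM UNIV (\<lambda>_. borel))"
    unfolding g_def[abs_def] by measurable
  have [measurable]: "(\<lambda>\<omega> n. eps t n \<omega>) \<in> measurable M (PiM UNIV (\<lambda>_. borel))" for t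
    using eta_indep by (intro measurable_PiM_single') (auto simp: indep_vars_def eps_def)
  have "distr M borel (\<lambda>\<omega>. sqrt (\<sigma> i t \<omega> * \<sigma> j t \<omega>)) = distr (PiM UNIV (\<lambda>_. distr M borel (eta 0 0))) borel g" for t
  proof -
    have "AE \<omega> in M. sqrt (\<sigma> i t \<omega> * \<sigma> j t \<omega>) = g (\<lambda>n. eps t n \<omega>)"
      using sigma_eq_suminf[of i t] sigma_eq_suminf[of j t] by eventually_elim (simp add: g_def)
    then have "distr M borel (\<lambda>\<omega>. sqrt (\<sigma> i t \<omega> * \<sigma> j t \<omega>)) = distr M borel (\<lambda>\<omega>. g (\<lambda>n. eps t n \<omega>))"
      by (intro distr_cong_AE) auto
    also have "\<dots> = distr (distr M (PiM UNIV (\<lambda>_. borel)) (\<lambda>\<omega> n. eps t n \<omega>)) borel g"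
      by (subst distr_distr) (auto simp: comp_def)
    finally show ?thesis by (simp only: distr_eps)
  qed
  then show ?thesis by metis
qed

lemma Z_prod_distr:
  "distr M borel (\<lambda>\<omega>. sqrt \<bar>Z i t \<omega> * Z j t \<omega>\<bar>) = distr M borel (\<lambda>\<omega>. sqrt \<bar>Z i 0 \<omega> * Z j 0 \<omega>\<bar>)"
proof -
  define g where "g x = sqrt \<bar>x (i, 0) * x (j, 0)\<bar>" for x :: "int \<times> int \<Rightarrow> real"
  have [measurable]: "g \<in> borel_measurable (PiM UNIV (\<lambda>_. borel))"
    unfolding g_def[abs_def] by measurable
  have m [measurable]: "(\<lambda>\<omega> p. Z (fst p) (snd p + t) \<omega>) \<in> measurable M (PiM UNIV (\<lambda>_. borel))" for t
    by (intro measurable_PiM_single') auto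
  have "distr M (PiM UNIV (\<lambda>_. borel)) (\<lambda>\<omega> p. Z (fst p) (snd p + t) \<omega>) = PiM UNIV (\<lambda>_. distr M borel (Z 0 0))" for t
    using distr_family_inj[OF Z_indep, of "distr M borel (Z 0 0)" "\<lambda>p. (fst p, snd p + t)"] Z_ident
    by (simp add: case_prod_beta inj_def prod_eq_iff)
  then have "distr (PiM UNIV (\<lambda>_. distr M borel (Z 0 0))) borel g
      = distr (distr M (PiM UNIV (\<lambda>_. borel)) (\<lambda>\<omega> p. Z (fst p) (snd p + t) \<omega>)) borel g" for t
    by simp
  also have "\<dots> t = distr M borel (\<lambda>\<omega>. sqrt \<bar>Z i t \<omega> * Z j t \<omega>\<bar>)" for t
    by (subst distr_distr) (auto simp: comp_def g_def)
  finally show ?thesis by metis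
qed

lemma sqrt_XX: "sqrt \<bar>X i t \<omega> * X j t \<omega>\<bar> = sqrt (\<sigma> i t \<omega> * \<sigma> j t \<omega>) * sqrt \<bar>Z i t \<omega> * Z j t \<omega>\<bar>"
  by (simp add: sv_X_def sv_sigma_def abs_mult real_sqrt_mult mult_ac)

lemma indep_sqrt_XX:
  "indep_var borel (\<lambda>\<omega>. sqrt (\<sigma> i t \<omega> * \<sigma> j t \<omega>)) borel (\<lambda>\<omega>. sqrt \<bar>Z i t \<omega> * Z j t \<omega>\<bar>)"
proof -
  have "(\<lambda>x :: int \<times> int \<Rightarrow> real. sqrt (x (i,t) * x (j,t))) \<in> borel_measurable (PiM UNIV (\<lambda>_. borel))"
    "(\<lambda>x :: int \<times> int \<Rightarrow> real. sqrt \<bar>x (i,t) * x (j,t)\<bar>) \<in> borel_measurable (PiM UNIV (\<lambda>_. borel))"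
    by measurable
  from indep_sigma_Z[OF this] show ?thesis by simp
qed

lemma upper_tail_XX_stationary:
  "upper_tail (\<lambda>\<omega>. sqrt \<bar>X i t \<omega> * X j t \<omega>\<bar>) x = upper_tail (\<lambda>\<omega>. sqrt \<bar>X i 0 \<omega> * X j 0 \<omega>\<bar>) x"
  using distr_mult_indep_cong[OF indep_sqrt_XX indep_sqrt_XX sigma_prod_distr Z_prod_distr, of i t j]
  by (simp add: upper_tail_distr flip: sqrt_XX)

lemma indep_sigma_absZ: "indep_var borel (\<sigma> i t) borel (\<lambda>\<omega>. \<bar>Z i t \<omega>\<bar>)"
proof -
  have "(\<lambda>x :: int \<times> int \<Rightarrow> real. x (i,t)) \<in> borel_measurable (PiM UNIV (\<lambda>_. borel))"
    "(\<lambda>x :: int \<times> int \<Rightarrow> real. \<bar>x (i,t)\<bar>) \<in> borel_measurable (PiM UNIV (\<lambda>_. borel))"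
    by measurable
  from indep_sigma_Z[OF this] show ?thesis by simp
qed

lemma ex_wt_1: "\<exists>n. wt i n = 1"
proof -
  obtain k l where kl: "psi k l = 1" using psi_max by blast
  obtain n where "(k, l) = (i - fst (site n), - snd (site n))"
    using surjD[OF bij_is_surj[OF bij_lag[of i]], of "(k, l)"] by blast
  then show ?thesis using kl by (auto simp: wt_def)
qed

lemma abs_X: "\<bar>X i t \<omega>\<bar> = \<sigma> i t \<omega> * \<bar>Z i t \<omega>\<bar>"
  by (simp add: sv_X_def sv_sigma_def abs_mult)

lemma potter_X:
  assumes "\<alpha> < \<beta>"
  shows "potter_bound \<beta> (\<lambda>\<omega>. \<bar>X i 0 \<omega>\<bar>)"
proof -
  obtain n where "wt i n = 1" using ex_wt_1 by blast
  then have pot: "potter_bound \<beta> (\<lambda>\<omega>. exp (wsum (wt i) \<omega>))"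
    by (intro potter_wsum[OF admissible_wt _ assms])
  have AE: "AE \<omega> in M. exp (wsum (wt i) \<omega>) = \<sigma> i 0 \<omega>"
    using sigma_eq_wsum[of i] by eventually_elim simp
  have "potter_bound \<beta> (\<sigma> i 0)"
    by (rule potter_bound_cong_AE[OF _ _ AE pot]) measurable
  from potter_bound_mult[OF this indep_sigma_absZ] show ?thesis by (simp add: abs_X)
qed

lemma Z_moment_le:
  assumes "0 \<le> q" "q \<le> \<alpha> + \<delta>"
  shows "integrable M (\<lambda>\<omega>. \<bar>Z i t \<omega>\<bar> powr q)"
proof -
  have "(\<integral>\<^sup>+\<omega>. ennreal (\<bar>Z i t \<omega>\<bar> powr (\<alpha> + \<delta>)) \<partial>M) = (\<integral>\<^sup>+x. ennreal (\<bar>x\<bar> powr (\<alpha> + \<delta>)) \<partial>distr M borel (Z i t))" for i t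
    by (subst nn_integral_distr) auto
  then have "(\<integral>\<^sup>+\<omega>. ennreal (\<bar>Z i t \<omega>\<bar> powr (\<alpha> + \<delta>)) \<partial>M) < \<infinity>"
    using Z_moment Z_ident[of i t] by metis
  then have int: "integrable M (\<lambda>\<omega>. \<bar>Z i t \<omega>\<bar> powr (\<alpha> + \<delta>))"
    by (intro integrableI_nonneg) auto
  have pt: "y powr q \<le> 1 + y powr (\<alpha> + \<delta>)" if "0 \<le> y" for y :: real
  proof (cases "y \<le> 1")
    case True
    then have "y powr q \<le> 1" using that assms by (intro powr_le1) auto
    then show ?thesis by (simp add: add_increasing2)
  next
    case False
    then have "y powr q \<le> y powr (\<alpha> + \<delta>)" using assms by (intro powr_mono) auto
    then show ?thesis by simp
  qed
  show ?thesis
    by (rule Bochner_Integration.integrable_bound[OF Bochner_Integration.integrable_add[OF integrable_const[of 1] int]])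
      (auto intro!: AE_I2 order_trans[OF pt])
qed

text \<open>The square root halves the exponent on each factor, and the factors are independent
  because i and j differ, so moments up to twice the order assumed for \<open>Z\<close> are
  finite.\<close>

lemma ZZ_moment:
  assumes "0 \<le> q" "q \<le> 2 * (\<alpha> + \<delta>)" "i \<noteq> j"
  shows "integrable M (\<lambda>\<omega>. sqrt \<bar>Z i t \<omega> * Z j t \<omega>\<bar> powr q)"
proof -
  have "indep_var (PiM {(i,t)} (\<lambda>_. borel)) (\<lambda>\<omega>. restrict (\<lambda>p. (case p of (i,t) \<Rightarrow> Z i t) \<omega>) {(i,t)})
      (PiM {(j,t)} (\<lambda>_. borel)) (\<lambda>\<omega>. restrict (\<lambda>p. (case p of (i,t) \<Rightarrow> Z i t) \<omega>) {(j,t)})"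
    using assms(3) by (intro indep_var_restrict[OF Z_indep]) auto
  from indep_var_compose[OF this, of "\<lambda>x. \<bar>x (i,t)\<bar> powr (q/2)" borel "\<lambda>x. \<bar>x (j,t)\<bar> powr (q/2)" borel]
  have "indep_var borel (\<lambda>\<omega>. \<bar>Z i t \<omega>\<bar> powr (q/2)) borel (\<lambda>\<omega>. \<bar>Z j t \<omega>\<bar> powr (q/2))"
    by (simp add: comp_def)
  then have "integrable M (\<lambda>\<omega>. \<bar>Z i t \<omega>\<bar> powr (q/2) * \<bar>Z j t \<omega>\<bar> powr (q/2))"
    using assms by (intro indep_var_integrable Z_moment_le) auto
  moreover have "sqrt \<bar>x * y\<bar> powr q = \<bar>x\<bar> powr (q/2) * \<bar>y\<bar> powr (q/2)" for x y :: real
  proof -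
    have "sqrt \<bar>x * y\<bar> powr q = (\<bar>x * y\<bar> powr (1/2)) powr q" by (simp add: powr_half_sqrt)
    then show ?thesis by (simp add: powr_powr abs_mult powr_mult)
  qed
  ultimately show ?thesis by simp
qed

section \<open>Overlapping weights of two rows, and off-diagonal products against a single
  entry\<close>

lemma psi_le_psi_sup: "wt i n + wt j n \<le> psi_sup psi i j"
proof -
  let ?f = "\<lambda>kl. psi (fst kl) (snd kl) + psi (fst kl + i - j) (snd kl)"
  have "bdd_above (range ?f)"
    by (rule bdd_aboveI[of _ 2]) (auto intro!: order_trans[OF add_mono[OF psi_le1 psi_le1]])
  \<comment> \<open>At this lag the first term of \<open>?f\<close> is \<open>wt j n\<close>, and
    the shift by i - j turns the second into \<open>wt i n\<close>.\<close>
  from cSUP_upper[OF UNIV_I this, of "(j - fst (site n), - snd (site n))"]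
  show ?thesis by (simp add: psi_sup_def wt_def add.commute)
qed

lemma psi_sup_le: "psi_sup psi i j \<le> 2"
  unfolding psi_sup_def
  by (rule cSUP_least) (auto intro!: order_trans[OF add_mono[OF psi_le1 psi_le1]])

lemma psi_sup_ge: "1 \<le> psi_sup psi i j"
proof -
  obtain n where "wt i n = 1" using ex_wt_1 by blast
  then show ?thesis using psi_le_psi_sup[of i n j] wt_bounds[of j n] by simp
qed

lemma psi_sup_diag: "psi_sup psi i i = 2"
proof -
  obtain n where "wt i n = 1" using ex_wt_1 by blast
  then show ?thesis using psi_le_psi_sup[of i n i] psi_sup_le[of i i] by simp
qed

text \<open>With combined weights at most c < 2 the root of the product has a finite moment of some
  order r > \<alpha>, so its tail is at most of order x^(-r). The tail of \<open>X\<close> is at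
  least of order x^(-\<beta>) by Potter's inequality, with \<alpha> < \<beta> < r.\<close>

lemma dominated_by_moment:
  assumes ij: "i \<noteq> j" and c: "0 < c" "c < 2" "\<And>n. wt i n + wt j n \<le> c"
    and pos: "0 < x1" "0 < upper_tail (\<lambda>\<omega>. \<bar>X 1 0 \<omega>\<bar>) x1" and e: "0 < e"
  shows "\<exists>v. \<forall>x\<ge>v. upper_tail (\<lambda>\<omega>. sqrt \<bar>X i 0 \<omega> * X j 0 \<omega>\<bar>) x \<le> e * upper_tail (\<lambda>\<omega>. \<bar>X 1 0 \<omega>\<bar>) x"
proof -
  let ?G = "upper_tail (\<lambda>\<omega>. \<bar>X 1 0 \<omega>\<bar>)"
  let ?W = "\<lambda>\<omega>. sqrt \<bar>X i 0 \<omega> * X j 0 \<omega>\<bar>"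
  let ?A = "\<lambda>\<omega>. sqrt (\<sigma> i 0 \<omega> * \<sigma> j 0 \<omega>)" and ?V = "\<lambda>\<omega>. sqrt \<bar>Z i 0 \<omega> * Z j 0 \<omega>\<bar>"
  \<comment> \<open>An order below 2 \<alpha> / c gives the volatility part its moment through
    \<open>r * c / 2 < \<alpha>\<close>; an order below 2 \<alpha> lets \<open>ZZ_moment\<close>
    treat the noise part.\<close>
  have "\<alpha> < min (2 * \<alpha> / c) (2 * \<alpha>)" using alpha c by (auto simp: field_simps)
  then obtain r where r: "\<alpha> < r" "r < min (2 * \<alpha> / c) (2 * \<alpha>)" using dense by blast
  then have rc: "r * c / 2 < \<alpha>" using c by (simp add: field_simps)
  have r0: "0 < r" using r alpha by simp
  obtain \<beta> where \<beta>: "\<alpha> < \<beta>" "\<beta> < r" using dense[OF r(1)] by blast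
  have adm: "admissible (\<lambda>n. wt i n + wt j n)" by (intro admissible_add admissible_wt)
  have "integrable M (\<lambda>\<omega>. exp (wsum (\<lambda>n. r / 2 * (wt i n + wt j n)) \<omega>))"
  proof (rule wsum_moment[where s="r * c / 2"])
    show "admissible (\<lambda>n. r / 2 * (wt i n + wt j n))"
      using r0 by (intro admissible_scale[OF adm]) auto
    show "r / 2 * (wt i n + wt j n) \<le> r * c / 2" for n
      using mult_left_mono[OF c(3)[of n], of "r / 2"] r0 by simp
  qed (use r0 c rc in auto)
  moreover have "AE \<omega> in M. exp (wsum (\<lambda>n. r / 2 * (wt i n + wt j n)) \<omega>) = ?A \<omega> powr r"
    using wsum_scale[OF adm, of "r / 2"] wsum_add[OF admissible_wt[of i] admissible_wt[of j]]
      sigma_eq_wsum[of i] sigma_eq_wsum[of j]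
  proof eventually_elim
    case (elim \<omega>)
    have "?A \<omega> = exp (wsum (wt i) \<omega> + wsum (wt j) \<omega>) powr (1/2)"
      unfolding elim by (simp add: powr_half_sqrt exp_add)
    then have "?A \<omega> powr r = exp (r / 2 * (wsum (wt i) \<omega> + wsum (wt j) \<omega>))"
      by (simp add: powr_def)
    then show ?case unfolding elim by simp
  qed
  ultimately have intA: "integrable M (\<lambda>\<omega>. ?A \<omega> powr r)"
    by (subst (asm) integrable_cong_AE) auto
  have intV: "integrable M (\<lambda>\<omega>. ?V \<omega> powr r)"
    using r r0 delta by (intro ZZ_moment ij) auto
  have "indep_var borel (\<lambda>\<omega>. ?A \<omega> powr r) borel (\<lambda>\<omega>. ?V \<omega> powr r)"
    using indep_var_compose[OF indep_sqrt_XX, of "\<lambda>x. x powr r" borel "\<lambda>x. x powr r" borel] by (simp add: comp_def)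
  then have "integrable M (\<lambda>\<omega>. ?A \<omega> powr r * ?V \<omega> powr r)"
    by (intro indep_var_integrable intA intV)
  then have intW: "integrable M (\<lambda>\<omega>. ?W \<omega> powr r)"
    unfolding sqrt_XX by (subst powr_mult) (auto simp: sv_sigma_def)
  define K where "K = expectation (\<lambda>\<omega>. ?W \<omega> powr r)"
  have K: "0 \<le> K" unfolding K_def by (intro integral_nonneg_AE) auto
  have up: "upper_tail ?W x \<le> K / x powr r" if "0 < x" for x
  proof -
    have "upper_tail ?W x \<le> prob {\<omega>\<in>space M. x powr r \<le> ?W \<omega> powr r}"
      unfolding upper_tail_def using that r0
      by (intro finite_measure_mono) (auto intro!: powr_mono2)
    also have "\<dots> \<le> K / x powr r"
      unfolding K_def using that intW by (intro integral_Markov_inequality_measure[where A="{}"]) auto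
    finally show ?thesis .
  qed
  obtain C where C: "C \<ge> 1" "\<And>x y. 0 < x \<Longrightarrow> x \<le> y \<Longrightarrow> ?G x \<le> C * (y / x) powr \<beta> * ?G y"
    using potter_boundE[OF potter_X[OF \<beta>(1), of 1]] by metis
  define D where "D = C * K / (x1 powr \<beta> * ?G x1)"
  have D: "0 \<le> D" unfolding D_def using C K pos by auto
  have main: "upper_tail ?W x \<le> D * x powr (\<beta> - r) * ?G x" if "x1 \<le> x" for x
  proof -
    have x0: "0 < x" using that pos by simp
    have "?G x1 \<le> C * (x powr \<beta> / x1 powr \<beta>) * ?G x"
      using C(2)[OF pos(1) that] x0 pos by (simp add: powr_divide)
    then have g: "1 \<le> C / (x1 powr \<beta> * ?G x1) * x powr \<beta> * ?G x"
      using pos by (simp add: field_simps)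
    have "upper_tail ?W x \<le> K / x powr r * 1" using up[OF x0] by simp
    also have "\<dots> \<le> K / x powr r * (C / (x1 powr \<beta> * ?G x1) * x powr \<beta> * ?G x)"
      using K by (intro mult_left_mono g) auto
    also have "\<dots> = D * x powr (\<beta> - r) * ?G x" by (simp add: D_def powr_diff mult_ac)
    finally show ?thesis .
  qed
  have "((\<lambda>x. x powr (\<beta> - r)) \<longlongrightarrow> 0) at_top"
    using \<beta> by (intro tendsto_neg_powr filterlim_ident) auto
  from tendsto_mult_right_zero[OF this, of D]
  have "\<forall>\<^sub>F x in at_top. D * x powr (\<beta> - r) < e" using e by (intro order_tendstoD(2))
  then obtain v where v: "\<And>x. v \<le> x \<Longrightarrow> D * x powr (\<beta> - r) < e"
    by (auto simp: eventually_at_top_linorder)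
  show ?thesis
  proof (intro exI[of _ "max v x1"] allI impI)
    fix x assume x: "max v x1 \<le> x"
    have "upper_tail ?W x \<le> D * x powr (\<beta> - r) * ?G x" using main x by simp
    also have "\<dots> \<le> e * ?G x"
      using v[of x] x by (intro mult_right_mono upper_tail_nonneg) auto
    finally show "upper_tail ?W x \<le> e * ?G x" .
  qed
qed

text \<open>Summable weights tend to 0, so only finitely many equal 1. Passing from site numbers to
  lags shows that their number is the same in every row, so any row can be compared with row
  1.\<close>

lemma card_wt_1: "finite {n. wt i n = 1}" "card {n. wt i n = 1} = card {(k,l). psi k l = 1}"
proof -
  have "wt i \<longlonglongrightarrow> 0" by (rule summable_LIMSEQ_zero[OF wt_summable])
  then have "\<forall>\<^sub>F n in sequentially. wt i n < 1" by (rule order_tendstoD) simp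
  then obtain N where "\<And>n. N \<le> n \<Longrightarrow> wt i n < 1" by (auto simp: eventually_sequentially)
  then have "{n. wt i n = 1} \<subseteq> {..<N}" by (force simp: not_less[symmetric])
  then show "finite {n. wt i n = 1}" by (rule finite_subset) simp
  have "bij_betw (\<lambda>n. (i - fst (site n), - snd (site n))) {n. wt i n = 1} {(k,l). psi k l = 1}"
    using bij_lag[of i] unfolding bij_betw_def
  proof (intro conjI; elim conjE)
    assume surj: "range (\<lambda>n. (i - fst (site n), - snd (site n))) = UNIV"
    show "(\<lambda>n. (i - fst (site n), - snd (site n))) ` {n. wt i n = 1} = {(k,l). psi k l = 1}"
    proof safe
      fix k l assume "psi k l = 1"
      moreover obtain n where "(k, l) = (i - fst (site n), - snd (site n))"
        using surjD[OF surj, of "(k,l)"] by blast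
      ultimately show "(k, l) \<in> (\<lambda>n. (i - fst (site n), - snd (site n))) ` {n. wt i n = 1}"
        by (auto simp: wt_def)
    qed (simp add: wt_def)
  qed (auto intro: inj_on_subset)
  then show "card {n. wt i n = 1} = card {(k,l). psi k l = 1}" by (rule bij_betw_same_card)
qed

text \<open>The finite set of maximal lags is not invariant under a nontrivial translation, so
  \<open>\<sigma> i 0\<close> and \<open>\<sigma> j 0\<close> never share all their dominant innovations.\<close>

lemma dominant_not_shared:
  assumes "i \<noteq> j"
  shows "\<not> {n. wt i n = 1} \<subseteq> {n. wt j n = 1}"
proof
  assume sub: "{n. wt i n = 1} \<subseteq> {n. wt j n = 1}"
  \<comment> \<open>Infinite sets have \<open>card\<close> 0, but this cardinality equals that of a
    finite nonempty set.\<close>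
  have fin: "finite {(k,l). psi k l = 1}"
    using card_wt_1[of i] ex_wt_1[of i] card_eq_0_iff[of "{n. wt i n = 1}"] card_eq_0_iff[of "{(k,l). psi k l = 1}"] by auto
  have shift: "psi (k + (j - i)) l = 1" if kl: "psi k l = 1" for k l
  proof -
    obtain n where n: "(k, l) = (i - fst (site n), - snd (site n))"
      using surjD[OF bij_is_surj[OF bij_lag[of i]], of "(k, l)"] by blast
    then have "wt i n = 1" using kl by (simp add: wt_def)
    then have "wt j n = 1" using sub by blast
    moreover have "k + (j - i) = j - fst (site n)" using n by simp
    ultimately show ?thesis using n by (simp only: wt_def prod.inject)
  qed
  obtain k l where kl: "psi k l = 1" using psi_max by blast
  \<comment> \<open>Iterating the translation by j - i yields infinitely many lags at which
    \<open>psi\<close> is 1.\<close>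
  have "psi (k + int m * (j - i)) l = 1" for m
  proof (induction m)
    case (Suc m)
    from shift[OF this] show ?case by (simp add: algebra_simps)
  qed (simp add: kl)
  then have "range (\<lambda>m. (k + int m * (j - i), l)) \<subseteq> {(k,l). psi k l = 1}" by auto
  moreover have "inj (\<lambda>m. (k + int m * (j - i), l))" using assms by (auto simp: inj_def)
  ultimately show False using fin by (metis finite_subset finite_imageD infinite_UNIV_nat)
qed

text \<open>The product is controlled by the \<open>card B\<close> innovations dominant in both
  rows, whereas each single row has at least one more dominant innovation. An infinite \<alpha>-th
  moment makes the tail with one more factor heavier by any prescribed constant.\<close>

lemma dominated_by_infinite_moment:
  assumes ij: "i \<noteq> j" and inf: "(\<integral>\<^sup>+\<omega>. ennreal (exp (\<alpha> * eta 0 0 \<omega>)) \<partial>M) = \<infinity>"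
    and B: "B = {n. wt i n + wt j n = 2}" "B \<noteq> {}"
    and c: "0 < c" "c < 2" "\<And>n. n \<notin> B \<Longrightarrow> wt i n + wt j n \<le> c"
    and pos: "0 < x1" "0 < upper_tail (\<lambda>\<omega>. \<bar>X 1 0 \<omega>\<bar>) x1" and e: "0 < e"
  shows "\<exists>v. \<forall>x\<ge>v. upper_tail (\<lambda>\<omega>. sqrt \<bar>X i 0 \<omega> * X j 0 \<omega>\<bar>) x \<le> e * upper_tail (\<lambda>\<omega>. \<bar>X 1 0 \<omega>\<bar>) x"
proof -
  let ?G = "upper_tail (\<lambda>\<omega>. \<bar>X 1 0 \<omega>\<bar>)"
  let ?A = "\<lambda>\<omega>. sqrt (\<sigma> i 0 \<omega> * \<sigma> j 0 \<omega>)" and ?V = "\<lambda>\<omega>. sqrt \<bar>Z i 0 \<omega> * Z j 0 \<omega>\<bar>"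
  have adm: "admissible (\<lambda>n. wt i n + wt j n)" by (intro admissible_add admissible_wt)
  have B1: "wt i n = 1 \<and> wt j n = 1" if "n \<in> B" for n
    using that wt_bounds[of i n] wt_bounds[of j n] unfolding B(1) by auto
  then have sub: "B \<subseteq> {n. wt i n = 1}" by auto
  have "B \<noteq> {n. wt i n = 1}" using dominant_not_shared[OF ij] B1 by auto
  then have "card B < card {n. wt i n = 1}" using sub card_wt_1(1) by (intro psubset_card_mono) auto
  \<comment> \<open>The comparison moves from row i to row 1, whose entry \<open>X 1 0\<close>
    defines the normalization.\<close>
  then have "Suc (card B) \<le> card {n. wt 1 n = 1}" by (simp add: card_wt_1(2))
  then obtain S where S: "S \<subseteq> {n. wt 1 n = 1}" "card S = Suc (card B)" "finite S"
    by (rule obtain_subset_with_card_n)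
  have finB: "finite B" using sub card_wt_1(1) finite_subset by blast
  then obtain m where m: "card B = Suc m" using B(2) by (cases "card B") auto

  have "\<alpha> < min (2 * \<alpha> / c) (2 * \<alpha>)" using alpha c by (auto simp: field_simps)
  then obtain \<beta> where \<beta>: "\<alpha> < \<beta>" "\<beta> < min (2 * \<alpha> / c) (2 * \<alpha>)" using dense by blast
  then have bc: "\<beta> * c / 2 < \<alpha>" using c by (simp add: field_simps)
  let ?T = "\<lambda>\<omega>. exp (wsum (indicator {..<card B}) \<omega>)"
  obtain C1 where C1: "0 \<le> C1" "\<And>x. 0 < x \<Longrightarrow> upper_tail (\<lambda>\<omega>. sqrt (exp (wsum (\<lambda>n. wt i n + wt j n) \<omega>))) x \<le> C1 * F (card B) x"
    using upper_tail_wsum_le_F[OF adm finB B(2) _ c(3) c(1) \<beta>(1) bc] B(1) by auto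
  have "upper_tail ?A x = upper_tail (\<lambda>\<omega>. sqrt (exp (wsum (\<lambda>n. wt i n + wt j n) \<omega>))) x" for x
  proof (rule upper_tail_cong_AE)
    show "AE \<omega> in M. ?A \<omega> = sqrt (exp (wsum (\<lambda>n. wt i n + wt j n) \<omega>))"
      using wsum_add[OF admissible_wt[of i] admissible_wt[of j]] sigma_eq_wsum[of i] sigma_eq_wsum[of j]
      by eventually_elim (simp add: exp_add)
  qed measurable
  then have domA: "upper_tail ?A x \<le> C1 * F (card B) x" if "0 < x" for x using C1(2)[OF that] by simp
  have "\<exists>C2\<ge>0. \<forall>x>0. upper_tail (\<lambda>\<omega>. ?A \<omega> * ?V \<omega>) x \<le> C2 * F (card B) x"
  proof (rule upper_tail_mult_le[OF _ _ _ indep_sqrt_XX _ _ domA C1(1)])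
    show "potter_bound \<beta> ?T" using m \<beta> by (intro potter_F) auto
    show "integrable M (\<lambda>\<omega>. ?V \<omega> powr \<beta>)"
      using \<beta> alpha delta by (intro ZZ_moment ij) auto
  qed (use \<beta> alpha in auto)
  then obtain C2 where C2: "0 \<le> C2" "\<And>x. 0 < x \<Longrightarrow> upper_tail (\<lambda>\<omega>. sqrt \<bar>X i 0 \<omega> * X j 0 \<omega>\<bar>) x \<le> C2 * F (card B) x"
    unfolding sqrt_XX by blast

  have "S \<noteq> {}" using S(2) by auto
  obtain c1 where c1: "0 < c1" "\<And>x. 0 < x \<Longrightarrow> c1 * F (card S) x \<le> upper_tail (\<lambda>\<omega>. exp (wsum (wt 1) \<omega>)) x"
    using F_le_upper_tail_wsum[OF admissible_wt[of 1] S(3) \<open>S \<noteq> {}\<close>] S(1) by auto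
  have "upper_tail (\<sigma> 1 0) x = upper_tail (\<lambda>\<omega>. exp (wsum (wt 1) \<omega>)) x" for x
    using sigma_eq_wsum[of 1] by (intro upper_tail_cong_AE) measurable
  then have domS: "c1 * F (card S) x \<le> upper_tail (\<sigma> 1 0) x" if "0 < x" for x using c1(2)[OF that] by simp
  have "\<exists>c2>0. \<forall>x>0. c2 * F (card S) x \<le> upper_tail (\<lambda>\<omega>. \<sigma> 1 0 \<omega> * \<bar>Z 1 0 \<omega>\<bar>) x"
  proof (rule upper_tail_mult_ge[OF _ _ indep_sigma_absZ _ _ domS c1(1)])
    show "potter_bound \<beta> (\<lambda>\<omega>. exp (wsum (indicator {..<card S}) \<omega>))"
      using S(2) \<beta> by (intro potter_F) auto
    \<comment> \<open>A positive tail of \<open>X\<close> somewhere above 0 means that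
      \<open>Z\<close> is nonzero with positive probability, as the lower tail bound
      requires.\<close>
    have "upper_tail (\<lambda>\<omega>. \<bar>X 1 0 \<omega>\<bar>) x1 \<le> upper_tail (\<lambda>\<omega>. \<bar>Z 1 0 \<omega>\<bar>) 0"
      using pos(1) by (intro upper_tail_mono_AE) (auto simp: sv_X_def)
    then show "0 < upper_tail (\<lambda>\<omega>. \<bar>Z 1 0 \<omega>\<bar>) 0" using pos(2) by simp
  qed auto
  then obtain c2 where c2: "0 < c2" "\<And>x. 0 < x \<Longrightarrow> c2 * F (Suc (card B)) x \<le> ?G x"
    unfolding abs_X S(2) by blast

  \<comment> \<open>Chosen so that \<open>e * c2 * N\<close> equals \<open>C2 + 1\<close>; adding 1
    keeps \<open>N\<close> positive when \<open>C2\<close> is 0.\<close>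
  define N where "N = (C2 + 1) / (e * c2)"
  have N: "0 < N" unfolding N_def using C2(1) e c2(1) by auto
  have "(\<integral>\<^sup>+\<omega>. ennreal (exp (\<alpha> * eps 0 0 \<omega>)) \<partial>M) = \<infinity>"
    using inf exp_eta_moment_eps by simp
  from F_Suc_dominates[OF this N, of m]
  obtain v where v: "\<And>x. v \<le> x \<Longrightarrow> N * F (Suc m) x \<le> F (Suc (Suc m)) x"
    by (auto simp: eventually_at_top_linorder)
  show ?thesis
  proof (intro exI[of _ "max v 1"] allI impI)
    fix x assume x: "max v 1 \<le> x"
    have "upper_tail (\<lambda>\<omega>. sqrt \<bar>X i 0 \<omega> * X j 0 \<omega>\<bar>) x \<le> C2 * F (card B) x"
      using x by (intro C2) auto
    also have "\<dots> \<le> (C2 + 1) * F (card B) x" by (intro mult_right_mono upper_tail_nonneg) auto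
    also have "\<dots> = e * c2 * (N * F (Suc m) x)" using e c2(1) by (simp add: N_def m)
    also have "\<dots> \<le> e * c2 * F (Suc (Suc m)) x"
      using e c2(1) v x by (intro mult_left_mono) auto
    also have "\<dots> = e * (c2 * F (Suc (card B)) x)" by (simp add: m)
    also have "\<dots> \<le> e * ?G x" using e x by (intro mult_left_mono c2) auto
    finally show "upper_tail (\<lambda>\<omega>. sqrt \<bar>X i 0 \<omega> * X j 0 \<omega>\<bar>) x \<le> e * ?G x" .
  qed
qed

text \<open>As the combined weights tend to 0, those different from 2 stay below a constant c < 2.
  If no weight is 2, the moment argument applies; otherwise \<open>psi_sup\<close> reaches 2 and the
  hypothesis leaves the infinite moment.\<close>

lemma dominated:
  assumes ij: "i \<noteq> j"
    and alt: "psi_sup psi i j < 2 \<or> (\<integral>\<^sup>+\<omega>. ennreal (exp (\<alpha> * eta 0 0 \<omega>)) \<partial>M) = \<infinity>"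
    and pos: "0 < x1" "0 < upper_tail (\<lambda>\<omega>. \<bar>X 1 0 \<omega>\<bar>) x1" and e: "0 < e"
  shows "\<exists>v. \<forall>x\<ge>v. upper_tail (\<lambda>\<omega>. sqrt \<bar>X i 0 \<omega> * X j 0 \<omega>\<bar>) x \<le> e * upper_tail (\<lambda>\<omega>. \<bar>X 1 0 \<omega>\<bar>) x"
proof -
  define w where "w n = wt i n + wt j n" for n
  define B where "B = {n. w n = 2}"
  have w2: "w n \<le> 2" for n using wt_bounds(2)[of i n] wt_bounds(2)[of j n] by (simp add: w_def)
  have "w \<longlonglongrightarrow> 0"
    unfolding w_def[abs_def] by (intro summable_LIMSEQ_zero summable_add wt_summable)
  then have "\<forall>\<^sub>F n in sequentially. w n < 1" by (rule order_tendstoD) simp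
  then obtain N where N: "\<And>n. N \<le> n \<Longrightarrow> w n < 1" by (auto simp: eventually_sequentially)
  \<comment> \<open>The maximum covers the finitely many indices below \<open>N\<close>; the
    inserted 1 bounds all later weights and keeps the set nonempty.\<close>
  define c where "c = Max (insert 1 (w ` ({..<N} - B)))"
  have fin: "finite (insert 1 (w ` ({..<N} - B)))" by simp
  have "c \<in> insert 1 (w ` ({..<N} - B))" unfolding c_def by (rule Max_in) auto
  then have c2: "c < 2" using w2 by (auto simp: B_def order_less_le)
  have c1: "1 \<le> c" unfolding c_def by (rule Max_ge) auto
  have cw: "w n \<le> c" if "n \<notin> B" for n
  proof (cases "n < N")
    case True
    then show ?thesis unfolding c_def using that by (intro Max_ge) auto
  next
    case False
    then show ?thesis using N[of n] c1 by simp
  qed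
  show ?thesis
  proof (cases "B = {}")
    case True
    then show ?thesis using c1 c2 cw by (intro dominated_by_moment[OF ij _ _ _ pos e, of c]) (auto simp: w_def)
  next
    case False
    then obtain n where "w n = 2" by (auto simp: B_def)
    then have "\<not> psi_sup psi i j < 2" using psi_le_psi_sup[of i n j] by (simp add: w_def)
    with alt have "(\<integral>\<^sup>+\<omega>. ennreal (exp (\<alpha> * eta 0 0 \<omega>)) \<partial>M) = \<infinity>" by blast
    then show ?thesis using False c1 c2 cw
      by (intro dominated_by_infinite_moment[OF ij _ _ False _ _ _ pos e, of c]) (auto simp: w_def B_def)
  qed
qed

text \<open>Flipping the sign of the single variable \<open>Z i t\<close> preserves the joint law of the noise and the
  volatilities, but reverses the sign of \<open>X i t * X j t\<close> and no other product.\<close>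

lemma truncated_products_orthogonal:
  assumes sym: "distr M borel (Z 0 0) = distr M borel (\<lambda>\<omega>. - Z 0 0 \<omega>)"
    and ij: "i \<noteq> j" and st: "s \<noteq> t"
  shows "expectation (\<lambda>\<omega>. (if \<bar>X i s \<omega> * X j s \<omega>\<bar> \<le> b then X i s \<omega> * X j s \<omega> else 0)
    * (if \<bar>X i t \<omega> * X j t \<omega>\<bar> \<le> b then X i t \<omega> * X j t \<omega> else 0)) = 0"
proof -
  let ?P = "PiM (UNIV :: (int \<times> int) set) (\<lambda>_. borel :: real measure)"
  define \<tau> where "\<tau> y = (if \<bar>y\<bar> \<le> b then y else 0)" for y :: real
  have \<tau>_neg: "\<tau> (- y) = - \<tau> y" for y by (simp add: \<tau>_def)
  have [measurable]: "\<tau> \<in> borel_measurable borel" unfolding \<tau>_def[abs_def] by measurable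
  define Zf where "Zf \<omega> = (\<lambda>(i,t). Z i t \<omega>)" for \<omega>
  define Sf where "Sf \<omega> = (\<lambda>(i,t). \<sigma> i t \<omega>)" for \<omega>
  define flip where "flip z = (\<lambda>p. if p = (i,t) then - z p else z p :: real)" for z :: "int \<times> int \<Rightarrow> real"
  define h where "h p = \<tau> (snd p (i,s) * fst p (i,s) * (snd p (j,s) * fst p (j,s)))
      * \<tau> (snd p (i,t) * fst p (i,t) * (snd p (j,t) * fst p (j,t)))"
    for p :: "(int \<times> int \<Rightarrow> real) \<times> (int \<times> int \<Rightarrow> real)"
  have Zf_eq: "Zf = (\<lambda>\<omega> p. Z (fst p) (snd p) \<omega>)" by (simp add: fun_eq_iff Zf_def)
  have ind: "indep_var ?P Zf ?P Sf" using Z_sigma_indep by (simp add: Zf_def[abs_def] Sf_def[abs_def])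
  then have [measurable]: "Zf \<in> measurable M ?P" "Sf \<in> measurable M ?P"
    using indep_var_rv1 indep_var_rv2 by blast+
  have [measurable]: "flip \<in> measurable ?P ?P"
    unfolding flip_def[abs_def] by (intro measurable_PiM_single') (auto simp: space_PiM)
  have [measurable]: "h \<in> borel_measurable (?P \<Otimes>\<^sub>M ?P)" unfolding h_def[abs_def] by measurable
  have neg: "distr M borel (\<lambda>\<omega>. - Z a u \<omega>) = distr M borel (Z 0 0)" for a u
  proof -
    have "distr M borel (\<lambda>\<omega>. - Z a u \<omega>) = distr (distr M borel (Z a u)) borel uminus" for a u
      by (subst distr_distr) (auto simp: comp_def)
    then show ?thesis using Z_ident[of a u] sym by metis
  qed
  \<comment> \<open>By symmetry each component of the flipped field keeps the law of
    \<open>Z 0 0\<close>, and independence is unaffected, so both fields have the same product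
    law.\<close>
  have "distr M ?P (\<lambda>\<omega>. flip (Zf \<omega>)) = distr M ?P Zf"
  proof -
    have "indep_vars (\<lambda>_. borel) (\<lambda>p \<omega>. if p = (i,t) then - (case p of (i,t) \<Rightarrow> Z i t) \<omega> else (case p of (i,t) \<Rightarrow> Z i t) \<omega>) UNIV"
      by (rule indep_vars_compose2[OF Z_indep, where Y="\<lambda>p x. if p = (i,t) then - x else x"]) auto
    moreover have "distr M borel (\<lambda>\<omega>. if p = (i,t) then - (case p of (i,t) \<Rightarrow> Z i t) \<omega> else (case p of (i,t) \<Rightarrow> Z i t) \<omega>)
        = distr M borel (Z 0 0)" for p
      using neg Z_ident by (cases p; cases "p = (i,t)") auto
    ultimately have "distr M ?P (\<lambda>\<omega> p. if p = (i,t) then - (case p of (i,t) \<Rightarrow> Z i t) \<omega> else (case p of (i,t) \<Rightarrow> Z i t) \<omega>)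
        = PiM UNIV (\<lambda>_. distr M borel (Z 0 0))"
      by (rule distr_family_inj[where f="\<lambda>p. p"]) simp
    then have "distr M ?P (\<lambda>\<omega>. flip (Zf \<omega>)) = PiM UNIV (\<lambda>_. distr M borel (Z 0 0))"
      by (simp add: flip_def Zf_def case_prod_beta cong: if_cong)
    also have "\<dots> = distr M ?P Zf"
      using distr_family_inj[OF Z_indep, of "distr M borel (Z 0 0)" id] Z_ident
      by (simp add: Zf_eq case_prod_beta)
    finally show ?thesis .
  qed
  moreover have "indep_var ?P (\<lambda>\<omega>. flip (Zf \<omega>)) ?P Sf"
    using indep_var_compose[OF ind, of flip ?P id ?P] by (simp add: comp_def)
  ultimately have "distr M (?P \<Otimes>\<^sub>M ?P) (\<lambda>\<omega>. (flip (Zf \<omega>), Sf \<omega>)) = distr M (?P \<Otimes>\<^sub>M ?P) (\<lambda>\<omega>. (Zf \<omega>, Sf \<omega>))"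
    using ind by (simp add: indep_var_distribution_eq)
  then have "(\<integral>p. h p \<partial>distr M (?P \<Otimes>\<^sub>M ?P) (\<lambda>\<omega>. (flip (Zf \<omega>), Sf \<omega>))) = (\<integral>p. h p \<partial>distr M (?P \<Otimes>\<^sub>M ?P) (\<lambda>\<omega>. (Zf \<omega>, Sf \<omega>)))"
    by simp
  then have "expectation (\<lambda>\<omega>. h (flip (Zf \<omega>), Sf \<omega>)) = expectation (\<lambda>\<omega>. h (Zf \<omega>, Sf \<omega>))"
    by (simp add: integral_distr)
  \<comment> \<open>Since i and j differ, the flipped coordinate occurs once in the product at time
    t; since s and t differ, it does not occur in the product at time s. The truncation \<tau> is
    odd.\<close>
  moreover have "h (flip z, v) = - h (z, v)" for z v
    using ij st by (simp add: h_def flip_def \<tau>_neg)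
  ultimately have "expectation (\<lambda>\<omega>. h (Zf \<omega>, Sf \<omega>)) = 0" by simp
  then show ?thesis by (simp add: h_def Zf_def Sf_def \<tau>_def sv_X_def cong: if_cong)
qed

end

section \<open>Convergence in probability\<close>

context sv_model
begin

text \<open>If \<open>X\<close> vanished almost surely, the tail would take only the values 0 and 1,
  so \<open>n * ?G (a n)\<close> would be 0 or n and could not tend to 1.\<close>

lemma ex_positive_tail:
  assumes lim: "(\<lambda>n. real n * upper_tail (\<lambda>\<omega>. \<bar>X 1 0 \<omega>\<bar>) (a n)) \<longlonglongrightarrow> 1"
  obtains x1 where "0 < x1" "0 < upper_tail (\<lambda>\<omega>. \<bar>X 1 0 \<omega>\<bar>) x1"
proof -
  let ?G = "upper_tail (\<lambda>\<omega>. \<bar>X 1 0 \<omega>\<bar>)"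
  have "0 < ?G 0"
  proof (rule ccontr)
    assume "\<not> 0 < ?G 0"
    then have "?G x = 0" if "0 \<le> x" for x
      using upper_tail_antimono[of "\<lambda>\<omega>. \<bar>X 1 0 \<omega>\<bar>" 0 x] upper_tail_nonneg[of "\<lambda>\<omega>. \<bar>X 1 0 \<omega>\<bar>" x] that by simp
    moreover have "?G x = 1" if "x < 0" for x
    proof -
      have "{\<omega>\<in>space M. x < \<bar>X 1 0 \<omega>\<bar>} = space M" using that by auto
      then show ?thesis by (simp add: upper_tail_def prob_space)
    qed
    ultimately have G: "?G x = 0 \<or> ?G x = 1" for x by (cases "0 \<le> x") auto
    have "\<forall>\<^sub>F n in sequentially. real n * ?G (a n) < 3/2" "\<forall>\<^sub>F n in sequentially. 1/2 < real n * ?G (a n)"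
      by (rule order_tendstoD[OF lim], simp)+
    then have "\<forall>\<^sub>F n in sequentially. False"
      using eventually_ge_at_top[of 2]
    proof eventually_elim
      case (elim n)
      then show ?case using G[of "a n"] by auto
    qed
    then show False by simp
  qed
  then show thesis using upper_tail_pos_level[of "\<lambda>\<omega>. \<bar>X 1 0 \<omega>\<bar>"] that by auto
qed

lemma offdiagonal_negligible:
  assumes ij: "i \<noteq> j"
    and alt: "psi_sup psi i j < 2 \<or> (\<integral>\<^sup>+\<omega>. ennreal (exp (\<alpha> * eta 0 0 \<omega>)) \<partial>M) = \<infinity>"
    and regime: "\<alpha> < 2 \<or> \<alpha> < 4 \<and> distr M borel (Z 0 0) = distr M borel (\<lambda>\<omega>. - Z 0 0 \<omega>)"
    and lim: "(\<lambda>n. real n * upper_tail (\<lambda>\<omega>. \<bar>X 1 0 \<omega>\<bar>) (a n)) \<longlonglongrightarrow> 1" and d: "0 < d"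
  shows "(\<lambda>n. prob {\<omega>\<in>space M. d < \<bar>inverse ((a n)\<^sup>2) * (\<Sum>t=1..int n. X i t \<omega> * X j t \<omega>)\<bar>}) \<longlonglongrightarrow> 0"
proof -
  obtain x1 where pos: "0 < x1" "0 < upper_tail (\<lambda>\<omega>. \<bar>X 1 0 \<omega>\<bar>) x1"
    using ex_positive_tail[OF lim] by blast
  \<comment> \<open>The first-moment method serves \<alpha> < 2; for larger \<alpha> < 4 symmetry of
    \<open>Z\<close> permits the second-moment method.\<close>
  obtain m :: nat where m: "\<alpha> < real (2 * m)" "m = 1 \<or> m = 2 \<and> distr M borel (Z 0 0) = distr M borel (\<lambda>\<omega>. - Z 0 0 \<omega>)"
    using regime by force
  obtain \<beta> where \<beta>: "\<alpha> < \<beta>" "\<beta> < real (2 * m)" using dense[OF m(1)] by blast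
  show ?thesis
  proof (rule sum_negligible[OF _ potter_X[OF \<beta>(1)] _ \<beta>(2) pos lim _ _ _ d])
    show "\<exists>v. \<forall>x\<ge>v. \<forall>t. upper_tail (\<lambda>\<omega>. sqrt \<bar>X i t \<omega> * X j t \<omega>\<bar>) x \<le> e * upper_tail (\<lambda>\<omega>. \<bar>X 1 0 \<omega>\<bar>) x"
      if "0 < e" for e
      using dominated[OF ij alt pos that] by (subst upper_tail_XX_stationary) blast
    fix n and b e :: real assume be: "0 < b" "0 < e"
    show "prob {\<omega>\<in>space M. e < \<bar>\<Sum>t=1..int n. X i t \<omega> * X j t \<omega>\<bar>}
      \<le> (\<Sum>t=1..int n. upper_tail (\<lambda>\<omega>. sqrt \<bar>X i t \<omega> * X j t \<omega>\<bar>) b)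
        + (\<Sum>t=1..int n. expectation (\<lambda>\<omega>. min (sqrt \<bar>X i t \<omega> * X j t \<omega>\<bar>) b ^ (2 * m))) / e ^ m"
      using m(2)
    proof
      assume "m = 1"
      then show ?thesis
        using tail_sum_abs_le[of "{1..int n}" "\<lambda>t \<omega>. X i t \<omega> * X j t \<omega>" b e] be by simp
    next
      assume "m = 2 \<and> distr M borel (Z 0 0) = distr M borel (\<lambda>\<omega>. - Z 0 0 \<omega>)"
      then show ?thesis
        using tail_sum_orthogonal_le[of "{1..int n}" "\<lambda>t \<omega>. X i t \<omega> * X j t \<omega>" b e] be
          truncated_products_orthogonal[OF _ ij]
        by simp
    qed
  qed (use \<beta> alpha in auto)
qed

end

section \<open>From single entries to the spectral norm\<close>

lemma spec_norm_le_sum_abs: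
  assumes "1 \<le> p"
  shows "\<bar>spec_norm p A\<bar> \<le> (\<Sum>i=1..int p. \<Sum>j=1..int p. \<bar>A i j\<bar>)"
proof -
  let ?I = "{1..int p}"
  let ?K = "\<Sum>i\<in>?I. \<Sum>j\<in>?I. \<bar>A i j\<bar>"
  let ?N = "\<lambda>x. sqrt (\<Sum>i\<in>?I. (\<Sum>j\<in>?I. A i j * x j)^2)"
  let ?S = "{?N x | x. (\<Sum>j\<in>?I. (x j)^2) = (1::real)}"
  have le: "?N x \<le> ?K" if x: "(\<Sum>j\<in>?I. (x j)^2) = (1::real)" for x
  proof -
    \<comment> \<open>Coordinates of a unit vector are at most 1 in absolute value, and the
      Euclidean norm is at most the sum of absolute values.\<close>
    have xj: "\<bar>x j\<bar> \<le> 1" if "j \<in> ?I" for j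
    proof -
      have "(x j)^2 \<le> (\<Sum>j\<in>?I. (x j)^2)" using that by (intro member_le_sum) auto
      then show ?thesis using x by (simp add: abs_square_le_1)
    qed
    have "?N x \<le> (\<Sum>i\<in>?I. \<bar>\<Sum>j\<in>?I. A i j * x j\<bar>)"
      using L2_set_le_sum_abs[of "\<lambda>i. \<Sum>j\<in>?I. A i j * x j" ?I] by (simp add: L2_set_def)
    also have "\<dots> \<le> ?K"
    proof (rule sum_mono)
      fix i
      have "\<bar>\<Sum>j\<in>?I. A i j * x j\<bar> \<le> (\<Sum>j\<in>?I. \<bar>A i j * x j\<bar>)" by (rule sum_abs)
      also have "\<dots> \<le> (\<Sum>j\<in>?I. \<bar>A i j\<bar>)"
      proof (rule sum_mono)
        fix j assume "j \<in> ?I"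
        from mult_left_mono[OF xj[OF this] abs_ge_zero[of "A i j"]]
        show "\<bar>A i j * x j\<bar> \<le> \<bar>A i j\<bar>" by (simp add: abs_mult)
      qed
      finally show "\<bar>\<Sum>j\<in>?I. A i j * x j\<bar> \<le> (\<Sum>j\<in>?I. \<bar>A i j\<bar>)" .
    qed
    finally show ?thesis .
  qed
  \<comment> \<open>A unit vector, available because p \<ge> 1, shows that the supremum is over a
    nonempty set and is nonnegative.\<close>
  define e :: "int \<Rightarrow> real" where "e j = (if j = 1 then 1 else 0)" for j
  have "(\<Sum>j\<in>?I. (e j)^2) = (\<Sum>j\<in>?I. if j = 1 then 1 else 0)"
    by (intro sum.cong) (auto simp: e_def)
  also have "\<dots> = 1" using assms by simp
  finally have e: "(\<Sum>j\<in>?I. (e j)^2) = 1" .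
  then have mem: "?N e \<in> ?S" by blast
  have bdd: "bdd_above ?S" using le by (auto intro!: bdd_aboveI[of _ ?K])
  have "Sup ?S \<le> ?K" using mem le by (intro cSup_least) auto
  moreover have "0 \<le> ?N e" by (intro real_sqrt_ge_zero sum_nonneg) auto
  then have "0 \<le> Sup ?S" using cSup_upper[OF mem bdd] by linarith
  ultimately show ?thesis unfolding spec_norm_def by simp
qed

lemma (in prob_space) conv_prob_zero_spec_norm:
  fixes S :: "nat \<Rightarrow> int \<Rightarrow> int \<Rightarrow> 'a \<Rightarrow> real" and a :: "nat \<Rightarrow> real"
  assumes p: "1 \<le> p" and meas [measurable]: "\<And>n i j. S n i j \<in> borel_measurable M"
    and negl: "\<And>i j d. (i, j) \<notin> J \<Longrightarrow> 1 \<le> i \<Longrightarrow> i \<le> int p \<Longrightarrow> 1 \<le> j \<Longrightarrow> j \<le> int p \<Longrightarrow> 0 < d \<Longrightarrow>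
      (\<lambda>n. prob {\<omega>\<in>space M. d < \<bar>inverse ((a n)\<^sup>2) * S n i j \<omega>\<bar>}) \<longlonglongrightarrow> 0"
  shows "conv_prob_zero M (\<lambda>n \<omega>. inverse ((a n)\<^sup>2) *
    spec_norm p (\<lambda>i j. S n i j \<omega> - (if (i, j) \<in> J then S n i j \<omega> else 0)))"
  unfolding conv_prob_zero_def
proof (intro allI impI)
  fix e :: real assume e: "0 < e"
  let ?I = "{1..int p}"
  \<comment> \<open>A union bound over the entries: if all p^2 normalized entries are at most e /
    p^2, the norm is at most e.\<close>
  define c where "c = e / (real p)\<^sup>2"
  have c: "0 < c" unfolding c_def using e p by simp
  define T where "T n i j \<omega> = (if (i, j) \<in> J then 0 else inverse ((a n)\<^sup>2) * S n i j \<omega>)" for n i j \<omega>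
  have [measurable]: "T n i j \<in> borel_measurable M" for n i j
    unfolding T_def[abs_def] by (cases "(i, j) \<in> J") auto
  define E where "E n i j = {\<omega>\<in>space M. c < \<bar>T n i j \<omega>\<bar>}" for n i j
  have [measurable]: "E n i j \<in> sets M" for n i j unfolding E_def by measurable
  let ?bad = "\<lambda>n. {\<omega>\<in>space M. e < \<bar>inverse ((a n)\<^sup>2) *
    spec_norm p (\<lambda>i j. S n i j \<omega> - (if (i, j) \<in> J then S n i j \<omega> else 0))\<bar>}"
  have sub: "?bad n \<subseteq> (\<Union>i\<in>?I. \<Union>j\<in>?I. E n i j)" for n
  proof (rule subsetI, rule ccontr)
    fix \<omega> assume \<omega>: "\<omega> \<in> ?bad n" "\<omega> \<notin> (\<Union>i\<in>?I. \<Union>j\<in>?I. E n i j)"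
    let ?D = "\<lambda>i j. S n i j \<omega> - (if (i, j) \<in> J then S n i j \<omega> else 0)"
    have "\<bar>inverse ((a n)\<^sup>2) * spec_norm p ?D\<bar> \<le> inverse ((a n)\<^sup>2) * (\<Sum>i\<in>?I. \<Sum>j\<in>?I. \<bar>?D i j\<bar>)"
      using spec_norm_le_sum_abs[OF p, of ?D] by (simp add: abs_mult mult_left_mono)
    also have "\<dots> = (\<Sum>i\<in>?I. \<Sum>j\<in>?I. \<bar>T n i j \<omega>\<bar>)"
      unfolding sum_distrib_left by (intro sum.cong refl) (auto simp: T_def abs_mult)
    also have "\<dots> \<le> (\<Sum>i\<in>?I. \<Sum>j\<in>?I. c)"
      using \<omega> by (intro sum_mono) (auto simp: E_def not_less)
    also have "\<dots> = e" using p by (simp add: c_def power2_eq_square)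
    finally show False using \<omega> by simp
  qed
  have lim: "(\<lambda>n. \<Sum>i\<in>?I. \<Sum>j\<in>?I. prob (E n i j)) \<longlonglongrightarrow> 0"
  proof (intro tendsto_null_sum)
    fix i j assume ij: "i \<in> ?I" "j \<in> ?I"
    show "(\<lambda>n. prob (E n i j)) \<longlonglongrightarrow> 0"
      using negl[of i j c] ij c by (cases "(i, j) \<in> J") (auto simp: E_def T_def)
  qed
  show "(\<lambda>n. prob (?bad n)) \<longlonglongrightarrow> 0"
  proof (rule tendsto_sandwich[OF _ _ tendsto_const lim])
    show "\<forall>\<^sub>F n in sequentially. prob (?bad n) \<le> (\<Sum>i\<in>?I. \<Sum>j\<in>?I. prob (E n i j))"
    proof (intro always_eventually allI)
      fix n
      have "prob (?bad n) \<le> prob (\<Union>i\<in>?I. \<Union>j\<in>?I. E n i j)"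
        by (intro finite_measure_mono sub sets.finite_UN) auto
      also have "\<dots> \<le> (\<Sum>i\<in>?I. prob (\<Union>j\<in>?I. E n i j))"
        by (intro finite_measure_subadditive_finite) auto
      also have "\<dots> \<le> (\<Sum>i\<in>?I. \<Sum>j\<in>?I. prob (E n i j))"
        by (intro sum_mono finite_measure_subadditive_finite) auto
      finally show "prob (?bad n) \<le> (\<Sum>i\<in>?I. \<Sum>j\<in>?I. prob (E n i j))" .
    qed
  qed auto
qed

theorem theorem4p8:
  fixes M :: "'a measure" and Z eta :: "int \<Rightarrow> int \<Rightarrow> 'a \<Rightarrow> real"
    and psi :: "int \<Rightarrow> int \<Rightarrow> real" and \<alpha> :: real and p :: nat
  assumes prob: "prob_space M"
    and Z_indep: "prob_space.indep_vars M (\<lambda>_. borel) (\<lambda>(i,t). Z i t) UNIV"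
    and Z_ident: "\<And>i t. distr M borel (Z i t) = distr M borel (Z 0 0)"
    and eta_indep: "prob_space.indep_vars M (\<lambda>_. borel) (\<lambda>(i,t). eta i t) UNIV"
    and eta_ident: "\<And>i t. distr M borel (eta i t) = distr M borel (eta 0 0)"
    and Z_sigma_indep: "prob_space.indep_var M
          (PiM (UNIV :: (int \<times> int) set) (\<lambda>_. borel)) (\<lambda>\<omega> (i,t). Z i t \<omega>)
          (PiM (UNIV :: (int \<times> int) set) (\<lambda>_. borel)) (\<lambda>\<omega> (i,t). sv_sigma psi eta i t \<omega>)"
    and psi_nonneg: "\<And>k l. psi k l \<ge> 0"
    and psi_le1: "\<And>k l. psi k l \<le> 1"
    and psi_max: "\<exists>k l. psi k l = 1"
    and psi_summable: "(\<lambda>(k,l). psi k l) summable_on UNIV"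
    and sigma_welldef: "\<And>i t. AE \<omega> in M. (\<lambda>(k,l). \<bar>psi k l * eta (i - k) (t - l) \<omega>\<bar>) summable_on UNIV"
    and regvar: "\<exists>L. slowly_varying L \<and>
          (\<forall>x>0. measure M {\<omega>\<in>space M. exp (eta 0 0 \<omega>) > x} = x powr (-\<alpha>) * L x)"
    and tail_cond: "(\<integral>\<^sup>+\<omega>. ennreal (exp (\<alpha> * eta 0 0 \<omega>)) \<partial>M) = \<infinity> \<or>
          (\<exists>c>0. ((\<lambda>x. measure M {\<omega>\<in>space M. eta 0 0 \<omega> + eta 1 0 \<omega> > x}
                     / measure M {\<omega>\<in>space M. eta 0 0 \<omega> > x}) \<longlongrightarrow> c) at_top)"
    and p_pos: "p \<ge> 1"
    and Z_moment: "\<exists>\<delta>>0. (\<integral>\<^sup>+\<omega>. ennreal (\<bar>Z 0 0 \<omega>\<bar> powr (\<alpha> + \<delta>)) \<partial>M) < \<infinity>"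
    and mixing: "\<And>i j. 1 \<le> i \<Longrightarrow> i \<le> int p \<Longrightarrow> 1 \<le> j \<Longrightarrow> j \<le> int p \<Longrightarrow>
          \<exists>\<delta>'>0. (\<lambda>h. mixing_coeff M (\<lambda>t \<omega>. sv_sigma psi eta i t \<omega> * sv_sigma psi eta j t \<omega>) h)
                    \<in> o(\<lambda>h. real h powr (-\<delta>'))"
    and cases: "\<And>i j. 1 \<le> i \<Longrightarrow> i \<le> int p \<Longrightarrow> 1 \<le> j \<Longrightarrow> j \<le> int p \<Longrightarrow>
          \<alpha> / psi_sup psi i j < 1
        \<or> (i \<noteq> j \<and> 1 \<le> \<alpha> / psi_sup psi i j \<and> \<alpha> / psi_sup psi i j < 2 \<and>
             distr M borel (Z 0 0) = distr M borel (\<lambda>\<omega>. - Z 0 0 \<omega>))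
        \<or> (i = j \<and> 1 < \<alpha> / 2 \<and> \<alpha> / 2 < 2 \<and>
             (\<exists>(r :: nat \<Rightarrow> nat) (b :: nat \<Rightarrow> real).
                ((\<lambda>n. real n * measure M {\<omega>\<in>space M.
                    \<bar>sv_X psi eta Z i 0 \<omega> * sv_X psi eta Z j 0 \<omega>\<bar> > b n}) \<longlonglongrightarrow> 1) \<and>
                ((\<lambda>n. real n * real (r n) / (b n)\<^sup>2) \<longlonglongrightarrow> 0) \<and>
                (\<exists>C::real. \<forall>n. ennreal (real n) *
                   (\<Sum>h. ennreal (mixing_coeff M
                      (\<lambda>t \<omega>. sv_sigma psi eta i t \<omega> * sv_sigma psi eta j t \<omega>) (r n + h))) \<le> ennreal C)))"
    and alpha_range: "0 < \<alpha>" "\<alpha> < 4"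
  shows "\<forall>a :: nat \<Rightarrow> real.
           ((\<lambda>n. real n * measure M {\<omega>\<in>space M. \<bar>sv_X psi eta Z 1 0 \<omega>\<bar> > a n}) \<longlonglongrightarrow> 1) \<longrightarrow>
           conv_prob_zero M (\<lambda>n \<omega>. inverse ((a n)^2) * spec_norm p (\<lambda>i j.
              (\<Sum>t=1..int n. sv_X psi eta Z i t \<omega> * sv_X psi eta Z j t \<omega>)
              - (if (i,j) \<in> Gamma_p psi p
                 then (\<Sum>t=1..int n. sv_X psi eta Z i t \<omega> * sv_X psi eta Z j t \<omega>) else 0)))
         \<and> ((\<integral>\<^sup>+\<omega>. ennreal (exp (\<alpha> * eta 0 0 \<omega>)) \<partial>M) = \<infinity> \<longrightarrow>
           conv_prob_zero M (\<lambda>n \<omega>. inverse ((a n)^2) * spec_norm p (\<lambda>i j.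
              (\<Sum>t=1..int n. sv_X psi eta Z i t \<omega> * sv_X psi eta Z j t \<omega>)
              - (if i = j
                 then (\<Sum>t=1..int n. sv_X psi eta Z i t \<omega> * sv_X psi eta Z j t \<omega>) else 0))))"
proof -
  from prob interpret prob_space M .
  obtain L where L: "slowly_varying L"
    "\<And>x. 0 < x \<Longrightarrow> measure M {\<omega>\<in>space M. exp (eta 0 0 \<omega>) > x} = x powr (-\<alpha>) * L x"
    using regvar by blast
  obtain \<delta> where \<delta>: "0 < \<delta>" "(\<integral>\<^sup>+\<omega>. ennreal (\<bar>Z 0 0 \<omega>\<bar> powr (\<alpha> + \<delta>)) \<partial>M) < \<infinity>"
    using Z_moment by blast
  interpret sv_model M Z eta psi \<alpha> \<delta> L
    by unfold_locales
      (use Z_indep Z_ident eta_indep eta_ident Z_sigma_indep psi_nonneg psi_le1 psi_max psi_summable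
        sigma_welldef L \<delta> alpha_range in auto)
  \<comment> \<open>In the first regime \<alpha> < \<open>psi_sup psi i j\<close> \<le> 2; the
    second supplies symmetry, and the third is excluded off the diagonal.\<close>
  have pair_case: "\<alpha> < 2 \<or> \<alpha> < 4 \<and> distr M borel (Z 0 0) = distr M borel (\<lambda>\<omega>. - Z 0 0 \<omega>)"
    if "1 \<le> i" "i \<le> int p" "1 \<le> j" "j \<le> int p" "i \<noteq> j" for i j
  proof (cases "\<alpha> / psi_sup psi i j < 1")
    case True
    then have "\<alpha> < psi_sup psi i j" using psi_sup_ge[of i j] by simp
    then show ?thesis using psi_sup_le[of i j] by simp
  next
    case False
    then show ?thesis using cases[OF that(1-4)] that(5) alpha_range by blast
  qed
  show ?thesis
  proof (intro allI impI conjI)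
    fix a :: "nat \<Rightarrow> real"
    assume "(\<lambda>n. real n * measure M {\<omega>\<in>space M. \<bar>sv_X psi eta Z 1 0 \<omega>\<bar> > a n}) \<longlonglongrightarrow> 1"
    then have lim: "(\<lambda>n. real n * upper_tail (\<lambda>\<omega>. \<bar>X 1 0 \<omega>\<bar>) (a n)) \<longlonglongrightarrow> 1"
      by (simp add: upper_tail_def)
    have "conv_prob_zero M (\<lambda>n \<omega>. inverse ((a n)^2) * spec_norm p (\<lambda>i j.
        (\<Sum>t=1..int n. X i t \<omega> * X j t \<omega>)
        - (if (i,j) \<in> Gamma_p psi p then (\<Sum>t=1..int n. X i t \<omega> * X j t \<omega>) else 0)))"
    proof (rule conv_prob_zero_spec_norm[OF p_pos])
      fix i j and d :: real
      assume h: "(i, j) \<notin> Gamma_p psi p" "1 \<le> i" "i \<le> int p" "1 \<le> j" "j \<le> int p" "0 < d"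
      then have "psi_sup psi i j \<noteq> 2" by (simp add: Gamma_p_def)
      \<comment> \<open>A pair outside \<open>Gamma_p\<close> is automatically off-diagonal, since
        \<open>psi_sup psi i i\<close> is 2.\<close>
      then have "psi_sup psi i j < 2" "i \<noteq> j"
        using psi_sup_le[of i j] psi_sup_diag by auto
      then show "(\<lambda>n. prob {\<omega>\<in>space M. d < \<bar>inverse ((a n)\<^sup>2) * (\<Sum>t=1..int n. X i t \<omega> * X j t \<omega>)\<bar>}) \<longlonglongrightarrow> 0"
        using h pair_case by (intro offdiagonal_negligible lim) auto
    qed measurable
    then show "conv_prob_zero M (\<lambda>n \<omega>. inverse ((a n)^2) * spec_norm p (\<lambda>i j.
        (\<Sum>t=1..int n. sv_X psi eta Z i t \<omega> * sv_X psi eta Z j t \<omega>)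
        - (if (i,j) \<in> Gamma_p psi p
           then (\<Sum>t=1..int n. sv_X psi eta Z i t \<omega> * sv_X psi eta Z j t \<omega>) else 0)))" .
    assume inf: "(\<integral>\<^sup>+\<omega>. ennreal (exp (\<alpha> * eta 0 0 \<omega>)) \<partial>M) = \<infinity>"
    have "conv_prob_zero M (\<lambda>n \<omega>. inverse ((a n)^2) * spec_norm p (\<lambda>i j.
        (\<Sum>t=1..int n. X i t \<omega> * X j t \<omega>)
        - (if (i,j) \<in> {(i,j). i = j} then (\<Sum>t=1..int n. X i t \<omega> * X j t \<omega>) else 0)))"
    proof (rule conv_prob_zero_spec_norm[OF p_pos])
      fix i j :: int and d :: real
      assume h: "(i, j) \<notin> {(i,j). i = j}" "1 \<le> i" "i \<le> int p" "1 \<le> j" "j \<le> int p" "0 < d"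
      then show "(\<lambda>n. prob {\<omega>\<in>space M. d < \<bar>inverse ((a n)\<^sup>2) * (\<Sum>t=1..int n. X i t \<omega> * X j t \<omega>)\<bar>}) \<longlonglongrightarrow> 0"
        using pair_case inf by (intro offdiagonal_negligible lim) auto
    qed measurable
    then show "conv_prob_zero M (\<lambda>n \<omega>. inverse ((a n)^2) * spec_norm p (\<lambda>i j.
        (\<Sum>t=1..int n. sv_X psi eta Z i t \<omega> * sv_X psi eta Z j t \<omega>)
        - (if i = j
           then (\<Sum>t=1..int n. sv_X psi eta Z i t \<omega> * sv_X psi eta Z j t \<omega>) else 0)))"
      by simp
  qed
qed

end
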